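(* Let $X$ be a complex Banach space and suppose $T\in\mathcal{L}(X)$ is a Kreiss operator. Then $(I-T)^{\alpha}$ is of type $\alpha\pi/2$ for all $\alpha\in(0,1]$, and $I-(I-T)^{\alpha}$ is a Ritt operator for all $\alpha\in(0,1)$.
   Context: $T$ is a Kreiss operator if there is $c>0$ with $\|(\lambda I-T)^{-1}\|\le c(|\lambda|-1)^{-1}$ for all $\lambda\in\mathbb{C}$, $|\lambda|>1$. $T$ is power-bounded if $\sup_n\|T^n\|<\infty$, and Ritt if power-bounded with $\sup_n n\|T^n-T^{n+1}\|<\infty$. For $\omega\in[0,\pi)$, $\Lambda_\omega=\{z\ne0:|\mathrm{Arg}\,z|<\omega\}$, $\overline{\Lambda}_\omega=\{0\}\cup\{z:|\mathrm{Arg}\,z|\le\omega\}$; a densely defined closed operator $V$ is of type $\omega$ if $\sigma(V)\subseteq\overline{\Lambda}_\omega$ and $\sup_{\lambda\in\Lambda_{\pi-\omega-\varepsilon}}\|\lambda(\lambda I+V)^{-1}\|<\infty$ for every $\varepsilon\in(0,\pi-\omega)$. For an operator $V$ of type $\omega$ and $\alpha>0$, $V^\alpha$ is the fractional power in the standard sense of the theory of fractional powers of sectorial operators; here it is applied to $V=I-T$. *)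

theory Defs
  imports "HOL-Analysis.Analysis"
begin

class complex_banach = banach +
  fixes scaleC :: "complex \<Rightarrow> 'a \<Rightarrow> 'a"
  assumes scaleC_add_right: "scaleC a (x + y) = scaleC a x + scaleC a y"
    and scaleC_add_left: "scaleC (a + b) x = scaleC a x + scaleC b x"
    and scaleC_scaleC: "scaleC a (scaleC b x) = scaleC (a * b) x"
    and scaleC_one: "scaleC 1 x = x"
    and scaleC_of_real: "scaleC (complex_of_real r) x = scaleR r x"
    and norm_scaleC: "norm (scaleC a x) = cmod a * norm x"

definition clinear_op :: "('a::complex_banach \<Rightarrow>\<^sub>L 'a) \<Rightarrow> bool" where
  "clinear_op T \<longleftrightarrow> (\<forall>c x. blinfun_apply T (scaleC c x) = scaleC c (blinfun_apply T x))"

definition cscal :: "complex \<Rightarrow> ('a::complex_banach \<Rightarrow>\<^sub>L 'a)" where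
  "cscal c = Blinfun (\<lambda>x. scaleC c x)"

definition is_inverse_op :: "('a::real_normed_vector \<Rightarrow>\<^sub>L 'a) \<Rightarrow> ('a \<Rightarrow>\<^sub>L 'a) \<Rightarrow> bool" where
  "is_inverse_op R A \<longleftrightarrow> R o\<^sub>L A = id_blinfun \<and> A o\<^sub>L R = id_blinfun"

definition op_inverse :: "('a::real_normed_vector \<Rightarrow>\<^sub>L 'a) \<Rightarrow> ('a \<Rightarrow>\<^sub>L 'a)" where
  "op_inverse A = (THE R. is_inverse_op R A)"

fun op_pow :: "('a::real_normed_vector \<Rightarrow>\<^sub>L 'a) \<Rightarrow> nat \<Rightarrow> ('a \<Rightarrow>\<^sub>L 'a)" where
  "op_pow T 0 = id_blinfun"
| "op_pow T (Suc n) = T o\<^sub>L op_pow T n"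

definition op_spectrum :: "('a::complex_banach \<Rightarrow>\<^sub>L 'a) \<Rightarrow> complex set" where
  "op_spectrum T = {l. \<not> (\<exists>R. is_inverse_op R (cscal l - T))}"

definition kreiss_op :: "('a::complex_banach \<Rightarrow>\<^sub>L 'a) \<Rightarrow> bool" where
  "kreiss_op T \<longleftrightarrow> (\<exists>c>0. \<forall>l. cmod l > 1 \<longrightarrow>
      (\<exists>R. is_inverse_op R (cscal l - T) \<and> norm R \<le> c / (cmod l - 1)))"

definition power_bounded :: "('a::real_normed_vector \<Rightarrow>\<^sub>L 'a) \<Rightarrow> bool" where
  "power_bounded T \<longleftrightarrow> bounded (range (op_pow T))"

definition ritt_op :: "('a::real_normed_vector \<Rightarrow>\<^sub>L 'a) \<Rightarrow> bool" where
  "ritt_op T \<longleftrightarrow> power_bounded T \<and>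
     (\<exists>M. \<forall>n. real n * norm (op_pow T n - op_pow T (Suc n)) \<le> M)"

definition open_sector :: "real \<Rightarrow> complex set" where
  "open_sector \<omega> = {z. z \<noteq> 0 \<and> \<bar>Arg z\<bar> < \<omega>}"

definition closed_sector :: "real \<Rightarrow> complex set" where
  "closed_sector \<omega> = insert 0 {z. \<bar>Arg z\<bar> \<le> \<omega>}"

text \<open>For a bounded operator (automatically densely defined and closed): \<open>V\<close> is of type
\<open>\<omega>\<close>. The supremum condition includes that \<open>\<lambda> I + V\<close> is invertible on the sector
(which is anyway implied by the spectral condition).\<close>
definition op_of_type :: "('a::complex_banach \<Rightarrow>\<^sub>L 'a) \<Rightarrow> real \<Rightarrow> bool" where
  "op_of_type V \<omega> \<longleftrightarrow> op_spectrum V \<subseteq> closed_sector \<omega> \<and>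
     (\<forall>\<epsilon>. 0 < \<epsilon> \<and> \<epsilon> < pi - \<omega> \<longrightarrow>
        (\<exists>M. \<forall>l\<in>open_sector (pi - \<omega> - \<epsilon>).
            \<exists>R. is_inverse_op R (cscal l + V) \<and> norm (cscal l o\<^sub>L R) \<le> M))"

text \<open>Fractional powers \<open>V^\<alpha>\<close> of a bounded sectorial operator for \<open>0 < \<alpha> \<le> 1\<close>:
for \<open>0 < \<alpha> < 1\<close> by Balakrishnan's formula
\<open>V^\<alpha> = (sin (\<alpha>\<pi>)/\<pi>) \<integral>_0^\<infinity> t^(\<alpha>-1) (t + V)^(-1) V dt\<close>,
which agrees with the functional-calculus definition for sectorial operators,
and \<open>V^1 = V\<close>. Other exponents are not needed.\<close>
definition frac_pow :: "('a::complex_banach \<Rightarrow>\<^sub>L 'a) \<Rightarrow> real \<Rightarrow> ('a \<Rightarrow>\<^sub>L 'a)" where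
  "frac_pow V \<alpha> =
     (if \<alpha> = 1 then V
      else (sin (\<alpha> * pi) / pi) *\<^sub>R
        integral {0<..} (\<lambda>t::real. (t powr (\<alpha> - 1)) *\<^sub>R
            (op_inverse (cscal (complex_of_real t) + V) o\<^sub>L V)))"

end

theory Submission
  imports Defs "HOL-Complex_Analysis.Complex_Analysis"
begin

text \<open>
For a Kreiss operator \<open>T\<close> and a function \<open>f(z) = \<Sum> f\<^sub>k z\<^sup>k\<close> on the unit disc put \<open>f(rT) = \<Sum> f\<^sub>k r\<^sup>k T\<^sup>k\<close>
(\<open>0 \<le> r < 1\<close>), which is multiplicative in \<open>f\<close>. Writing the second derivative of \<open>u \<mapsto> f(uT)\<close> as the circular mean of
\<open>f''(\<rho> e\<^sup>i\<^sup>\<theta>) T\<^sup>2 (1 - \<rho> e\<^sup>-\<^sup>i\<^sup>\<theta> T)\<^sup>-\<^sup>1\<close> with \<open>\<rho>\<^sup>2 = u\<close>, and using Taylor's formula and the Kreiss condition, one bounds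
\<open>f(rT)\<close> uniformly in \<open>r\<close> by \<open>|f\<^sub>0|\<close>, \<open>|f\<^sub>1|\<close> and the area integral of \<open>|f''|\<close>. This integral is invariant under scaling
at the point \<open>1\<close>. For \<open>u = (1 - z)\<^sup>\<alpha>\<close> it is therefore bounded uniformly in \<open>n\<close> and \<open>\<lambda>\<close> for the functions \<open>(1 - u)\<^sup>n\<close>,
\<open>n u (1 - u)\<^sup>n\<close> and \<open>\<lambda> / (\<lambda> + u)\<close>; this gives the two Ritt conditions and the sectorial estimate for
\<open>(1 - rT)\<^sup>\<alpha>\<close>. As \<open>r\<close> tends to \<open>1\<close> these operators converge in norm to Balakrishnan's integral for \<open>(1 - T)\<^sup>\<alpha>\<close>.
\<close>

text \<open>The obstacle is that the Kreiss condition does not bound the powers \<open>t ^ k\<close>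
  uniformly, so \<open>fc f r\<close> cannot be estimated by the sum of the moduli of the
  coefficients of f. A circular mean against the resolvent alone is no better: the factor
  \<open>K / (1 - \<rho>)\<close> costs one power of the distance to the unit circle. Passing to
  second order repairs this, because the Taylor weight \<open>r - u\<close> is at most
  \<open>1 - u\<close> and pays for the resolvent. Pointwise, f'' is compared with |1 - z| to the
  power -\<beta>, where \<beta> is 2 - \<alpha> or 2 + \<alpha>. Since \<beta> > 1, the mean over a
  circle gains one power over the supremum. This is where \<alpha> < 1 enters; the exponent 1 is
  treated separately, straight from the resolvent. A function living at scale p needs both
  exponents: the first controls the points closer to 1 than the scale, the second those farther
  away. Integrated over all distances the two together give a bound free of p.\<close>

section \<open>Vector-valued integrals\<close>

lemma has_integral_suminf:
  fixes h :: "nat \<Rightarrow> real \<Rightarrow> 'b::banach"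
  assumes cont: "\<And>k. continuous_on {a..b} (h k)"
    and bound: "\<And>k x. x \<in> {a..b} \<Longrightarrow> norm (h k x) \<le> M k" and "summable M"
    and int: "\<And>k. (h k has_integral I k) {a..b}"
  shows "((\<lambda>x. \<Sum>k. h k x) has_integral (\<Sum>k. I k)) {a..b}"
proof -
  have u: "uniform_limit {a..b} (\<lambda>n x. \<Sum>k<n. h k x) (\<lambda>x. \<Sum>k. h k x) sequentially"
    using bound \<open>summable M\<close> by (rule Weierstrass_m_test)
  have c: "continuous_on {a..b} (\<lambda>x. \<Sum>k<n. h k x)" for n
    by (intro continuous_intros cont)
  obtain K J where K: "\<And>n. ((\<lambda>x. \<Sum>k<n. h k x) has_integral K n) {a..b}"
    and J: "((\<lambda>x. \<Sum>k. h k x) has_integral J) {a..b}" and KJ: "K \<longlonglongrightarrow> J"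
    by (rule uniform_limit_integral[OF u c]) (simp, rule that)
  have "K n = (\<Sum>k<n. I k)" for n
    using K[of n] by (rule has_integral_unique) (intro has_integral_sum int; simp)
  then have "K = (\<lambda>n. \<Sum>k<n. I k)" by blast
  then have "I sums J"
    using KJ by (simp add: sums_def)
  with J show ?thesis by (simp add: sums_iff)
qed

text \<open>The Henstock-Kurzweil integral asks for no absolute integrability, so limits of an
  antiderivative at both ends suffice. Continuing \<open>F\<close> by the constant \<open>A\<close>
  to the left of 0 makes it continuous there, and the fundamental theorem with the exceptional point
  0 applies on every large interval.\<close>

lemma has_integral_Ioi_vector_derivative:
  fixes F :: "real \<Rightarrow> 'b::banach"
  assumes deriv: "\<And>x. x > 0 \<Longrightarrow> (F has_vector_derivative f x) (at x)"
    and zero: "(F \<longlongrightarrow> A) (at_right 0)" and inf: "(F \<longlongrightarrow> B) at_top"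
  shows "(f has_integral (B - A)) {0<..}"
proof (subst has_integral', intro allI impI)
  fix e :: real assume "e > 0"
  with inf have "eventually (\<lambda>x. dist (F x) B < e) at_top"
    by (auto simp: tendsto_iff)
  then obtain N where N: "\<And>x. x \<ge> N \<Longrightarrow> dist (F x) B < e"
    by (auto simp: eventually_at_top_linorder)
  define N' where "N' = max N 1"
  show "\<exists>B'>0. \<forall>a b. ball 0 B' \<subseteq> cbox a b \<longrightarrow>
      (\<exists>z. ((\<lambda>x. if x \<in> {0<..} then f x else 0) has_integral z) (cbox a b) \<and> norm (z - (B - A)) < e)"
  proof (intro exI[of _ N'] conjI allI impI)
    show "N' > 0" by (simp add: N'_def)
    fix a b :: real assume sub: "ball 0 N' \<subseteq> cbox a b"
    have *: "a \<le> x \<and> x \<le> b" if "\<bar>x\<bar> < N'" for x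
      using that by (intro atLeastAtMost_iff[THEN iffD1] subsetD[OF sub[unfolded cbox_interval]]) simp
    \<comment> \<open>The ball is open, so \<open>N'\<close> itself is not known to lie in the
      interval; every smaller point does, and density gives \<open>b \<ge> N'\<close>.\<close>
    have ab: "a \<le> 0" "b \<ge> N'"
      using *[of 0] \<open>N' > 0\<close> by (simp, intro dense_le_bounded[of 0 N' b]) (simp_all add: *)
    have b0: "b > 0" using ab \<open>N' > 0\<close> by simp
    define G where "G = (\<lambda>x. if x \<le> 0 then A else F x)"
    have "((\<lambda>x. if x \<in> {0<..} then f x else 0) has_integral (G b - G a)) {a..b}"
    proof (rule fundamental_theorem_of_calculus_interior_strong[of "{0}"])
      show "a \<le> b" using ab b0 by simp
      show "(G has_vector_derivative (if x \<in> {0<..} then f x else 0)) (at x)" if "x \<in> {a<..<b} - {0}" for x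
      proof (cases "x > 0")
        case True
        have "(G has_vector_derivative f x) (at x)"
          by (rule has_vector_derivative_transform_within_open[OF deriv[OF True], of "{0<..}"])
             (use True in \<open>auto simp: G_def\<close>)
        then show ?thesis using True by simp
      next
        case False
        then have "x < 0" using that by auto
        have "(G has_vector_derivative 0) (at x)"
          by (rule has_vector_derivative_transform_within_open[OF has_vector_derivative_const[of A], of "{..<0}"])
             (use \<open>x < 0\<close> in \<open>auto simp: G_def\<close>)
        then show ?thesis using False by simp
      qed
      show "continuous_on {a..b} G"
      proof (rule continuous_at_imp_continuous_on, intro ballI)
        fix x assume "x \<in> {a..b}"
        consider "x > 0" | "x < 0" | "x = 0" by linarith
        then show "isCont G x"
        proof cases
          case 1
          have "isCont F x" by (rule has_vector_derivative_continuous[OF deriv[OF 1]])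
          moreover have "eventually (\<lambda>y. y \<in> {0<..}) (nhds x)"
            using 1 by (intro eventually_nhds_in_open) auto
          then have "eventually (\<lambda>y. G y = F y) (nhds x)"
            by eventually_elim (auto simp: G_def)
          ultimately show ?thesis using isCont_cong by blast
        next
          case 2
          then have "eventually (\<lambda>y. y \<in> {..<0}) (nhds x)"
            by (intro eventually_nhds_in_open) auto
          then have "eventually (\<lambda>y. G y = A) (nhds x)"
            by eventually_elim (auto simp: G_def)
          then show ?thesis using isCont_cong[where g = "\<lambda>_. A"] continuous_const by blast
        next
          case 3
          have "(G \<longlongrightarrow> A) (at_right 0)"
            using zero by (rule Lim_transform_eventually)
              (simp add: eventually_at_filter G_def)
          moreover have "(G \<longlongrightarrow> A) (at_left 0)"
            by (rule Lim_transform_eventually[OF tendsto_const])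
              (simp add: eventually_at_filter G_def)
          ultimately show ?thesis
            using 3 by (simp add: isCont_def filterlim_at_split[of G] G_def[THEN fun_cong, of 0])
        qed
      qed
    qed auto
    moreover have "G b - G a = F b - A"
      using ab b0 by (simp add: G_def)
    moreover have "norm (F b - A - (B - A)) < e"
      using N[of b] ab by (simp add: N'_def dist_norm)
    ultimately show "\<exists>z. ((\<lambda>x. if x \<in> {0<..} then f x else 0) has_integral z) (cbox a b) \<and>
        norm (z - (B - A)) < e"
      by (intro exI[of _ "G b - G a"]) auto
  qed
qed

text \<open>The base point is 1 because \<open>f\<close> may be singular at 0. Near a given x both
  branches of \<open>F\<close> agree with one formula based at \<open>a = min x 1 / 2\<close>, a
  point to the left of x and of 1.\<close>

lemma continuous_antiderivative_Ioi:
  fixes f :: "real \<Rightarrow> 'b::banach"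
  assumes cont: "continuous_on {0<..} f"
  obtains F where "\<And>x. x > 0 \<Longrightarrow> (F has_vector_derivative f x) (at x)"
proof -
  define F where "F = (\<lambda>x. if x \<ge> 1 then integral {1..x} f else - integral {x..1} f)"
  have int: "f integrable_on {x..y}" if "0 < x" for x y
    by (rule integrable_continuous_real) (use cont that in \<open>auto intro: continuous_on_subset\<close>)
  have "(F has_vector_derivative f x) (at x)" if "x > 0" for x
  proof -
    define a where "a = min x 1 / 2"
    have a: "0 < a" "a < x" "a < 1" using that by (auto simp: a_def)
    have "((\<lambda>u. integral {a..u} f) has_vector_derivative f x) (at x within {a..x+1})"
      by (rule integral_has_vector_derivative)
        (use cont a in \<open>auto intro: continuous_on_subset\<close>)
    then have "((\<lambda>u. integral {a..u} f) has_vector_derivative f x) (at x)"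
      using a by (simp add: at_within_Icc_at)
    then have "((\<lambda>u. integral {a..u} f - integral {a..1} f) has_vector_derivative f x) (at x)"
      by (auto intro!: derivative_eq_intros)
    moreover have "F u = integral {a..u} f - integral {a..1} f" if "u > a" for u
      using Henstock_Kurzweil_Integration.integral_combine[where a = a and c = 1 and b = u and f = f]
        Henstock_Kurzweil_Integration.integral_combine[where a = a and c = u and b = 1 and f = f] a that int[of a]
      by (auto simp: F_def algebra_simps)
    ultimately show ?thesis
      using a by (elim has_vector_derivative_transform_within_open[where S = "{a<..}"]) auto
  qed
  then show thesis by (rule that)
qed

text \<open>Comparison test in terms of antiderivatives. The mean value inequality turns the
  pointwise majorant into \<open>norm (F y - F x) \<le> G y - G x\<close>; so \<open>F\<close> is
  Cauchy wherever \<open>G\<close> converges, and the same inequality in the limit bounds the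
  integral.\<close>

lemma dominated_has_integral_Ioi:
  fixes f :: "real \<Rightarrow> 'b::banach"
  assumes cont: "continuous_on {0<..} f"
    and derivG: "\<And>x. x > 0 \<Longrightarrow> (G has_real_derivative g x) (at x)"
    and le: "\<And>x. x > 0 \<Longrightarrow> norm (f x) \<le> g x"
    and zero: "(G \<longlongrightarrow> a) (at_right 0)" and inf: "(G \<longlongrightarrow> b) at_top"
  obtains I where "(f has_integral I) {0<..}" "norm I \<le> b - a"
proof -
  obtain F where F: "\<And>x. x > 0 \<Longrightarrow> (F has_vector_derivative f x) (at x)"
    using continuous_antiderivative_Ioi[OF cont] by metis
  have "norm (F y - F x) \<le> G y - G x" if "0 < x" "x < y" for x y
  proof (rule differentiable_bound_general[OF \<open>x < y\<close>, where f' = f and \<phi>' = g])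
    show "continuous_on {x..y} F"
      using F that by (intro continuous_at_imp_continuous_on ballI has_vector_derivative_continuous[OF F]) auto
    show "continuous_on {x..y} G"
      using that by (intro continuous_at_imp_continuous_on ballI DERIV_isCont[OF derivG]) auto
  qed (use F derivG le that in \<open>auto simp: has_real_derivative_iff_has_vector_derivative\<close>)
  then have *: "norm (F y - F x) \<le> \<bar>G y - G x\<bar>" if "0 < x" "x < y" for x y
    using that abs_ge_self order_trans by blast
  have FG: "norm (F y - F x) \<le> \<bar>G y - G x\<bar>" if "0 < x" "0 < y" for x y
    using *[of x y] *[of y x] that
    by (cases x y rule: linorder_cases) (auto simp: norm_minus_commute abs_minus_commute)
  have lim: "\<exists>l. (F \<longlongrightarrow> l) \<F>"
    if "(G \<longlongrightarrow> c) \<F>" and pos: "eventually (\<lambda>x. x > 0) \<F>" and "\<F> \<noteq> bot" for c and \<F> :: "real filter"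
  proof -
    have "cauchy_filter (filtermap F \<F>)"
      unfolding cauchy_filter_metric_filtermap
    proof (intro allI impI)
      fix e :: real assume "e > 0"
      have "eventually (\<lambda>x. dist (G x) c < e / 2 \<and> x > 0) \<F>"
        using tendstoD[OF that(1), of "e / 2"] \<open>e > 0\<close> pos by (auto intro: eventually_conj)
      moreover have "dist (F x) (F y) < e"
        if "dist (G x) c < e / 2 \<and> x > 0" "dist (G y) c < e / 2 \<and> y > 0" for x y
        using FG[of y x] that unfolding dist_real_def dist_norm by linarith
      ultimately show "\<exists>P. eventually P \<F> \<and> (\<forall>x y. P x \<and> P y \<longrightarrow> dist (F x) (F y) < e)"
        by (intro exI[of _ "\<lambda>x. dist (G x) c < e / 2 \<and> x > 0"]) auto
    qed
    then have "\<exists>l. filtermap F \<F> \<le> nhds l"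
      using \<open>\<F> \<noteq> bot\<close> complete_uniform[of "UNIV :: 'b set"] complete_UNIV
      by (auto simp: filtermap_bot_iff)
    then show ?thesis by (simp add: filterlim_def)
  qed
  have ev0: "eventually (\<lambda>x::real. x > 0) (at_right 0)"
    by (simp add: eventually_at_filter)
  obtain A where A: "(F \<longlongrightarrow> A) (at_right 0)"
    using lim[OF zero ev0] by auto
  obtain B where B: "(F \<longlongrightarrow> B) at_top"
    using lim[OF inf eventually_gt_at_top] by auto
  have "norm (B - A) \<le> \<bar>b - a\<bar>"
  proof -
    have step: "norm (B - F x) \<le> \<bar>b - G x\<bar>" if "x > 0" for x
    proof (rule tendsto_le)
      show "((\<lambda>y. norm (F y - F x)) \<longlongrightarrow> norm (B - F x)) at_top"
        by (intro tendsto_intros B)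
      show "((\<lambda>y. \<bar>G y - G x\<bar>) \<longlongrightarrow> \<bar>b - G x\<bar>) at_top"
        by (intro tendsto_intros inf)
      show "\<forall>\<^sub>F y in at_top. norm (F y - F x) \<le> \<bar>G y - G x\<bar>"
        using eventually_gt_at_top[of 0] by eventually_elim (rule FG[OF that])
    qed simp
    show ?thesis
    proof (rule tendsto_le)
      show "((\<lambda>y. norm (B - F y)) \<longlongrightarrow> norm (B - A)) (at_right 0)"
        by (intro tendsto_intros A)
      show "((\<lambda>y. \<bar>b - G y\<bar>) \<longlongrightarrow> \<bar>b - a\<bar>) (at_right 0)"
        by (intro tendsto_intros zero)
      show "\<forall>\<^sub>F y in at_right 0. norm (B - F y) \<le> \<bar>b - G y\<bar>"
        using ev0 by eventually_elim (rule step)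
    qed simp
  qed
  \<comment> \<open>\<open>G\<close> is nondecreasing since \<open>g\<close> dominates a norm; this
    removes the absolute value left by the limit argument.\<close>
  moreover have "a \<le> b"
  proof -
    have mono: "G x \<le> G y" if "0 < x" "x \<le> y" for x y
    proof (rule DERIV_nonneg_imp_nondecreasing[OF that(2)])
      fix z assume "x \<le> z" "z \<le> y"
      then show "\<exists>d. (G has_real_derivative d) (at z) \<and> 0 \<le> d"
        using derivG[of z] order_trans[OF norm_ge_zero le[of z]] \<open>0 < x\<close> by auto
    qed
    have "a \<le> G 1"
      by (rule tendsto_upperbound[OF zero]) (auto simp: eventually_at intro!: exI[of _ 1] mono)
    also have "G 1 \<le> b"
      by (rule tendsto_lowerbound[OF inf]) (auto intro!: eventually_mono[OF eventually_ge_at_top[of 1]] mono)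
    finally show ?thesis .
  qed
  ultimately have "norm (B - A) \<le> b - a" by simp
  with has_integral_Ioi_vector_derivative[OF F A B] show thesis
    by (rule that)
qed

section \<open>Kreiss elements of a complex Banach algebra\<close>

text \<open>The base is not \<open>real_normed_algebra_1\<close>: on the zero space the identity
  operator equals 0, so neither \<open>1 \<noteq> 0\<close> nor \<open>norm 1 = 1\<close> may be
  assumed. Later bounds therefore carry \<open>norm 1\<close>, or \<open>K\<close> in its
  place.\<close>

class complex_banach_algebra = complex_banach + real_normed_algebra + monoid_mult +
  assumes scaleC_mult_left: "scaleC a x * y = scaleC a (x * y)"
    and scaleC_mult_right: "x * scaleC a y = scaleC a (x * y)"

notation scaleC (infixr "*\<^sub>C" 75)

lemma bounded_bilinear_scaleC:
  "bounded_bilinear (scaleC :: complex \<Rightarrow> 'a \<Rightarrow> 'a::complex_banach)"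
proof
  fix a b :: complex and x y :: 'a and r :: real
  show "(a + b) *\<^sub>C x = a *\<^sub>C x + b *\<^sub>C x" by (rule scaleC_add_left)
  show "a *\<^sub>C (x + y) = a *\<^sub>C x + a *\<^sub>C y" by (rule scaleC_add_right)
  show "(r *\<^sub>R a) *\<^sub>C x = r *\<^sub>R (a *\<^sub>C x)"
    by (simp add: scaleR_conv_of_real scaleC_scaleC flip: scaleC_of_real)
  show "a *\<^sub>C (r *\<^sub>R x) = r *\<^sub>R (a *\<^sub>C x)"
    by (simp add: scaleC_scaleC mult.commute flip: scaleC_of_real)
  show "\<exists>K. \<forall>(a::complex) (x::'a). norm (a *\<^sub>C x) \<le> norm a * norm x * K"
    by (intro exI[of _ 1]) (simp add: norm_scaleC)
qed

interpretation scaleC: bounded_bilinear "scaleC :: complex \<Rightarrow> 'a \<Rightarrow> 'a::complex_banach"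
  by (rule bounded_bilinear_scaleC)

lemmas scaleC_simps = scaleC_mult_left scaleC_mult_right scaleC_scaleC scaleC_one

lemma has_integral_cis:
  "((\<lambda>\<theta>. cis (of_int j * \<theta>)) has_integral (if j = 0 then of_real (2 * pi) else 0)) {-pi..pi}"
proof (cases "j = 0")
  case True
  then show ?thesis
    using has_integral_const_real[of "1::complex" "-pi" pi] by (simp add: scaleR_conv_of_real)
next
  case False
  have "((\<lambda>\<theta>. cis (of_int j * \<theta>)) has_integral
      (cis (of_int j * pi) / (\<i> * of_int j) - cis (of_int j * (-pi)) / (\<i> * of_int j))) {-pi..pi}"
  proof (rule fundamental_theorem_of_calculus)
    show "((\<lambda>\<theta>. cis (of_int j * \<theta>) / (\<i> * of_int j)) has_vector_derivative cis (of_int j * x))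
       (at x within {-pi..pi})" for x
      unfolding cis_conv_exp using False
      by (auto intro!: derivative_eq_intros has_vector_derivative_real_field simp: field_simps)
  qed simp
  moreover have "cis (of_int j * pi) = cis (of_int j * (-pi))"
    using sin_zero_iff_int2[of "of_int j * pi"] by (auto simp: complex_eq_iff)
  ultimately show ?thesis using False by simp
qed

text \<open>The Kreiss condition in the variable \<open>z = 1 / \<lambda>\<close>.\<close>

locale kreiss =
  fixes t :: "'a::complex_banach_algebra" and K :: real
  assumes kreiss: "cmod z < 1 \<Longrightarrow>
    \<exists>N. N * (1 - z *\<^sub>C t) = 1 \<and> (1 - z *\<^sub>C t) * N = 1 \<and> norm N \<le> K / (1 - cmod z)"
begin

section \<open>The resolvent on the unit disc and its Fourier coefficients\<close>

definition res :: "complex \<Rightarrow> 'a" where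
  "res z = (SOME N. N * (1 - z *\<^sub>C t) = 1 \<and> (1 - z *\<^sub>C t) * N = 1 \<and> norm N \<le> K / (1 - cmod z))"

lemma
  assumes "cmod z < 1"
  shows res_left: "res z * (1 - z *\<^sub>C t) = 1" and res_right: "(1 - z *\<^sub>C t) * res z = 1"
    and res_bound: "norm (res z) \<le> K / (1 - cmod z)"
  using someI_ex[OF kreiss[OF assms]] unfolding res_def by auto

lemma res_unique: "cmod z < 1 \<Longrightarrow> (1 - z *\<^sub>C t) * N = 1 \<Longrightarrow> N = res z"
  by (metis mult.assoc mult_1_left mult_1_right res_left)

lemma res_0: "res 0 = 1"
  using res_left[of 0] by (simp add: scaleC.zero_left)

lemma K_ge: "norm (1::'a) \<le> K" "0 \<le> K"
  using res_bound[of 0] norm_ge_zero[of "1::'a"] by (simp_all add: res_0 del: norm_ge_zero)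

lemma res_eq: "cmod z < 1 \<Longrightarrow> res z = 1 + z *\<^sub>C (t * res z)"
  using res_right[of z] by (simp add: algebra_simps scaleC_simps)

lemma res_diff:
  assumes "cmod z < 1" "cmod w < 1"
  shows "res z - res w = (z - w) *\<^sub>C (res z * t * res w)"
proof -
  have "res z - res w = res z * ((1 - w *\<^sub>C t) * res w) - (res z * (1 - z *\<^sub>C t)) * res w"
    using assms by (simp add: res_left res_right)
  also have "\<dots> = (z - w) *\<^sub>C (res z * t * res w)"
    by (simp add: algebra_simps scaleC_simps scaleC.diff_left)
  finally show ?thesis .
qed

lemma isCont_res:
  assumes "cmod z < 1"
  shows "isCont res z"
  unfolding isCont_def
proof (rule Lim_null[THEN iffD2], rule Lim_null_comparison)
  have "eventually (\<lambda>w. w \<in> ball 0 1) (nhds z)"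
    using assms by (intro eventually_nhds_in_open) auto
  then have "eventually (\<lambda>w. cmod w < 1) (at z)"
    by (auto simp: eventually_at_filter elim: eventually_mono)
  then show "\<forall>\<^sub>F w in at z. norm (res w - res z) \<le>
      cmod (w - z) * (K / (1 - cmod w) * norm t * norm (res z))"
  proof eventually_elim
    case (elim w)
    have "norm (res w * t * res z) \<le> norm (res w) * norm t * norm (res z)"
      by (meson norm_mult_ineq order_trans mult_right_mono norm_ge_zero)
    also have "\<dots> \<le> K / (1 - cmod w) * norm t * norm (res z)"
      by (intro mult_right_mono res_bound elim) auto
    finally have "norm (res w * t * res z) \<le> K / (1 - cmod w) * norm t * norm (res z)" .
    from mult_left_mono[OF this, of "cmod (w - z)"] show ?case
      unfolding res_diff[OF elim assms] norm_scaleC by simp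
  qed
  have "((\<lambda>w. cmod (w - z) * (K / (1 - cmod w) * norm t * norm (res z))) \<longlongrightarrow>
      cmod (z - z) * (K / (1 - cmod z) * norm t * norm (res z))) (at z)"
    using assms by (intro tendsto_intros) auto
  then show "((\<lambda>w. cmod (w - z) * (K / (1 - cmod w) * norm t * norm (res z))) \<longlongrightarrow> 0) (at z)"
    by simp
qed

lemma continuous_on_res: "continuous_on (ball 0 1) res"
  by (intro continuous_at_imp_continuous_on ballI isCont_res) auto

lemma continuous_on_res_compose [continuous_intros]:
  assumes "continuous_on S f" "\<And>x. x \<in> S \<Longrightarrow> cmod (f x) < 1"
  shows "continuous_on S (\<lambda>x. res (f x))"
  by (rule continuous_on_compose2[OF continuous_on_res assms(1)]) (use assms(2) in auto)

lemma has_derivative_res: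
  assumes "cmod z < 1"
  shows "(res has_derivative (\<lambda>h. h *\<^sub>C (res z * t * res z))) (at z)"
  unfolding has_derivative_iff_norm
proof (intro conjI)
  show "bounded_linear (\<lambda>h. h *\<^sub>C (res z * t * res z))"
    by (rule scaleC.bounded_linear_left)
  have ev: "eventually (\<lambda>w. w \<in> ball 0 1 \<and> w \<noteq> z) (at z)"
    using assms by (intro eventually_conj eventually_at_in_open' eventually_neq_at_within) auto
  show "((\<lambda>w. norm (res w - res z - (w - z) *\<^sub>C (res z * t * res z)) / norm (w - z)) \<longlongrightarrow> 0) (at z)"
  proof (rule Lim_null_comparison)
    show "\<forall>\<^sub>F w in at z. norm (norm (res w - res z - (w - z) *\<^sub>C (res z * t * res z)) / norm (w - z))
        \<le> norm ((res w - res z) * (t * res z))"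
      using ev
    proof eventually_elim
      case (elim w)
      have "res w - res z - (w - z) *\<^sub>C (res z * t * res z) = (w - z) *\<^sub>C ((res w - res z) * (t * res z))"
        using elim assms by (subst res_diff) (auto simp: algebra_simps scaleC.diff_right scaleC.diff_left)
      then show ?case using elim by (simp add: norm_scaleC)
    qed
    have "((\<lambda>w. norm ((res w - res z) * (t * res z))) \<longlongrightarrow> norm ((res z - res z) * (t * res z))) (at z)"
      using isCont_res[OF assms] unfolding isCont_def by (intro tendsto_intros)
    then show "((\<lambda>w. norm ((res w - res z) * (t * res z))) \<longlongrightarrow> 0) (at z)" by simp
  qed
qed

lemma has_vector_derivative_res:
  assumes "cmod (g x) < 1" "(g has_vector_derivative g') (at x within S)"
  shows "((\<lambda>x. res (g x)) has_vector_derivative g' *\<^sub>C (res (g x) * t * res (g x))) (at x within S)"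
proof -
  have "((\<lambda>x. res (g x)) has_derivative (\<lambda>h. (h *\<^sub>R g') *\<^sub>C (res (g x) * t * res (g x)))) (at x within S)"
    using has_derivative_compose[OF assms(2)[unfolded has_vector_derivative_def] has_derivative_res[OF assms(1)]] .
  then show ?thesis by (simp add: has_vector_derivative_def scaleC.scaleR_left)
qed

lemma res_mean_value:
  assumes "\<bar>\<rho>\<bar> < 1"
  shows "((\<lambda>\<theta>. res (of_real \<rho> * cis \<theta>)) has_integral (2 * pi) *\<^sub>R 1) {-pi..pi}"
proof -
  define D where "D = (\<lambda>\<rho> \<theta>. cis \<theta> *\<^sub>C (res (of_real \<rho> * cis \<theta>) * t * res (of_real \<rho> * cis \<theta>)))"
  define m where "m = (\<lambda>\<rho>. integral (cbox (-pi) pi) (\<lambda>\<theta>. res (of_real \<rho> * cis \<theta>)))"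
  have cis_deriv: "(cis has_vector_derivative \<i> * cis x) (at x within S)" for x S
    unfolding cis_conv_exp by (auto intro!: derivative_eq_intros has_vector_derivative_real_field)
  have cont: "continuous_on {-pi..pi} (\<lambda>\<theta>. res (of_real x * cis \<theta>))" if "\<bar>x\<bar> < 1" for x
    using that by (intro continuous_intros) (auto simp: norm_mult)
  have contD: "continuous_on ({-1<..<1} \<times> cbox (-pi) pi) (\<lambda>(x, \<theta>). D x \<theta>)"
    unfolding D_def split_beta
    by (intro continuous_intros scaleC.continuous_on) (auto simp: norm_mult)
  have contD1: "continuous_on (cbox (-pi) pi) (D x)" if "\<bar>x\<bar> < 1" for x
    unfolding D_def using that by (intro continuous_intros scaleC.continuous_on) (auto simp: norm_mult)
  \<comment> \<open>At x = 0 one cannot divide by \<open>of_real x * \<i>\<close>, but there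
    \<open>D\<close> reduces to \<open>cis \<theta>\<close> times \<open>t\<close>, whose integral
    vanishes by orthogonality.\<close>
  have D0: "integral (cbox (-pi) pi) (D x) = 0" if "\<bar>x\<bar> < 1" for x
  proof (cases "x = 0")
    case True
    have "((\<lambda>\<theta>. cis (of_int 1 * \<theta>) *\<^sub>C t) has_integral 0 *\<^sub>C t) {-pi..pi}"
      using has_integral_linear[OF has_integral_cis[of 1] scaleC.bounded_linear_left[of t]]
      by (simp add: o_def)
    then show ?thesis
      by (simp add: True D_def res_0 scaleC.zero_left integral_unique)
  next
    case False
    have "((\<lambda>\<theta>. (of_real x * (\<i> * cis \<theta>)) *\<^sub>C (res (of_real x * cis \<theta>) * t * res (of_real x * cis \<theta>)))
        has_integral (res (of_real x * cis pi) - res (of_real x * cis (-pi)))) {-pi..pi}"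
      using that by (intro fundamental_theorem_of_calculus has_vector_derivative_res
          has_vector_derivative_mult_right cis_deriv) (auto simp: norm_mult)
    moreover have "cis (- pi) = cis pi" by (simp add: complex_eq_iff)
    ultimately have "((\<lambda>\<theta>. (of_real x * \<i>) *\<^sub>C D x \<theta>) has_integral 0) {-pi..pi}"
      by (simp add: D_def scaleC_simps mult.assoc)
    from has_integral_linear[OF this scaleC.bounded_linear_right[of "1 / (of_real x * \<i>)"]]
    have "(D x has_integral 0) {-pi..pi}"
      using False by (simp add: o_def scaleC_simps scaleC.zero_right)
    then show ?thesis by (simp add: integral_unique)
  qed
  have "(m has_vector_derivative 0) (at x within {-1<..<1})" if x: "x \<in> {-1<..<1}" for x
  proof -
    have "(m has_vector_derivative integral (cbox (-pi) pi) (D x)) (at x within {-1<..<1})"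
      unfolding m_def
    proof (rule leibniz_rule_vector_derivative[OF _ _ contD x])
      fix y \<theta> :: real assume "y \<in> {-1<..<1}"
      then have "((\<lambda>y. res (of_real y * cis \<theta>)) has_vector_derivative
          cis \<theta> *\<^sub>C (res (of_real y * cis \<theta>) * t * res (of_real y * cis \<theta>))) (at y within {-1<..<1})"
        by (intro has_vector_derivative_res)
           (auto simp: norm_mult intro!: derivative_eq_intros)
      then show "((\<lambda>y. res (of_real y * cis \<theta>)) has_vector_derivative D y \<theta>) (at y within {-1<..<1})"
        by (simp add: D_def)
    qed (auto intro!: integrable_continuous_real cont)
    then show ?thesis using D0[of x] x by (simp add: abs_less_iff)
  qed
  then obtain m0 where "\<And>x. x \<in> {-1<..<1} \<Longrightarrow> m x = m0"
    using has_vector_derivative_zero_constant[of "{-1<..<1}" m] by (metis convex_real_interval(8))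
  then have "m \<rho> = m 0" using assms by (simp add: abs_less_iff)
  also have "m 0 = (2 * pi) *\<^sub>R 1" by (simp add: m_def res_0)
  finally have "integral {-pi..pi} (\<lambda>\<theta>. res (of_real \<rho> * cis \<theta>)) = (2 * pi) *\<^sub>R 1"
    by (simp add: m_def)
  with integrable_continuous_real[OF cont[OF assms]] show ?thesis
    by (simp add: has_integral_iff)
qed

text \<open>Multiplying \<open>res z = 1 + z t res z\<close> by \<open>cis (-k \<theta>)\<close> raises the Fourier index by one.\<close>

lemma res_fourier:
  assumes "\<bar>\<rho>\<bar> < 1"
  shows "((\<lambda>\<theta>. cis (- real k * \<theta>) *\<^sub>C res (of_real \<rho> * cis \<theta>)) has_integral (2 * pi * \<rho> ^ k) *\<^sub>R t ^ k) {-pi..pi}"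
proof (induction k)
  case 0
  show ?case using res_mean_value[OF assms] by (simp add: scaleC_one)
next
  case (Suc k)
  have 1: "((\<lambda>\<theta>. cis (of_int (- int (Suc k)) * \<theta>) *\<^sub>C (1::'a)) has_integral 0 *\<^sub>C 1) {-pi..pi}"
    using has_integral_linear[OF has_integral_cis scaleC.bounded_linear_left[of "1::'a"], of "- int (Suc k)"]
    by (simp add: o_def)
  have 2: "((\<lambda>\<theta>. \<rho> *\<^sub>R (t * (cis (- real k * \<theta>) *\<^sub>C res (of_real \<rho> * cis \<theta>)))) has_integral
      \<rho> *\<^sub>R (t * ((2 * pi * \<rho> ^ k) *\<^sub>R t ^ k))) {-pi..pi}"
    using has_integral_cmul[OF has_integral_linear[OF Suc.IH bounded_linear_mult_right[of t]]]
    by (simp add: o_def)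
  have "cis (- real (Suc k) * \<theta>) *\<^sub>C res (of_real \<rho> * cis \<theta>) =
     cis (of_int (- int (Suc k)) * \<theta>) *\<^sub>C 1 + \<rho> *\<^sub>R (t * (cis (- real k * \<theta>) *\<^sub>C res (of_real \<rho> * cis \<theta>)))" for \<theta>
  proof -
    have "cis (- real (Suc k) * \<theta>) * (of_real \<rho> * cis \<theta>) = of_real \<rho> * cis (- real k * \<theta>)"
      by (simp add: cis_mult algebra_simps)
    then show ?thesis
      using assms by (subst res_eq)
        (simp_all only: norm_mult scaleC_simps scaleC_add_right flip: scaleC_of_real, simp_all)
  qed
  then show ?case
    using has_integral_add[OF 1 2] by (simp add: scaleC.zero_left algebra_simps)
qed

text \<open>A Fourier coefficient is at most the supremum of the function on the circle. For \<rho>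
  close to 1 this says that the spectral radius of \<open>t\<close> is at most 1, which is how it
  enters \<open>summable_power\<close>.\<close>

lemma power_bound:
  assumes "0 \<le> \<rho>" "\<rho> < 1"
  shows "\<rho> ^ k * norm (t ^ k) \<le> K / (1 - \<rho>)"
proof -
  have "norm ((2 * pi * \<rho> ^ k) *\<^sub>R t ^ k) \<le> K / (1 - \<rho>) * Henstock_Kurzweil_Integration.content {-pi..pi}"
    using assms K_ge res_bound
    by (intro has_integral_bound_real[OF _ finite.emptyI res_fourier[of \<rho> k]])
       (auto simp: norm_scaleC norm_mult intro!: res_bound[THEN order_trans])
  also have "\<dots> = K / (1 - \<rho>) * (2 * pi)" by simp
  finally have "(2 * pi) * (\<rho> ^ k * norm (t ^ k)) \<le> (2 * pi) * (K / (1 - \<rho>))"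
    using assms by (simp add: mult_ac)
  then show ?thesis by (rule mult_left_le_imp_le) simp
qed

lemma summable_power:
  assumes "0 \<le> x" "x < 1"
  shows "summable (\<lambda>k. x ^ k * norm (t ^ k))"
proof -
  define \<rho> where "\<rho> = (1 + x) / 2"
  have \<rho>: "0 < \<rho>" "\<rho> < 1" "x < \<rho>" using assms by (auto simp: \<rho>_def)
  show ?thesis
  proof (rule summable_comparison_test')
    show "summable (\<lambda>k. K / (1 - \<rho>) * (x / \<rho>) ^ k)"
      using \<rho> assms by (intro summable_mult summable_geometric) auto
    fix k
    have "x ^ k * norm (t ^ k) = (x / \<rho>) ^ k * (\<rho> ^ k * norm (t ^ k))"
      using \<rho> by (simp add: power_divide)
    also have "\<dots> \<le> (x / \<rho>) ^ k * (K / (1 - \<rho>))"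
      using \<rho> assms by (intro mult_left_mono power_bound) auto
    finally show "norm (x ^ k * norm (t ^ k)) \<le> K / (1 - \<rho>) * (x / \<rho>) ^ k"
      using assms by (simp add: mult.commute)
  qed
qed

lemma summable_scaleC_power:
  assumes "0 \<le> x" "x < 1" "\<And>k. cmod (a k) \<le> B * x ^ k"
  shows "summable (\<lambda>k. norm (a k *\<^sub>C t ^ k))"
proof (rule summable_comparison_test')
  show "summable (\<lambda>k. B * (x ^ k * norm (t ^ k)))"
    using assms by (intro summable_mult summable_power)
  show "norm (norm (a k *\<^sub>C t ^ k)) \<le> B * (x ^ k * norm (t ^ k))" for k
    using mult_right_mono[OF assms(3)[of k], of "norm (t ^ k)"] by (simp add: norm_scaleC mult_ac)
qed

lemma res_sums:
  assumes "cmod z < 1"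
  shows "(\<lambda>k. z ^ k *\<^sub>C t ^ k) sums res z"
proof -
  have sm: "summable (\<lambda>k. z ^ k *\<^sub>C t ^ k)"
    by (rule summable_norm_cancel, rule summable_scaleC_power[of "cmod z" _ 1])
       (use assms in \<open>auto simp: norm_power\<close>)
  define S where "S = (\<Sum>k. z ^ k *\<^sub>C t ^ k)"
  have "S = 1 + (\<Sum>k. z ^ Suc k *\<^sub>C t ^ Suc k)"
    unfolding S_def by (subst suminf_split_head[OF sm]) (simp add: scaleC_one)
  also have "(\<Sum>k. z ^ Suc k *\<^sub>C t ^ Suc k) = (\<Sum>k. z *\<^sub>C (t * (z ^ k *\<^sub>C t ^ k)))"
    by (simp add: scaleC_simps)
  also have "\<dots> = z *\<^sub>C (t * S)"
    unfolding S_def using bounded_linear_compose[OF scaleC.bounded_linear_right[of z] bounded_linear_mult_right[of t]]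
    by (rule bounded_linear.suminf[symmetric]) (rule sm)
  finally have "(1 - z *\<^sub>C t) * S = 1" by (simp add: algebra_simps scaleC_simps)
  then have "S = res z" using assms by (intro res_unique)
  with sm show ?thesis by (auto simp: S_def sums_iff)
qed

section \<open>Power series evaluated at r t\<close>

definition fc :: "complex fps \<Rightarrow> real \<Rightarrow> 'a" where
  "fc f r = (\<Sum>k. (fps_nth f k * of_real r ^ k) *\<^sub>C t ^ k)"

lemma fc_summable:
  assumes "fps_conv_radius f \<ge> 1" "0 \<le> r" "r < 1"
  shows "summable (\<lambda>k. norm ((fps_nth f k * of_real r ^ k) *\<^sub>C t ^ k))"
proof -
  \<comment> \<open>\<open>r ^ k\<close> is split evenly as \<open>x ^ k * x ^ k\<close>: one factor
    keeps the coefficients of \<open>f\<close> bounded, the other makes the powers of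
    \<open>t\<close> summable.\<close>
  define x where "x = sqrt r"
  have x: "0 \<le> x" "x < 1" "x * x = r" using assms by (auto simp: x_def)
  have "ereal (norm (of_real x :: complex)) < fps_conv_radius f"
    using x assms by (intro less_le_trans[OF _ assms(1)]) simp
  then have "summable (\<lambda>k. norm (fps_nth f k * of_real x ^ k))"
    by (rule norm_summable_fps)
  then have "bounded (range (\<lambda>k. norm (fps_nth f k * of_real x ^ k)))"
    using summable_imp_bounded by blast
  then obtain B where B: "\<And>k. norm (fps_nth f k * of_real x ^ k) \<le> B"
    by (auto simp: bounded_iff)
  show ?thesis
  proof (rule summable_scaleC_power[OF x(1,2)])
    fix k
    have "of_real r ^ k = (of_real x ^ k * of_real x ^ k :: complex)"
      by (simp add: x(3)[symmetric] power_mult_distrib)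
    then show "cmod (fps_nth f k * of_real r ^ k) \<le> B * x ^ k"
      using mult_right_mono[OF B[of k], of "x ^ k"] x by (simp add: norm_mult norm_power mult_ac)
  qed
qed

lemma fc_sums:
  assumes "fps_conv_radius f \<ge> 1" "0 \<le> r" "r < 1"
  shows "(\<lambda>k. (fps_nth f k * of_real r ^ k) *\<^sub>C t ^ k) sums fc f r"
  using summable_norm_cancel[OF fc_summable[OF assms]] by (simp add: fc_def sums_iff)

lemma fc_const: "fc (fps_const c) r = c *\<^sub>C 1"
proof -
  have "fc (fps_const c) r = (\<Sum>k\<in>{0}. (fps_nth (fps_const c) k * of_real r ^ k) *\<^sub>C t ^ k)"
    unfolding fc_def by (rule suminf_finite) (auto simp: scaleC.zero_left)
  then show ?thesis by simp
qed

lemma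
  assumes "fps_conv_radius f \<ge> 1" "fps_conv_radius g \<ge> 1" "0 \<le> r" "r < 1"
  shows fc_add: "fc (f + g) r = fc f r + fc g r"
    and fc_diff: "fc (f - g) r = fc f r - fc g r"
    and fc_mult: "fc (f * g) r = fc f r * fc g r"
proof -
  note s = fc_sums[OF assms(1,3,4)] fc_sums[OF assms(2,3,4)]
  show "fc (f + g) r = fc f r + fc g r"
    using sums_unique[OF sums_add[OF s]]
    by (simp only: fc_def[of "f + g"] fps_add_nth distrib_right scaleC_add_left)
  show "fc (f - g) r = fc f r - fc g r"
    using sums_unique[OF sums_diff[OF s]]
    by (simp only: fc_def[of "f - g"] fps_sub_nth left_diff_distrib scaleC.diff_left)
  have "(\<lambda>k. \<Sum>i\<le>k. ((fps_nth f i * of_real r ^ i) *\<^sub>C t ^ i) *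
      ((fps_nth g (k - i) * of_real r ^ (k - i)) *\<^sub>C t ^ (k - i))) sums (fc f r * fc g r)"
    unfolding fc_def using assms by (intro Cauchy_product_sums fc_summable)
  also have "(\<lambda>k. \<Sum>i\<le>k. ((fps_nth f i * of_real r ^ i) *\<^sub>C t ^ i) *
      ((fps_nth g (k - i) * of_real r ^ (k - i)) *\<^sub>C t ^ (k - i))) =
      (\<lambda>k. (fps_nth (f * g) k * of_real r ^ k) *\<^sub>C t ^ k)"
  proof
    fix k
    have "((fps_nth f i * of_real r ^ i) *\<^sub>C t ^ i) * ((fps_nth g (k - i) * of_real r ^ (k - i)) *\<^sub>C t ^ (k - i)) =
       (fps_nth f i * fps_nth g (k - i) * of_real r ^ k) *\<^sub>C t ^ k" if "i \<le> k" for i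
    proof -
      have "t ^ i * t ^ (k - i) = t ^ k" "of_real r ^ i * of_real r ^ (k - i) = (of_real r ^ k :: complex)"
        using that by (simp_all flip: power_add)
      then show ?thesis by (simp add: scaleC_simps mult_ac)
    qed
    then show "(\<Sum>i\<le>k. ((fps_nth f i * of_real r ^ i) *\<^sub>C t ^ i) *
      ((fps_nth g (k - i) * of_real r ^ (k - i)) *\<^sub>C t ^ (k - i))) = (fps_nth (f * g) k * of_real r ^ k) *\<^sub>C t ^ k"
      by (simp add: fps_mult_nth atLeast0AtMost scaleC.sum_left[symmetric] sum_distrib_right)
  qed
  finally show "fc (f * g) r = fc f r * fc g r"
    unfolding fc_def[of "f * g"] by (rule sums_unique[symmetric])
qed

end

section \<open>Taylor and Fourier representation\<close>

text \<open>Jordan's inequality: a concave function lies above its chord.\<close>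

lemma sin_ge_linear:
  assumes "0 \<le> x" "x \<le> pi / 2"
  shows "2 * x / pi \<le> sin x"
proof -
  have "concave_on {0..pi/2} sin"
    by (rule f''_le0_imp_concave[where f' = cos and f'' = "\<lambda>x. - sin x"])
       (auto intro!: derivative_eq_intros sin_ge_zero)
  then have "(1 - 2 * x / pi) * sin 0 + (2 * x / pi) * sin (pi / 2) \<le>
      sin ((1 - 2 * x / pi) *\<^sub>R 0 + (2 * x / pi) *\<^sub>R (pi / 2))"
    using assms by (intro concave_onD) (auto simp: field_simps)
  then show ?thesis by simp
qed

lemma norm_one_minus_cis_ge:
  assumes "\<bar>\<theta>\<bar> \<le> pi"
  shows "2 * \<bar>\<theta>\<bar> / pi \<le> cmod (1 - cis \<theta>)"
proof -
  have "2 * (\<bar>\<theta>\<bar> / 2) / pi \<le> sin (\<bar>\<theta>\<bar> / 2)"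
    using assms by (intro sin_ge_linear) auto
  then have "(2 * \<bar>\<theta>\<bar> / pi)\<^sup>2 \<le> (2 * sin (\<bar>\<theta>\<bar> / 2))\<^sup>2"
    by (intro power_mono) auto
  also have "\<dots> = 2 * (1 - cos \<bar>\<theta>\<bar>)"
    using cos_double_sin[of "\<bar>\<theta>\<bar> / 2"] by (simp add: power2_eq_square)
  also have "\<dots> = (cmod (1 - cis \<theta>))\<^sup>2"
    using sin_cos_squared_add[of \<theta>] unfolding cmod_power2
    by (simp add: power2_eq_square algebra_simps)
  finally show ?thesis by (rule power2_le_imp_le) simp
qed

text \<open>The triangle inequality gives \<open>1 - \<rho> \<le> |1 - z|\<close>. Moving z radially
  to the unit circle costs \<open>1 - \<rho>\<close> as well, so the chord bound there yields
  \<open>|\<theta>| \<le> pi * |1 - z|\<close>. The constant 5 is 1 + 4, with pi < 4.\<close>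

lemma norm_one_minus_polar_ge:
  assumes "\<bar>\<theta>\<bar> \<le> pi" "0 \<le> \<rho>" "\<rho> \<le> 1"
  shows "1 - \<rho> + \<bar>\<theta>\<bar> \<le> 5 * cmod (1 - of_real \<rho> * cis \<theta>)"
proof -
  let ?z = "of_real \<rho> * cis \<theta>"
  have 1: "1 - \<rho> \<le> cmod (1 - ?z)"
    using norm_triangle_ineq2[of 1 ?z] assms by (simp add: norm_mult)
  have "cmod (1 - cis \<theta>) \<le> cmod (1 - ?z) + cmod (?z - cis \<theta>)"
    using norm_triangle_ineq[of "1 - ?z" "?z - cis \<theta>"] by simp
  also have "?z - cis \<theta> = of_real (\<rho> - 1) * cis \<theta>" by (simp add: algebra_simps)
  also have "cmod \<dots> = 1 - \<rho>" using assms by (simp add: norm_mult del: of_real_diff)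
  finally have "cmod (1 - cis \<theta>) \<le> 2 * cmod (1 - ?z)" using 1 by simp
  with norm_one_minus_cis_ge[OF assms(1)] have "2 * \<bar>\<theta>\<bar> / pi \<le> 2 * cmod (1 - ?z)"
    by linarith
  then have "\<bar>\<theta>\<bar> \<le> pi * cmod (1 - ?z)"
    by (simp add: field_simps)
  also have "\<dots> \<le> 4 * cmod (1 - ?z)"
    using pi_less_4 by (intro mult_right_mono) auto
  finally show ?thesis using 1 by simp
qed

lemma has_integral_powr_translate:
  fixes x b \<beta> :: real
  assumes "x > 0" "\<beta> > 1" "b \<ge> 0"
  shows "((\<lambda>\<theta>. (x + \<theta>) powr (-\<beta>)) has_integral (x powr (1 - \<beta>) - (x + b) powr (1 - \<beta>)) / (\<beta> - 1)) {0..b}"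
proof -
  have "((\<lambda>\<theta>. (x + \<theta>) powr (-\<beta>)) has_integral
     (- ((x + b) powr (1 - \<beta>)) / (\<beta> - 1) - (- ((x + 0) powr (1 - \<beta>)) / (\<beta> - 1)))) {0..b}"
  proof (rule fundamental_theorem_of_calculus[OF assms(3)])
    fix y assume "y \<in> {0..b}"
    then have "((\<lambda>\<theta>. - ((x + \<theta>) powr (1 - \<beta>)) / (\<beta> - 1)) has_real_derivative (x + y) powr (-\<beta>)) (at y within {0..b})"
      using assms by (auto intro!: derivative_eq_intros simp: divide_simps) (simp add: algebra_simps)
    then show "((\<lambda>\<theta>. - ((x + \<theta>) powr (1 - \<beta>)) / (\<beta> - 1)) has_vector_derivative (x + y) powr (-\<beta>)) (at y within {0..b})"
      by (simp add: has_real_derivative_iff_has_vector_derivative)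
  qed
  then show ?thesis by (simp add: diff_divide_distrib)
qed

text \<open>For \<beta> > 1 the mass sits within distance x of \<theta> = 0, so integration gains
  exactly one power of x over the supremum of the integrand.\<close>

lemma integral_powr_polar_le:
  fixes x \<beta> :: real
  assumes "x > 0" "\<beta> > 1"
  shows "integral {-pi..pi} (\<lambda>\<theta>. (x + \<bar>\<theta>\<bar>) powr (-\<beta>)) \<le> 2 * x powr (1 - \<beta>) / (\<beta> - 1)"
proof -
  let ?I = "(x powr (1 - \<beta>) - (x + pi) powr (1 - \<beta>)) / (\<beta> - 1)"
  have "((\<lambda>\<theta>. (x + \<bar>\<theta>\<bar>) powr (-\<beta>)) has_integral ?I) {0..pi}"
    using has_integral_powr_translate[OF assms, of pi]
    by (rule has_integral_eq[rotated]) auto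
  moreover from this have "((\<lambda>\<theta>. (x + \<bar>\<theta>\<bar>) powr (-\<beta>)) has_integral ?I) {-pi..0}"
    using has_integral_reflect_real[where f = "\<lambda>\<theta>. (x + \<bar>\<theta>\<bar>) powr (-\<beta>)" and i = ?I and a = 0 and b = pi]
    by simp
  ultimately have "((\<lambda>\<theta>. (x + \<bar>\<theta>\<bar>) powr (-\<beta>)) has_integral (?I + ?I)) {-pi..pi}"
    by (intro has_integral_combine[of "-pi" 0 pi]) auto
  then have "integral {-pi..pi} (\<lambda>\<theta>. (x + \<bar>\<theta>\<bar>) powr (-\<beta>)) = ?I + ?I"
    by (rule integral_unique)
  also have "\<dots> = 2 * x powr (1 - \<beta>) / (\<beta> - 1) - 2 * (x + pi) powr (1 - \<beta>) / (\<beta> - 1)"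
    by (simp add: diff_divide_distrib)
  also have "\<dots> \<le> 2 * x powr (1 - \<beta>) / (\<beta> - 1)"
    using assms by simp
  finally show ?thesis .
qed

text \<open>The weight is the scalar part of the m-th term in the Neumann series of
  \<open>res (of_real \<rho> * cis (-\<theta>))\<close>. The radius enters once through
  \<open>g\<close> and once through the weight, hence the exponent \<open>2 * m\<close>.\<close>

lemma eval_fps_fourier:
  fixes g :: "complex fps"
  assumes "fps_conv_radius g \<ge> 1" "0 \<le> \<rho>" "\<rho> < 1"
  shows "((\<lambda>\<theta>. eval_fps g (of_real \<rho> * cis \<theta>) * (of_real \<rho> * cis (-\<theta>)) ^ m) has_integral
     of_real (2 * pi) * (fps_nth g m * of_real \<rho> ^ (2 * m))) {-pi..pi}"
proof -
  define h where "h = (\<lambda>j \<theta>. (fps_nth g j * of_real \<rho> ^ j * of_real \<rho> ^ m) * cis (of_int (int j - int m) * \<theta>))"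
  define I where "I = (\<lambda>j. (fps_nth g j * of_real \<rho> ^ j * of_real \<rho> ^ m) * (if int j - int m = 0 then of_real (2 * pi) else 0))"
  have rad: "ereal (norm (of_real \<rho> * cis \<theta>)) < fps_conv_radius g" for \<theta>
    using assms by (intro less_le_trans[OF _ assms(1)]) (simp add: norm_mult)
  have sm: "summable (\<lambda>j. cmod (fps_nth g j * of_real \<rho> ^ j) * \<rho> ^ m)"
    using norm_summable_fps[OF rad[of 0]] by (intro summable_mult2) simp
  have hI: "((\<lambda>\<theta>. \<Sum>j. h j \<theta>) has_integral (\<Sum>j. I j)) {-pi..pi}"
  proof (rule has_integral_suminf[OF _ _ sm])
    show "continuous_on {-pi..pi} (h k)" for k
      unfolding h_def by (intro continuous_intros)
    show "norm (h k x) \<le> cmod (fps_nth g k * of_real \<rho> ^ k) * \<rho> ^ m" for k x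
      using assms by (simp add: h_def norm_mult norm_power)
    show "(h k has_integral I k) {-pi..pi}" for k
      unfolding h_def I_def by (intro has_integral_mult_right has_integral_cis)
  qed
  have "(\<Sum>j. I j) = (\<Sum>j\<in>{m}. I j)"
    by (rule suminf_finite) (simp_all add: I_def)
  also have "\<dots> = of_real (2 * pi) * (fps_nth g m * of_real \<rho> ^ (2 * m))"
    using power_add[of "of_real \<rho> :: complex" m m] by (simp add: I_def mult_ac flip: mult_2)
  finally have "(\<Sum>j. I j) = of_real (2 * pi) * (fps_nth g m * of_real \<rho> ^ (2 * m))" .
  moreover have "(\<Sum>j. h j \<theta>) = eval_fps g (of_real \<rho> * cis \<theta>) * (of_real \<rho> * cis (-\<theta>)) ^ m" for \<theta>
  proof -
    have "cis (of_int (int j - int m) * \<theta>) = cis \<theta> ^ j * cis (-\<theta>) ^ m" for j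
      by (simp only: Complex.DeMoivre cis_mult) (simp add: left_diff_distrib)
    then have "(\<lambda>j. h j \<theta>) = (\<lambda>j. (fps_nth g j * (of_real \<rho> * cis \<theta>) ^ j) * (of_real \<rho> * cis (-\<theta>)) ^ m)"
      by (simp only: h_def power_mult_distrib mult_ac)
    then show ?thesis
      unfolding eval_fps_def by (simp only: suminf_mult2[OF summable_fps[OF rad[of \<theta>]]])
  qed
  ultimately show ?thesis using hI by simp
qed

section \<open>Circular means and Taylor's formula for \<open>fc\<close>\<close>

context kreiss
begin

text \<open>Parseval pairing of \<open>g\<close> with the resolvent on circles of equal radius: only
  equal indices survive, so the argument is \<open>\<rho>\<^sup>2\<close>. Both factors stay at
  distance 1 - \<rho> from the unit circle, which is comparable with
  \<open>1 - \<rho>\<^sup>2\<close>.\<close>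

lemma fc_fourier:
  assumes "fps_conv_radius g \<ge> 1" "0 \<le> \<rho>" "\<rho> < 1"
  shows "((\<lambda>\<theta>. eval_fps g (of_real \<rho> * cis \<theta>) *\<^sub>C res (of_real \<rho> * cis (-\<theta>))) has_integral
     (2 * pi) *\<^sub>R fc g (\<rho>\<^sup>2)) {-pi..pi}"
proof -
  define h where "h = (\<lambda>m \<theta>. (eval_fps g (of_real \<rho> * cis \<theta>) * (of_real \<rho> * cis (-\<theta>)) ^ m) *\<^sub>C t ^ m)"
  define I where "I = (\<lambda>m. (of_real (2 * pi) * (fps_nth g m * of_real \<rho> ^ (2 * m))) *\<^sub>C t ^ m)"
  have rad: "ereal (norm (of_real \<rho> * cis \<theta>)) < fps_conv_radius g" for \<theta>
    using assms by (intro less_le_trans[OF _ assms(1)]) (simp add: norm_mult)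
  have cont: "continuous_on {-pi..pi} (\<lambda>\<theta>. eval_fps g (of_real \<rho> * cis \<theta>))"
    by (rule continuous_on_eval_fps'[OF _ ]) (use rad in \<open>auto intro!: continuous_intros simp: dist_norm\<close>)
  then have "bounded ((\<lambda>\<theta>. eval_fps g (of_real \<rho> * cis \<theta>)) ` {-pi..pi})"
    by (intro compact_imp_bounded compact_continuous_image) auto
  then obtain B where B: "\<And>\<theta>. \<theta> \<in> {-pi..pi} \<Longrightarrow> cmod (eval_fps g (of_real \<rho> * cis \<theta>)) \<le> B"
    unfolding bounded_iff by fast
  have hI: "((\<lambda>\<theta>. \<Sum>m. h m \<theta>) has_integral (\<Sum>m. I m)) {-pi..pi}"
  proof (rule has_integral_suminf)
    show "summable (\<lambda>m. B * (\<rho> ^ m * norm (t ^ m)))"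
      using assms by (intro summable_mult summable_power)
    show "continuous_on {-pi..pi} (h k)" for k
      unfolding h_def by (intro scaleC.continuous_on continuous_intros cont)
    show "norm (h k \<theta>) \<le> B * (\<rho> ^ k * norm (t ^ k))" if "\<theta> \<in> {-pi..pi}" for k \<theta>
      using mult_right_mono[OF B[OF that], of "\<rho> ^ k * norm (t ^ k)"] assms
      by (simp add: h_def norm_scaleC norm_mult norm_power mult_ac)
    show "(h k has_integral I k) {-pi..pi}" for k
      using has_integral_linear[OF eval_fps_fourier[OF assms] scaleC.bounded_linear_left[of "t ^ k"]]
      unfolding h_def I_def o_def .
  qed
  have "I m = (2 * pi) *\<^sub>R ((fps_nth g m * of_real (\<rho>\<^sup>2) ^ m) *\<^sub>C t ^ m)" for m
    by (simp only: I_def scaleC_of_real[symmetric] scaleC_scaleC of_real_power power_mult[symmetric])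
  then have "I = (\<lambda>m. (2 * pi) *\<^sub>R ((fps_nth g m * of_real (\<rho>\<^sup>2) ^ m) *\<^sub>C t ^ m))" ..
  then have "I sums ((2 * pi) *\<^sub>R fc g (\<rho>\<^sup>2))"
    using sums_scaleR_right[OF fc_sums[OF assms(1), of "\<rho>\<^sup>2"], of "2 * pi"] assms
    by (simp add: power_less_one_iff)
  moreover have "(\<Sum>m. h m \<theta>) = eval_fps g (of_real \<rho> * cis \<theta>) *\<^sub>C res (of_real \<rho> * cis (-\<theta>))" for \<theta>
  proof -
    have "(\<lambda>m. eval_fps g (of_real \<rho> * cis \<theta>) *\<^sub>C (of_real \<rho> * cis (-\<theta>)) ^ m *\<^sub>C t ^ m) sums
      (eval_fps g (of_real \<rho> * cis \<theta>) *\<^sub>C res (of_real \<rho> * cis (-\<theta>)))"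
      using assms by (intro bounded_linear.sums[OF scaleC.bounded_linear_right] res_sums) (simp add: norm_mult)
    then show ?thesis by (simp add: h_def scaleC_scaleC sums_iff)
  qed
  ultimately show ?thesis using hI by (simp add: sums_iff)
qed

text \<open>No power is lost between hypothesis and conclusion: with x = 1 - \<rho> the resolvent
  contributes 1 / x and the angular integral \<open>x powr (1 - \<beta>)\<close>. The base 10 is 5
  from \<open>norm_one_minus_polar_ge\<close> times 2 from
  \<open>(1 - u) / 2 \<le> x\<close>.\<close>

lemma fc_second_derivative_bound:
  assumes "fps_conv_radius g \<ge> 1" "\<beta> > 1" "0 \<le> u" "u < 1" "D \<ge> 0"
    and g: "\<And>z. cmod z < 1 \<Longrightarrow> cmod (eval_fps g z) \<le> D * cmod (1 - z) powr (-\<beta>)"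
  shows "norm (fc g u) \<le> K * 10 powr \<beta> / (\<beta> - 1) * D * (1 - u) powr (-\<beta>)"
proof -
  define \<rho> where "\<rho> = sqrt u"
  define x where "x = 1 - \<rho>"
  have \<rho>: "0 \<le> \<rho>" "\<rho> < 1" "\<rho>\<^sup>2 = u" using assms by (auto simp: \<rho>_def)
  then have x: "x > 0" by (simp add: x_def)
  have "norm ((2 * pi) *\<^sub>R fc g u) \<le> K / x * D * 5 powr \<beta> * integral {-pi..pi} (\<lambda>\<theta>. (x + \<bar>\<theta>\<bar>) powr (-\<beta>))"
  proof -
    have int: "((\<lambda>\<theta>. eval_fps g (of_real \<rho> * cis \<theta>) *\<^sub>C res (of_real \<rho> * cis (-\<theta>))) has_integral
       (2 * pi) *\<^sub>R fc g u) {-pi..pi}"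
      using fc_fourier[OF assms(1) \<rho>(1,2)] \<rho>(3) by simp
    have "norm (integral {-pi..pi} (\<lambda>\<theta>. eval_fps g (of_real \<rho> * cis \<theta>) *\<^sub>C res (of_real \<rho> * cis (-\<theta>))))
      \<le> integral {-pi..pi} (\<lambda>\<theta>. K / x * D * 5 powr \<beta> * (x + \<bar>\<theta>\<bar>) powr (-\<beta>))"
    proof (rule integral_norm_bound_integral)
      show "(\<lambda>\<theta>. eval_fps g (of_real \<rho> * cis \<theta>) *\<^sub>C res (of_real \<rho> * cis (-\<theta>))) integrable_on {-pi..pi}"
        using int by blast
      show "(\<lambda>\<theta>. K / x * D * 5 powr \<beta> * (x + \<bar>\<theta>\<bar>) powr (-\<beta>)) integrable_on {-pi..pi}"
        using x by (intro integrable_continuous_real continuous_intros) auto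
      fix \<theta> assume \<theta>: "\<theta> \<in> {-pi..pi}"
      let ?z = "of_real \<rho> * cis \<theta>"
      have "(x + \<bar>\<theta>\<bar>) / 5 \<le> cmod (1 - ?z)"
        using norm_one_minus_polar_ge[of \<theta> \<rho>] \<theta> \<rho> by (simp add: x_def abs_le_iff)
      then have "cmod (1 - ?z) powr (-\<beta>) \<le> ((x + \<bar>\<theta>\<bar>) / 5) powr (-\<beta>)"
        using x assms by (intro powr_mono2') auto
      also have "\<dots> = 5 powr \<beta> * (x + \<bar>\<theta>\<bar>) powr (-\<beta>)"
        using x by (simp add: powr_divide powr_minus field_simps)
      finally have "cmod (eval_fps g ?z) \<le> D * (5 powr \<beta> * (x + \<bar>\<theta>\<bar>) powr (-\<beta>))"
        using \<rho> assms by (intro g[THEN order_trans] mult_left_mono) (auto simp: norm_mult)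
      moreover have "norm (res (of_real \<rho> * cis (-\<theta>))) \<le> K / x"
        using res_bound[of "of_real \<rho> * cis (-\<theta>)"] \<rho> by (simp add: norm_mult x_def)
      ultimately have "cmod (eval_fps g ?z) * norm (res (of_real \<rho> * cis (-\<theta>))) \<le>
         (D * (5 powr \<beta> * (x + \<bar>\<theta>\<bar>) powr (-\<beta>))) * (K / x)"
        using assms by (intro mult_mono) auto
      then show "norm (eval_fps g ?z *\<^sub>C res (of_real \<rho> * cis (-\<theta>))) \<le> K / x * D * 5 powr \<beta> * (x + \<bar>\<theta>\<bar>) powr (-\<beta>)"
        by (simp add: norm_scaleC mult_ac)
    qed
    then show ?thesis using int by (simp add: integral_unique)
  qed
  also have "\<dots> \<le> K / x * D * 5 powr \<beta> * (2 * x powr (1 - \<beta>) / (\<beta> - 1))"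
    using x assms K_ge by (intro mult_left_mono integral_powr_polar_le) auto
  also have "x powr (1 - \<beta>) = x * x powr (-\<beta>)"
    using x by (simp add: powr_diff powr_minus field_simps)
  also have "K / x * D * 5 powr \<beta> * (2 * (x * x powr (-\<beta>)) / (\<beta> - 1)) = 2 * (K * 5 powr \<beta> / (\<beta> - 1) * D * x powr (-\<beta>))"
    using x by (simp add: field_simps)
  also have "\<dots> \<le> (2 * pi) * (K * 5 powr \<beta> / (\<beta> - 1) * D * x powr (-\<beta>))"
    using assms K_ge pi_gt3 by (intro mult_right_mono) auto
  finally have "(2 * pi) * norm (fc g u) \<le> (2 * pi) * (K * 5 powr \<beta> / (\<beta> - 1) * D * x powr (-\<beta>))"
    by simp
  then have "norm (fc g u) \<le> K * 5 powr \<beta> / (\<beta> - 1) * D * x powr (-\<beta>)"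
    by (rule mult_left_le_imp_le) simp
  also have "x powr (-\<beta>) \<le> ((1 - u) / 2) powr (-\<beta>)"
  proof (rule powr_mono2')
    have "1 - u = x * (1 + \<rho>)" by (simp add: x_def \<rho>(3)[symmetric] power2_eq_square algebra_simps)
    also have "\<dots> \<le> x * 2" using x \<rho> by (intro mult_left_mono) auto
    finally show "(1 - u) / 2 \<le> x" by simp
  qed (use assms in auto)
  also have "((1 - u) / 2) powr (-\<beta>) = 2 powr \<beta> * (1 - u) powr (-\<beta>)"
    using assms by (simp add: powr_divide powr_minus field_simps)
  also have "K * 5 powr \<beta> / (\<beta> - 1) * D * (2 powr \<beta> * (1 - u) powr (-\<beta>)) =
      K * 10 powr \<beta> / (\<beta> - 1) * D * (1 - u) powr (-\<beta>)"
    using powr_mult[of 5 2 \<beta>] by simp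
  finally show ?thesis using assms K_ge by (simp add: mult_left_mono divide_right_mono)
qed

text \<open>Taylor's formula with integral remainder, checked term by term: integrating
  \<open>(r - u) * u ^ k\<close> produces the denominator \<open>(k + 1) * (k + 2)\<close>, which
  cancels the factor created by differentiating the series twice.\<close>

lemma fc_taylor:
  assumes "fps_conv_radius f \<ge> 1" "0 \<le> r" "r < 1"
  shows "((\<lambda>u. (r - u) *\<^sub>R (t\<^sup>2 * fc (fps_deriv (fps_deriv f)) u)) has_integral
    (fc f r - fps_nth f 0 *\<^sub>C 1 - (fps_nth f 1 * of_real r) *\<^sub>C t)) {0..r}"
proof -
  define g where "g = fps_deriv (fps_deriv f)"
  have rad: "fps_conv_radius g \<ge> 1"
    unfolding g_def by (rule order_trans[OF order_trans[OF assms(1) fps_conv_radius_deriv] fps_conv_radius_deriv])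
  define h where "h = (\<lambda>m u. (r - u) *\<^sub>R (t\<^sup>2 * ((fps_nth g m * of_real u ^ m) *\<^sub>C t ^ m)))"
  define I where "I = (\<lambda>m. (fps_nth f (m + 2) * of_real r ^ (m + 2)) *\<^sub>C t ^ (m + 2))"
  have hI: "((\<lambda>u. \<Sum>m. h m u) has_integral (\<Sum>m. I m)) {0..r}"
  proof (rule has_integral_suminf)
    show "summable (\<lambda>m. norm (t\<^sup>2) * norm ((fps_nth g m * of_real r ^ m) *\<^sub>C t ^ m))"
      by (intro summable_mult fc_summable rad assms)
    show "continuous_on {0..r} (h k)" for k
      unfolding h_def by (intro scaleC.continuous_on continuous_intros)
    show "norm (h k u) \<le> norm (t\<^sup>2) * norm ((fps_nth g k * of_real r ^ k) *\<^sub>C t ^ k)" if "u \<in> {0..r}" for k u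
    proof -
      have "norm (h k u) \<le> 1 * (norm (t\<^sup>2) * norm ((fps_nth g k * of_real u ^ k) *\<^sub>C t ^ k))"
        unfolding h_def norm_scaleR using that assms by (intro mult_mono norm_mult_ineq) auto
      also have "norm ((fps_nth g k * of_real u ^ k) *\<^sub>C t ^ k) \<le> norm ((fps_nth g k * of_real r ^ k) *\<^sub>C t ^ k)"
        using that assms unfolding norm_scaleC norm_mult norm_power
        by (intro mult_right_mono mult_left_mono power_mono) auto
      finally show ?thesis by (simp add: mult_left_mono)
    qed
    show "(h k has_integral I k) {0..r}" for k
    proof -
      have "((\<lambda>u. (r - u) * u ^ k) has_integral
         ((r * r ^ (k + 1) / (k + 1) - r ^ (k + 2) / (k + 2)) - (r * 0 ^ (k + 1) / (k + 1) - 0 ^ (k + 2) / (k + 2)))) {0..r}"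
      proof (rule fundamental_theorem_of_calculus[OF assms(2)])
        fix x assume "x \<in> {0..r}"
        have "((\<lambda>u. r * u ^ (k + 1) / (k + 1) - u ^ (k + 2) / (k + 2)) has_real_derivative
            (r * (real (k + 1) * x ^ k) / (k + 1) - (real (k + 2) * x ^ (k + 1)) / (k + 2))) (at x within {0..r})"
          by (rule derivative_eq_intros refl | simp)+
        also have "r * (real (k + 1) * x ^ k) / (k + 1) - (real (k + 2) * x ^ (k + 1)) / (k + 2) = (r - x) * x ^ k"
          by (simp del: of_nat_add add: left_diff_distrib)
        finally show "((\<lambda>u. r * u ^ (k + 1) / (k + 1) - u ^ (k + 2) / (k + 2)) has_vector_derivative (r - x) * x ^ k)
            (at x within {0..r})"
          by (simp only: has_real_derivative_iff_has_vector_derivative[symmetric])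
      qed
      moreover have "r * r ^ (k + 1) / (k + 1) - r ^ (k + 2) / (k + 2) = r ^ (k + 2) / ((k + 1) * (k + 2))"
        by (simp add: field_simps)
      ultimately have "((\<lambda>u. (r - u) * u ^ k) has_integral r ^ (k + 2) / ((k + 1) * (k + 2))) {0..r}"
        by simp
      from has_integral_scaleR_left[OF this, of "fps_nth g k *\<^sub>C t ^ (k + 2)"]
      have "((\<lambda>u. ((r - u) * u ^ k) *\<^sub>R (fps_nth g k *\<^sub>C t ^ (k + 2))) has_integral
          (r ^ (k + 2) / ((k + 1) * (k + 2))) *\<^sub>R (fps_nth g k *\<^sub>C t ^ (k + 2))) {0..r}" .
      moreover have "((r - u) * u ^ k) *\<^sub>R (fps_nth g k *\<^sub>C t ^ (k + 2)) = h k u" for u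
      proof -
        have "t\<^sup>2 * t ^ k = t ^ (k + 2)" by (simp add: power_add[symmetric] add.commute)
        then show ?thesis
          by (simp add: h_def scaleC_simps flip: scaleC_of_real) (simp add: mult_ac)
      qed
      moreover have "(r ^ (k + 2) / ((k + 1) * (k + 2))) *\<^sub>R (fps_nth g k *\<^sub>C t ^ (k + 2)) = I k"
      proof -
        have "fps_nth g k = of_real ((k + 1) * (k + 2)) * fps_nth f (k + 2)"
          by (simp add: g_def algebra_simps)
        moreover have "of_real (r ^ (k + 2) / ((k + 1) * (k + 2))) * (of_real (real ((k + 1) * (k + 2)))) = (of_real r ^ (k + 2) :: complex)"
          unfolding of_real_mult[symmetric] of_real_power[symmetric]
          by (rule arg_cong[of _ _ complex_of_real]) (simp del: of_nat_mult of_nat_add)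
        ultimately have "of_real (r ^ (k + 2) / ((k + 1) * (k + 2))) * fps_nth g k = fps_nth f (k + 2) * of_real r ^ (k + 2)"
          by (simp only: mult.assoc[symmetric]) (rule mult.commute)
        then show ?thesis
          by (simp only: I_def scaleC_of_real[symmetric] scaleC_scaleC)
      qed
      ultimately show ?thesis by simp
    qed
  qed
  have "summable (\<lambda>k. (fps_nth f k * of_real r ^ k) *\<^sub>C t ^ k)"
    by (rule sums_summable[OF fc_sums[OF assms]])
  from suminf_split_initial_segment[OF this, of 2]
  have "(\<Sum>m. I m) = fc f r - fps_nth f 0 *\<^sub>C 1 - (fps_nth f 1 * of_real r) *\<^sub>C t"
    by (simp add: I_def fc_def numeral_2_eq_2 algebra_simps)
  moreover have "(\<Sum>m. h m u) = (r - u) *\<^sub>R (t\<^sup>2 * fc g u)" if "u \<in> {0..r}" for u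
  proof -
    have "(\<lambda>m. h m u) sums ((r - u) *\<^sub>R (t\<^sup>2 * fc g u))"
      unfolding h_def using that assms by (intro sums_scaleR_right sums_mult fc_sums rad) auto
    then show ?thesis by (simp add: sums_iff)
  qed
  ultimately show ?thesis
    using has_integral_eq[OF _ hI, of "\<lambda>u. (r - u) *\<^sub>R (t\<^sup>2 * fc g u)"] by (simp add: g_def)
qed

end

section \<open>The functional calculus bound\<close>

lemma fps_expansion_unit_ball:
  assumes "F holomorphic_on ball 0 1"
  shows "fps_conv_radius (fps_expansion F 0) \<ge> 1"
    and "cmod z < 1 \<Longrightarrow> eval_fps (fps_expansion F 0) z = F z"
proof -
  have *: "F holomorphic_on eball 0 1"
    using assms by (simp add: one_ereal_def)
  show "fps_conv_radius (fps_expansion F 0) \<ge> 1"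
    by (rule conv_radius_fps_expansion[OF *])
  show "eval_fps (fps_expansion F 0) z = F z" if "cmod z < 1"
    using eval_fps_expansion'[OF *, of z] that by (simp add: one_ereal_def)
qed

lemma eval_fps_deriv_unit_ball:
  fixes f :: "complex fps"
  assumes "fps_conv_radius f \<ge> 1" and eq: "\<And>z. cmod z < 1 \<Longrightarrow> eval_fps f z = F z"
    and F: "\<And>z. cmod z < 1 \<Longrightarrow> (F has_field_derivative F' z) (at z)" and "cmod z < 1"
  shows "eval_fps (fps_deriv f) z = F' z"
proof -
  have "(eval_fps f has_field_derivative eval_fps (fps_deriv f) z) (at z)"
    using assms by (intro has_field_derivative_eval_fps less_le_trans[OF _ assms(1)]) (auto simp: one_ereal_def)
  then have "(F has_field_derivative eval_fps (fps_deriv f) z) (at z)"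
    by (rule has_field_derivative_transform_within_open[of _ _ _ "ball 0 1"]) (use assms in auto)
  then show ?thesis
    using F[OF \<open>cmod z < 1\<close>] by (rule DERIV_unique)
qed

lemma one_minus_notin_nonpos_Reals: "cmod z < 1 \<Longrightarrow> 1 - z \<notin> \<real>\<^sub>\<le>\<^sub>0"
  using abs_Re_le_cmod[of z] by (auto simp: complex_nonpos_Reals_iff)

lemma has_field_derivative_one_minus_powr:
  assumes "cmod z < 1"
  shows "((\<lambda>z. (1 - z) powr s) has_field_derivative - s * (1 - z) powr (s - 1)) (at z)"
proof -
  have "((\<lambda>z. (1 - z) powr s) has_field_derivative s * (1 - z) powr (s - 1) * (0 - 1)) (at z)"
    by (rule DERIV_chain2[where f = "\<lambda>z. z powr s" and g = "\<lambda>z. 1 - z"])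
       (intro has_field_derivative_powr one_minus_notin_nonpos_Reals assms derivative_intros)+
  then show ?thesis by simp
qed

context kreiss
begin

text \<open>Up to constants the hypothesis says that the second derivative is integrable over the disc with
a bound independent of the scale \<open>p\<close>: with \<open>\<sigma> = |1 - z|\<close> it is dominated by
\<open>\<sigma>\<^sup>-\<^sup>2 min (p \<sigma>\<^sup>\<alpha>) (1 / (p \<sigma>\<^sup>\<alpha>))\<close>.\<close>

lemma fc_bound:
  assumes rad: "fps_conv_radius f \<ge> 1" and \<alpha>: "0 < \<alpha>" "\<alpha> < 1" and "p > 0" "D \<ge> 0"
    and b1: "\<And>z. cmod z < 1 \<Longrightarrow> cmod (eval_fps (fps_deriv (fps_deriv f)) z) \<le> (D * p) * cmod (1 - z) powr (- (2 - \<alpha>))"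
    and b2: "\<And>z. cmod z < 1 \<Longrightarrow> cmod (eval_fps (fps_deriv (fps_deriv f)) z) \<le> (D / p) * cmod (1 - z) powr (- (2 + \<alpha>))"
    and r: "0 \<le> r" "r < 1"
  shows "norm (fc f r) \<le> cmod (fps_nth f 0) * K + cmod (fps_nth f 1) * norm t + 4000 * K / (\<alpha> * (1 - \<alpha>)) * norm (t\<^sup>2) * D"
proof -
  define g where "g = fps_deriv (fps_deriv f)"
  have radg: "fps_conv_radius g \<ge> 1"
    unfolding g_def by (rule order_trans[OF order_trans[OF rad fps_conv_radius_deriv] fps_conv_radius_deriv])
  define C where "C = 1000 * K / (1 - \<alpha>) * norm (t\<^sup>2) * D"
  have C0: "C \<ge> 0" using K_ge \<alpha> \<open>D \<ge> 0\<close> by (simp add: C_def)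
  \<comment> \<open>Both exponents are below 3, whence \<open>1000 = 10 ^ 3\<close>, and exceed 1 by
    at least \<open>1 - \<alpha>\<close>, whence the denominator.\<close>
  have const: "K * 10 powr \<beta> / (\<beta> - 1) \<le> 1000 * K / (1 - \<alpha>)" if "\<beta> = 2 - \<alpha> \<or> \<beta> = 2 + \<alpha>" for \<beta>
  proof -
    have "10 powr \<beta> \<le> 10 powr 3" using that \<alpha> by (intro powr_mono) auto
    also have "(10::real) powr 3 = 1000" using powr_realpow[of 10 3] by simp
    finally have "K * 10 powr \<beta> \<le> 1000 * K" using K_ge by (simp add: mult.commute mult_left_mono)
    then show ?thesis using that \<alpha> K_ge by (intro frac_le) auto
  qed
  have fcg: "norm (fc g u) \<le> 1000 * K / (1 - \<alpha>) * E * (1 - u) powr (- \<beta>)"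
    if "\<beta> = 2 - \<alpha> \<or> \<beta> = 2 + \<alpha>" "E \<ge> 0" "0 \<le> u" "u < 1"
      "\<And>z. cmod z < 1 \<Longrightarrow> cmod (eval_fps g z) \<le> E * cmod (1 - z) powr (-\<beta>)" for \<beta> E u
  proof -
    have "norm (fc g u) \<le> K * 10 powr \<beta> / (\<beta> - 1) * E * (1 - u) powr (-\<beta>)"
      using that \<alpha> by (intro fc_second_derivative_bound radg) auto
    also have "\<dots> \<le> 1000 * K / (1 - \<alpha>) * E * (1 - u) powr (- \<beta>)"
      using that by (intro mult_right_mono const) auto
    finally show ?thesis .
  qed
  have main: "norm ((r - u) *\<^sub>R (t\<^sup>2 * fc g u)) \<le> 4 * C * (p * (1 - u) powr (\<alpha> - 1) / (1 + p * (1 - u) powr \<alpha>)\<^sup>2)"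
    if u: "u \<in> {0..r}" for u
  proof -
    define y where "y = 1 - u"
    define X where "X = p * y powr \<alpha>"
    have y: "y > 0" "u = 1 - y" using u r by (auto simp: y_def)
    have X: "X > 0" using y \<open>p > 0\<close> by (simp add: X_def)
    have n: "norm ((r - u) *\<^sub>R (t\<^sup>2 * fc g u)) \<le> y * (norm (t\<^sup>2) * norm (fc g u))"
      unfolding norm_scaleR using u r y by (intro mult_mono norm_mult_ineq) auto
    have "norm (fc g u) \<le> 1000 * K / (1 - \<alpha>) * (D * p) * (1 - u) powr (- (2 - \<alpha>))"
      using u r \<open>p > 0\<close> \<open>D \<ge> 0\<close> b1 by (intro fcg) (auto simp: g_def)
    also have "(1 - u) powr (- (2 - \<alpha>)) = y powr \<alpha> / y\<^sup>2"
      using y by (simp add: powr_diff)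
    finally have "y * (norm (t\<^sup>2) * norm (fc g u)) \<le> y * (norm (t\<^sup>2) * (1000 * K / (1 - \<alpha>) * (D * p) * (y powr \<alpha> / y\<^sup>2)))"
      using y by (intro mult_left_mono) auto
    also have "\<dots> = C / y * X"
      using y by (simp add: C_def X_def power2_eq_square mult_ac)
    finally have 1: "y * (norm (t\<^sup>2) * norm (fc g u)) \<le> C / y * X" .
    have "norm (fc g u) \<le> 1000 * K / (1 - \<alpha>) * (D / p) * (1 - u) powr (- (2 + \<alpha>))"
      using u r \<open>p > 0\<close> \<open>D \<ge> 0\<close> b2 by (intro fcg) (auto simp: g_def)
    also have "(1 - u) powr (- (2 + \<alpha>)) = 1 / (y powr \<alpha> * y\<^sup>2)"
      using y by (simp only: powr_minus powr_add) (simp add: divide_simps)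
    finally have "y * (norm (t\<^sup>2) * norm (fc g u)) \<le> y * (norm (t\<^sup>2) * (1000 * K / (1 - \<alpha>) * (D / p) * (1 / (y powr \<alpha> * y\<^sup>2))))"
      using y by (intro mult_left_mono) auto
    also have "\<dots> = C / y * (1 / X)"
      using y by (simp add: C_def X_def power2_eq_square mult_ac)
    finally have 2: "y * (norm (t\<^sup>2) * norm (fc g u)) \<le> C / y * (1 / X)" .
    \<comment> \<open>The minimum is replaced by a smooth majorant that has an elementary
      antiderivative after division by y. The two cases rest on \<open>1 + X \<le> 2\<close> and
      \<open>1 + X \<le> 2 * X\<close>.\<close>
    have "min X (1 / X) \<le> 4 * X / (1 + X)\<^sup>2"
    proof (cases "X \<le> 1")
      case True
      then have "(1 + X)\<^sup>2 \<le> 2\<^sup>2" using X by (intro power_mono) auto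
      then have "X * (1 + X)\<^sup>2 \<le> X * 4" using X by (intro mult_left_mono) auto
      then show ?thesis using X by (simp add: min_le_iff_disj field_simps)
    next
      case False
      then have "(1 + X)\<^sup>2 \<le> (2 * X)\<^sup>2" using X by (intro power_mono) auto
      then show ?thesis using X by (simp add: min_le_iff_disj field_simps power2_eq_square)
    qed
    then have "C / y * min X (1 / X) \<le> C / y * (4 * X / (1 + X)\<^sup>2)"
      using C0 y by (intro mult_left_mono) auto
    moreover have "y * (norm (t\<^sup>2) * norm (fc g u)) \<le> C / y * min X (1 / X)"
      using 1 2 unfolding min_def by presburger
    ultimately have "norm ((r - u) *\<^sub>R (t\<^sup>2 * fc g u)) \<le> C / y * (4 * X / (1 + X)\<^sup>2)"
      using n by linarith
    also have "\<dots> = 4 * C * (p * (y powr \<alpha> / y) / (1 + X)\<^sup>2)"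
      by (simp add: X_def)
    also have "y powr \<alpha> / y = y powr (\<alpha> - 1)"
      using y by (simp add: powr_diff)
    finally show ?thesis by (simp only: X_def y_def)
  qed
  \<comment> \<open>With \<open>X = p * (1 - u) powr \<alpha>\<close> the integrand is a multiple of
    the derivative of \<open>1 / (1 + X)\<close>. This function takes values in [0, 1] whatever p
    and r are, so the dependence on the scale disappears here, at the price of the factor
    \<open>1 / \<alpha>\<close>.\<close>
  have maj: "((\<lambda>u. 4 * C * (p * (1 - u) powr (\<alpha> - 1) / (1 + p * (1 - u) powr \<alpha>)\<^sup>2)) has_integral
      (4 * C / \<alpha> / (1 + p * (1 - r) powr \<alpha>) - 4 * C / \<alpha> / (1 + p * (1 - 0) powr \<alpha>))) {0..r}"
  proof (rule fundamental_theorem_of_calculus[OF r(1)])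
    fix u assume u: "u \<in> {0..r}"
    then have pos: "1 + p * (1 - u) powr \<alpha> > 0" "1 - u > 0"
      using r \<open>p > 0\<close> by (auto intro!: add_pos_nonneg)
    have "((\<lambda>u. 4 * C / \<alpha> / (1 + p * (1 - u) powr \<alpha>)) has_real_derivative
      - (4 * C / \<alpha> * (p * (\<alpha> * (1 - u) powr (\<alpha> - 1) * (0 - 1)))) / ((1 + p * (1 - u) powr \<alpha>) * (1 + p * (1 - u) powr \<alpha>))) (at u within {0..r})"
      using pos by (auto intro!: derivative_eq_intros)
    also have "- (4 * C / \<alpha> * (p * (\<alpha> * (1 - u) powr (\<alpha> - 1) * (0 - 1)))) / ((1 + p * (1 - u) powr \<alpha>) * (1 + p * (1 - u) powr \<alpha>))
       = 4 * C * (p * (1 - u) powr (\<alpha> - 1) / (1 + p * (1 - u) powr \<alpha>)\<^sup>2)"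
      using \<alpha> by (simp add: power2_eq_square)
    finally show "((\<lambda>u. 4 * C / \<alpha> / (1 + p * (1 - u) powr \<alpha>)) has_vector_derivative
      4 * C * (p * (1 - u) powr (\<alpha> - 1) / (1 + p * (1 - u) powr \<alpha>)\<^sup>2)) (at u within {0..r})"
      by (simp only: has_real_derivative_iff_has_vector_derivative)
  qed
  note tay = fc_taylor[OF rad r, folded g_def]
  have "norm (fc f r - fps_nth f 0 *\<^sub>C 1 - (fps_nth f 1 * of_real r) *\<^sub>C t) \<le>
    4 * C / \<alpha> / (1 + p * (1 - r) powr \<alpha>) - 4 * C / \<alpha> / (1 + p * (1 - 0) powr \<alpha>)"
    using integral_norm_bound_integral[OF has_integral_integrable[OF tay] has_integral_integrable[OF maj] main]
    by (simp only: integral_unique[OF tay] integral_unique[OF maj])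
  also have "\<dots> \<le> 4 * C / \<alpha>"
  proof -
    have "4 * C / \<alpha> / (1 + p * (1 - r) powr \<alpha>) \<le> 4 * C / \<alpha> / 1"
      using C0 \<alpha> \<open>p > 0\<close> by (intro divide_left_mono) (auto intro!: add_pos_nonneg)
    moreover have "4 * C / \<alpha> / (1 + p * (1 - 0) powr \<alpha>) \<ge> 0"
      using C0 \<alpha> \<open>p > 0\<close> by (intro divide_nonneg_nonneg add_nonneg_nonneg) auto
    ultimately show ?thesis by simp
  qed
  finally have n1: "norm (fc f r - fps_nth f 0 *\<^sub>C 1 - (fps_nth f 1 * of_real r) *\<^sub>C t) \<le> 4 * C / \<alpha>" .
  have n2: "norm (fps_nth f 0 *\<^sub>C (1::'a)) \<le> cmod (fps_nth f 0) * K"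
    using K_ge by (simp add: norm_scaleC mult_left_mono)
  have n3: "norm ((fps_nth f 1 * of_real r) *\<^sub>C t) \<le> cmod (fps_nth f 1) * norm t"
    using r mult_left_mono[of r 1 "cmod (fps_nth f 1) * norm t"]
    by (simp add: norm_scaleC norm_mult mult_ac)
  have tri: "norm x \<le> norm y + norm z + norm (x - y - z)" for x y z :: 'a
    using norm_triangle_ineq[of "y + z" "x - y - z"] norm_triangle_ineq[of y z] by simp
  have "norm (fc f r) \<le> norm (fps_nth f 0 *\<^sub>C (1::'a)) + norm ((fps_nth f 1 * of_real r) *\<^sub>C t)
     + norm (fc f r - fps_nth f 0 *\<^sub>C 1 - (fps_nth f 1 * of_real r) *\<^sub>C t)"
    by (rule tri)
  also have "\<dots> \<le> cmod (fps_nth f 0) * K + cmod (fps_nth f 1) * norm t + 4 * C / \<alpha>"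
    using n1 n2 n3 by linarith
  also have "4 * C / \<alpha> = 4000 * K / (\<alpha> * (1 - \<alpha>)) * norm (t\<^sup>2) * D"
    by (simp add: C_def mult_ac)
  finally show ?thesis .
qed

definition pfps :: "real \<Rightarrow> (complex \<Rightarrow> complex) \<Rightarrow> complex fps" where
  "pfps \<alpha> G = fps_expansion (\<lambda>z. G ((1 - z) powr of_real \<alpha>)) 0"

lemma pfps:
  assumes G: "\<And>z. cmod z < 1 \<Longrightarrow> (G has_field_derivative G' z) (at ((1 - z) powr of_real \<alpha>))"
  shows pfps_radius: "fps_conv_radius (pfps \<alpha> G) \<ge> 1"
    and eval_pfps: "cmod z < 1 \<Longrightarrow> eval_fps (pfps \<alpha> G) z = G ((1 - z) powr of_real \<alpha>)"
proof -
  have "(\<lambda>z. G ((1 - z) powr of_real \<alpha>)) holomorphic_on ball 0 1"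
    unfolding holomorphic_on_open[OF open_ball]
    by (intro ballI exI, rule DERIV_chain2[OF G has_field_derivative_one_minus_powr]) auto
  from fps_expansion_unit_ball[OF this]
  show "fps_conv_radius (pfps \<alpha> G) \<ge> 1"
    and "cmod z < 1 \<Longrightarrow> eval_fps (pfps \<alpha> G) z = G ((1 - z) powr of_real \<alpha>)"
    by (auto simp: pfps_def)
qed

text \<open>The conditions on \<open>G'\<close> and \<open>G''\<close> are those of a dilation
  \<open>G u = H (p * u)\<close> whose first two derivatives decay like the powers -2 and -3, so
  \<open>D\<close> can be independent of \<open>p\<close>. Put \<sigma> = |1 - z| and
  \<open>X = p * \<sigma> powr \<alpha>\<close>. The first two derivatives of
  \<open>(1 - z) powr \<alpha>\<close> are at most \<open>X / (p * \<sigma>)\<close> and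
  \<open>X / (p * \<sigma>\<^sup>2)\<close>, so each of the two terms of the chain rule is at most D
  / \<open>\<sigma>\<^sup>2\<close> times \<open>X / (1 + X)\<^sup>2\<close>. The last quotient is
  below both X and 1 / X, which gives the two hypotheses of \<open>fc_bound\<close>. The two terms
  double 4000 to 8000.\<close>

lemma fc_pfps_bound:
  assumes \<alpha>: "0 < \<alpha>" "\<alpha> < 1" and "p > 0" "D \<ge> 0"
    and G: "\<And>z. cmod z < 1 \<Longrightarrow> (G has_field_derivative G' ((1 - z) powr of_real \<alpha>)) (at ((1 - z) powr of_real \<alpha>))"
    and G': "\<And>z. cmod z < 1 \<Longrightarrow> (G' has_field_derivative G'' ((1 - z) powr of_real \<alpha>)) (at ((1 - z) powr of_real \<alpha>))"
    and n1: "\<And>u z. cmod z < 1 \<Longrightarrow> u = (1 - z) powr of_real \<alpha> \<Longrightarrow> cmod (G' u) \<le> D * p / (1 + p * cmod u)\<^sup>2"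
    and n2: "\<And>u z. cmod z < 1 \<Longrightarrow> u = (1 - z) powr of_real \<alpha> \<Longrightarrow> cmod (G'' u) \<le> D * p\<^sup>2 / (1 + p * cmod u) ^ 3"
    and r: "0 \<le> r" "r < 1"
  shows "norm (fc (pfps \<alpha> G) r) \<le> cmod (G 1) * K + (norm t + 8000 * K / (\<alpha> * (1 - \<alpha>)) * norm (t\<^sup>2)) * D"
proof -
  define f where "f = pfps \<alpha> G"
  define u where "u = (\<lambda>z::complex. (1 - z) powr of_real \<alpha>)"
  define u1 where "u1 = (\<lambda>z::complex. - of_real \<alpha> * (1 - z) powr (of_real \<alpha> - 1))"
  define u2 where "u2 = (\<lambda>z::complex. - of_real \<alpha> * (- (of_real \<alpha> - 1) * (1 - z) powr (of_real \<alpha> - 1 - 1)))"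
  have f: "fps_conv_radius f \<ge> 1" "\<And>z. cmod z < 1 \<Longrightarrow> eval_fps f z = G (u z)"
    using pfps[of G "\<lambda>z. G' (u z)" \<alpha>] G by (auto simp: f_def u_def)
  have du: "(u has_field_derivative u1 z) (at z)" "(u1 has_field_derivative u2 z) (at z)" if "cmod z < 1" for z
    unfolding u_def u1_def u2_def by (intro DERIV_cmult has_field_derivative_one_minus_powr that)+
  have d1: "((\<lambda>z. G (u z)) has_field_derivative G' (u z) * u1 z) (at z)" if "cmod z < 1" for z
    using DERIV_chain2[OF _ du(1)[OF that], of G] G[OF that] by (simp add: u_def)
  have d2: "((\<lambda>z. G' (u z) * u1 z) has_field_derivative (G'' (u z) * u1 z * u1 z + u2 z * G' (u z))) (at z)" if "cmod z < 1" for z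
    using DERIV_mult[OF DERIV_chain2[OF _ du(1)[OF that], of G'] du(2)[OF that]] G'[OF that] by (simp add: u_def)
  have e1: "eval_fps (fps_deriv f) z = G' (u z) * u1 z" if "cmod z < 1" for z
    by (rule eval_fps_deriv_unit_ball[OF f d1 that])
  have radf': "fps_conv_radius (fps_deriv f) \<ge> 1"
    by (rule order_trans[OF f(1) fps_conv_radius_deriv])
  have e2: "eval_fps (fps_deriv (fps_deriv f)) z = G'' (u z) * u1 z * u1 z + u2 z * G' (u z)" if "cmod z < 1" for z
    by (rule eval_fps_deriv_unit_ball[OF radf' e1 d2 that])
  have bound: "cmod (eval_fps (fps_deriv (fps_deriv f)) z) \<le> 2 * D * (X / (1 + X)\<^sup>2) / (cmod (1 - z))\<^sup>2"
    if z: "cmod z < 1" and X: "X = p * cmod (1 - z) powr \<alpha>" for z X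
  proof -
    define \<sigma> where "\<sigma> = cmod (1 - z)"
    have \<sigma>: "\<sigma> > 0" using z by (auto simp: \<sigma>_def)
    have X0: "X > 0" and X\<sigma>: "\<sigma> powr \<alpha> = X / p" using \<sigma> \<open>p > 0\<close> by (auto simp: X \<sigma>_def)
    have nu: "cmod (u z) = X / p"
      using X\<sigma> by (simp add: u_def norm_powr_real_powr' \<sigma>_def)
    have "cmod (u1 z) = \<alpha> * \<sigma> powr (\<alpha> - 1)"
      using \<alpha> norm_powr_real_powr'[of "of_real \<alpha> - 1" "1 - z"] by (simp add: u1_def norm_mult \<sigma>_def)
    also have "\<dots> \<le> 1 * \<sigma> powr (\<alpha> - 1)" using \<alpha> by (intro mult_right_mono) auto
    finally have nu1: "cmod (u1 z) \<le> X / p / \<sigma>" using \<sigma> X\<sigma> by (simp add: powr_diff)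
    have "cmod (u2 z) = (\<alpha> * (1 - \<alpha>)) * \<sigma> powr (\<alpha> - 1 - 1)"
    proof -
      have "cmod (1 - of_real \<alpha>) = 1 - \<alpha>"
        using \<alpha> norm_of_real[of "1 - \<alpha>", where 'a = complex] by simp
      then show ?thesis
        using \<alpha> norm_powr_real_powr'[of "of_real \<alpha> - 1 - 1" "1 - z"]
        by (simp add: u2_def norm_mult \<sigma>_def)
    qed
    also have "\<dots> \<le> 1 * \<sigma> powr (\<alpha> - 1 - 1)" using \<alpha> by (intro mult_right_mono) (auto intro: mult_le_one)
    finally have nu2: "cmod (u2 z) \<le> X / p / \<sigma>\<^sup>2"
      using \<sigma> X\<sigma> by (simp add: powr_diff power2_eq_square)
    have "cmod (G'' (u z)) \<le> D * p\<^sup>2 / (1 + X) ^ 3"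
      using n2[OF z refl] nu \<open>p > 0\<close> by (simp add: u_def)
    then have "cmod (G'' (u z) * u1 z * u1 z) \<le> (D * p\<^sup>2 / (1 + X) ^ 3) * (X / p / \<sigma>) * (X / p / \<sigma>)"
      unfolding norm_mult using nu1 X0 \<open>p > 0\<close> \<sigma> \<open>D \<ge> 0\<close> by (intro mult_mono) auto
    also have "\<dots> = D / \<sigma>\<^sup>2 * (X / (1 + X)\<^sup>2) * (X / (1 + X))"
      using \<open>p > 0\<close> by (simp add: power2_eq_square power3_eq_cube mult_ac)
    also have "\<dots> \<le> D / \<sigma>\<^sup>2 * (X / (1 + X)\<^sup>2) * 1"
      using X0 \<open>D \<ge> 0\<close> by (intro mult_left_mono) auto
    finally have a: "cmod (G'' (u z) * u1 z * u1 z) \<le> D / \<sigma>\<^sup>2 * (X / (1 + X)\<^sup>2)" by simp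
    have "cmod (G' (u z)) \<le> D * p / (1 + X)\<^sup>2"
      using n1[OF z refl] nu \<open>p > 0\<close> by (simp add: u_def)
    then have "cmod (u2 z * G' (u z)) \<le> (X / p / \<sigma>\<^sup>2) * (D * p / (1 + X)\<^sup>2)"
      unfolding norm_mult using nu2 X0 \<open>p > 0\<close> \<sigma> \<open>D \<ge> 0\<close> by (intro mult_mono) auto
    also have "\<dots> = D / \<sigma>\<^sup>2 * (X / (1 + X)\<^sup>2)"
      using \<open>p > 0\<close> by simp
    finally have "cmod (G'' (u z) * u1 z * u1 z + u2 z * G' (u z)) \<le> 2 * (D / \<sigma>\<^sup>2 * (X / (1 + X)\<^sup>2))"
      using a norm_triangle_ineq[of "G'' (u z) * u1 z * u1 z" "u2 z * G' (u z)"] by linarith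
    then show ?thesis by (simp add: e2[OF z] \<sigma>_def mult_ac)
  qed
  have "norm (fc f r) \<le> cmod (fps_nth f 0) * K + cmod (fps_nth f 1) * norm t + 4000 * K / (\<alpha> * (1 - \<alpha>)) * norm (t\<^sup>2) * (2 * D)"
  proof (rule fc_bound[OF f(1) \<alpha> \<open>p > 0\<close> _ _ _ r])
    fix z :: complex assume z: "cmod z < 1"
    define \<sigma> where "\<sigma> = cmod (1 - z)"
    have \<sigma>: "\<sigma> > 0" using z by (auto simp: \<sigma>_def)
    define X where "X = p * \<sigma> powr \<alpha>"
    have X0: "X > 0" using \<sigma> \<open>p > 0\<close> by (simp add: X_def)
    have b: "cmod (eval_fps (fps_deriv (fps_deriv f)) z) \<le> 2 * D * (X / (1 + X)\<^sup>2) / \<sigma>\<^sup>2"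
      using bound[OF z, of X] by (simp add: X_def \<sigma>_def)
    also have "\<dots> \<le> 2 * D * X / \<sigma>\<^sup>2"
      using X0 \<open>D \<ge> 0\<close> by (intro divide_right_mono mult_left_mono) (auto simp: divide_le_eq mult_le_cancel_left1 one_le_power)
    also have "\<dots> = 2 * D * p * \<sigma> powr (- (2 - \<alpha>))"
      using \<sigma> by (simp add: X_def powr_diff)
    finally show "cmod (eval_fps (fps_deriv (fps_deriv f)) z) \<le> 2 * D * p * cmod (1 - z) powr (- (2 - \<alpha>))"
      by (simp add: \<sigma>_def)
    have "X / (1 + X)\<^sup>2 \<le> 1 / X"
      using X0 by (simp add: divide_simps power2_eq_square) (simp add: algebra_simps)
    then have "2 * D * (X / (1 + X)\<^sup>2) / \<sigma>\<^sup>2 \<le> 2 * D * (1 / X) / \<sigma>\<^sup>2"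
      using \<open>D \<ge> 0\<close> by (intro divide_right_mono mult_left_mono) auto
    also have "\<dots> = 2 * D / p * \<sigma> powr (- (2 + \<alpha>))"
      using \<sigma> by (simp only: X_def powr_minus powr_add) (simp add: divide_simps)
    finally show "cmod (eval_fps (fps_deriv (fps_deriv f)) z) \<le> 2 * D / p * cmod (1 - z) powr (- (2 + \<alpha>))"
      using b by (simp add: \<sigma>_def)
  qed (use \<open>D \<ge> 0\<close> in auto)
  also have "fps_nth f 0 = G 1"
    using f(2)[of 0] by (simp add: eval_fps_at_0 u_def)
  \<comment> \<open>The first coefficient is \<open>- of_real \<alpha> * G' 1\<close>, because z = 0
    corresponds to u = 1; the inequality \<open>p \<le> (1 + p)\<^sup>2\<close> then removes
    \<open>p\<close>.\<close>
  also have "cmod (fps_nth f 1) \<le> D"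
  proof -
    have "fps_nth f 1 = - of_real \<alpha> * G' 1"
      using e1[of 0] by (simp add: eval_fps_at_0 u_def u1_def)
    then have "cmod (fps_nth f 1) = \<alpha> * cmod (G' 1)" using \<alpha> by (simp add: norm_mult)
    also have "\<dots> \<le> 1 * (D * p / (1 + p)\<^sup>2)"
      using n1[of 0 1] \<alpha> by (intro mult_mono) auto
    also have "\<dots> \<le> D"
    proof -
      have "p \<le> (1 + p)\<^sup>2" using \<open>p > 0\<close> by (simp add: power2_eq_square algebra_simps)
      then have "D * p \<le> D * (1 + p)\<^sup>2" using \<open>D \<ge> 0\<close> by (intro mult_left_mono)
      then show ?thesis using \<open>p > 0\<close> by (simp add: divide_le_eq)
    qed
    finally show ?thesis .
  qed
  finally show ?thesis
    by (simp add: f_def algebra_simps mult_right_mono)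
qed

end

section \<open>Powers and resolvents of the fractional power\<close>

lemma norm_add_polar:
  "(cmod (of_real a * cis \<phi> + of_real b * cis \<psi>))\<^sup>2 = a\<^sup>2 + b\<^sup>2 + 2 * a * b * cos (\<phi> - \<psi>)"
proof -
  have "(cmod (of_real a * cis \<phi> + of_real b * cis \<psi>))\<^sup>2 =
      (a * cos \<phi> + b * cos \<psi>)\<^sup>2 + (a * sin \<phi> + b * sin \<psi>)\<^sup>2"
    by (simp add: cmod_power2)
  then show ?thesis
    unfolding cos_diff using sin_cos_squared_add[of \<phi>] sin_cos_squared_add[of \<psi>] by algebra
qed

text \<open>The last inequality is the polar equation of the disc with centre 1 and radius 1, over
  which 1 - z ranges: it is |z| < 1 expanded by the law of cosines and divided by |1 - z|.\<close>

lemma one_minus_powr_polar: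
  assumes "cmod z < 1"
  shows "(1 - z) powr of_real \<alpha> = of_real (cmod (1 - z) powr \<alpha>) * cis (\<alpha> * Arg (1 - z))"
    and "\<bar>Arg (1 - z)\<bar> < pi / 2" and "cmod (1 - z) < 2 * cos (Arg (1 - z))"
proof -
  have w: "1 - z \<noteq> 0" using assms by auto
  have Re: "Re (1 - z) > 0" using abs_Re_le_cmod[of z] assms by simp
  have "(1 - z) powr of_real \<alpha> = exp (of_real \<alpha> * Ln (1 - z))"
    using w by (simp add: powr_def)
  also have "of_real \<alpha> * Ln (1 - z) = of_real (\<alpha> * ln (cmod (1 - z))) + \<i> * of_real (\<alpha> * Arg (1 - z))"
    using w by (simp add: complex_eq_iff Arg_eq_Im_Ln)
  also have "exp \<dots> = of_real (cmod (1 - z) powr \<alpha>) * cis (\<alpha> * Arg (1 - z))"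
    using w by (simp add: exp_add cis_conv_exp powr_def flip: exp_of_real)
  finally show "(1 - z) powr of_real \<alpha> = of_real (cmod (1 - z) powr \<alpha>) * cis (\<alpha> * Arg (1 - z))" .
  show "\<bar>Arg (1 - z)\<bar> < pi / 2"
    using Re_Ln_pos_lt_imp[OF Re] w by (simp add: Arg_eq_Im_Ln)
  define \<sigma> \<theta> where "\<sigma> = cmod (1 - z)" and "\<theta> = Arg (1 - z)"
  have \<sigma>: "\<sigma> > 0" using w by (simp add: \<sigma>_def)
  have eq: "1 - z = of_real \<sigma> * cis \<theta>"
    using Arg_eq[of "1 - z"] w by (simp add: \<sigma>_def \<theta>_def cis_conv_exp)
  then have "z = of_real 1 * cis 0 + of_real (-\<sigma>) * cis \<theta>"
    by (simp add: algebra_simps)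
  then have "(cmod z)\<^sup>2 = 1 + \<sigma>\<^sup>2 - 2 * \<sigma> * cos \<theta>"
    using norm_add_polar[of 1 0 "-\<sigma>" \<theta>] by simp
  moreover have "(cmod z)\<^sup>2 < 1" using assms by (simp add: power_less_one_iff abs_square_less_1)
  ultimately have "\<sigma> * \<sigma> < \<sigma> * (2 * cos \<theta>)" by (simp add: power2_eq_square)
  then show "cmod (1 - z) < 2 * cos (Arg (1 - z))"
    using \<sigma> by (simp add: \<sigma>_def \<theta>_def)
qed

text \<open>The logarithm of the cosine is concave on this interval and vanishes at 0; concavity
  between 0 and \<theta> is the claim after exponentiation.\<close>

lemma cos_powr_le_cos_mult:
  assumes "\<bar>\<theta>\<bar> < pi / 2" "0 \<le> \<alpha>" "\<alpha> \<le> 1"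
  shows "cos \<theta> powr \<alpha> \<le> cos (\<alpha> * \<theta>)"
proof -
  let ?I = "{-(pi/2)<..<pi/2}"
  have cpos: "cos x > 0" if "x \<in> ?I" for x using that by (intro cos_gt_zero_pi) auto
  have "concave_on ?I (\<lambda>x. ln (cos x))"
  proof (rule f''_le0_imp_concave[where f' = "\<lambda>x. - (sin x / cos x)" and f'' = "\<lambda>x. - ((cos x)\<^sup>2 + (sin x)\<^sup>2) / (cos x)\<^sup>2"])
    fix x assume x: "x \<in> ?I"
    note c = cpos[OF x]
    show "((\<lambda>x. ln (cos x)) has_real_derivative - (sin x / cos x)) (at x)"
      using c by (auto intro!: derivative_eq_intros simp: divide_simps)
    show "((\<lambda>x. - (sin x / cos x)) has_real_derivative - ((cos x)\<^sup>2 + (sin x)\<^sup>2) / (cos x)\<^sup>2) (at x)"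
      using c by (auto intro!: derivative_eq_intros simp: divide_simps power2_eq_square)
    show "- ((cos x)\<^sup>2 + (sin x)\<^sup>2) / (cos x)\<^sup>2 \<le> 0" by simp
  qed (rule convex_real_interval)
  then have "(1 - \<alpha>) * ln (cos 0) + \<alpha> * ln (cos \<theta>) \<le> ln (cos ((1 - \<alpha>) *\<^sub>R 0 + \<alpha> *\<^sub>R \<theta>))"
    using assms by (intro concave_onD) auto
  then have "\<alpha> * ln (cos \<theta>) \<le> ln (cos (\<alpha> * \<theta>))" by simp
  then have "exp (\<alpha> * ln (cos \<theta>)) \<le> exp (ln (cos (\<alpha> * \<theta>)))" by simp
  moreover have "\<bar>\<alpha> * \<theta>\<bar> < pi / 2"
    using assms mult_right_mono[of \<alpha> 1 "\<bar>\<theta>\<bar>"] by (simp add: abs_mult)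
  then have "cos (\<alpha> * \<theta>) > 0" by (intro cpos) auto
  moreover have "cos \<theta> > 0" using assms by (intro cpos) auto
  ultimately show ?thesis by (simp add: powr_def)
qed

text \<open>For \<open>u = s * cis (\<alpha> * \<theta>)\<close> the law of cosines gives \<open>|1
  - u|\<^sup>2 = 1 - s * (2 * cos (\<alpha> * \<theta>) - s)\<close>. The polar equation of the disc
  and \<open>cos_powr_le_cos_mult\<close> give
  \<open>s \<le> 2 powr \<alpha> * cos (\<alpha> * \<theta>)\<close>; as
  \<open>2 powr \<alpha> < 2\<close>, the bracket is bounded below by a positive constant. The
  exponential form is chosen because it behaves well under n-th powers.\<close>

lemma norm_one_minus_one_minus_powr:
  assumes "0 < \<alpha>" "\<alpha> < 1"
  obtains \<kappa> where "\<kappa> > 0"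
    "\<And>z. cmod z < 1 \<Longrightarrow> cmod (1 - (1 - z) powr of_real \<alpha>) \<le> exp (- \<kappa> * cmod ((1 - z) powr of_real \<alpha>))"
proof -
  define \<kappa> where "\<kappa> = (2 - 2 powr \<alpha>) * cos (\<alpha> * pi / 2) / 2"
  have p2: "2 powr \<alpha> < (2::real)" using powr_less_mono[of \<alpha> 1 2] assms by simp
  have cp: "cos (\<alpha> * pi / 2) > 0"
  proof (rule cos_gt_zero_pi)
    have "0 < \<alpha> * pi" "\<alpha> * pi < 1 * pi"
      using assms by (simp, intro mult_strict_right_mono) auto
    then show "- (pi / 2) < \<alpha> * pi / 2" "\<alpha> * pi / 2 < pi / 2" by linarith+
  qed
  have "\<kappa> > 0" using p2 cp by (simp add: \<kappa>_def)
  moreover have "cmod (1 - (1 - z) powr of_real \<alpha>) \<le> exp (- \<kappa> * cmod ((1 - z) powr of_real \<alpha>))" if z: "cmod z < 1" for z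
  proof -
    define \<sigma> \<theta> where "\<sigma> = cmod (1 - z)" and "\<theta> = Arg (1 - z)"
    define s where "s = \<sigma> powr \<alpha>"
    note pol = one_minus_powr_polar[OF z, folded \<sigma>_def \<theta>_def]
    have \<sigma>: "\<sigma> > 0" using z by (auto simp: \<sigma>_def)
    have s: "s > 0" using \<sigma> by (simp add: s_def)
    have u: "(1 - z) powr of_real \<alpha> = of_real s * cis (\<alpha> * \<theta>)" using pol(1)[of \<alpha>] by (simp add: s_def)
    have "s \<le> (2 * cos \<theta>) powr \<alpha>"
      unfolding s_def using pol(3) \<sigma> assms by (intro powr_mono2) auto
    also have "\<dots> = 2 powr \<alpha> * cos \<theta> powr \<alpha>"
      using pol(3) \<sigma> by (intro powr_mult)
    also have "\<dots> \<le> 2 powr \<alpha> * cos (\<alpha> * \<theta>)"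
      using pol(2) assms by (intro mult_left_mono cos_powr_le_cos_mult) auto
    finally have "2 * cos (\<alpha> * \<theta>) - s \<ge> (2 - 2 powr \<alpha>) * cos (\<alpha> * \<theta>)" by (simp add: algebra_simps)
    moreover have "cos (\<alpha> * pi / 2) \<le> cos \<bar>\<alpha> * \<theta>\<bar>"
    proof (rule cos_monotone_0_pi_le)
      show "\<bar>\<alpha> * \<theta>\<bar> \<le> \<alpha> * pi / 2"
        using mult_left_mono[of "\<bar>\<theta>\<bar>" "pi / 2" \<alpha>] pol(2) assms by (simp add: abs_mult)
      show "\<alpha> * pi / 2 \<le> pi" using assms by (simp add: field_simps)
    qed simp
    then have "(2 - 2 powr \<alpha>) * cos (\<alpha> * \<theta>) \<ge> 2 * \<kappa>"
      using p2 by (simp add: \<kappa>_def mult_left_mono)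
    ultimately have k: "2 * cos (\<alpha> * \<theta>) - s \<ge> 2 * \<kappa>" by linarith
    have "(cmod (1 - (1 - z) powr of_real \<alpha>))\<^sup>2 = 1 + s\<^sup>2 - 2 * s * cos (\<alpha> * \<theta>)"
      using norm_add_polar[of 1 0 "-s" "\<alpha> * \<theta>"] by (simp add: u)
    also have "\<dots> = 1 - s * (2 * cos (\<alpha> * \<theta>) - s)" by (simp add: power2_eq_square algebra_simps)
    also have "\<dots> \<le> 1 - s * (2 * \<kappa>)" using k s by (simp add: mult_left_mono)
    also have "\<dots> \<le> exp (- (s * (2 * \<kappa>)))" using exp_ge_add_one_self[of "- (s * (2 * \<kappa>))"] by simp
    also have "\<dots> = (exp (- \<kappa> * s))\<^sup>2" by (simp add: power2_eq_square flip: exp_add)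
    finally have "cmod (1 - (1 - z) powr of_real \<alpha>) \<le> exp (- \<kappa> * s)"
      by (rule power2_le_imp_le) simp
    then show ?thesis using s by (simp add: u norm_mult)
  qed
  ultimately show thesis by (rule that)
qed

lemma norm_one_minus_powr_le_2:
  assumes "cmod z < 1" "0 \<le> \<alpha>" "\<alpha> \<le> 1"
  shows "cmod ((1 - z) powr of_real \<alpha>) \<le> 2"
proof -
  have "cmod ((1 - z) powr of_real \<alpha>) = cmod (1 - z) powr \<alpha>"
    by (simp add: norm_powr_real_powr')
  also have "\<dots> \<le> 2 powr \<alpha>"
    using assms norm_triangle_ineq4[of 1 z] by (intro powr_mono2) auto
  also have "\<dots> \<le> 2 powr 1" using assms by (intro powr_mono) auto
  finally show ?thesis by simp
qed

text \<open>The arguments of the two summands differ by at most pi - \<epsilon>, so they cannot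
  cancel. The constant is that of the worst case, two vectors of equal length at the angle pi -
  \<epsilon>.\<close>

lemma norm_sector_add_ge:
  assumes \<alpha>: "0 < \<alpha>" "\<alpha> < 1" and \<epsilon>: "0 < \<epsilon>" "\<epsilon> < pi - \<alpha> * pi / 2"
    and l: "l \<in> open_sector (pi - \<alpha> * pi / 2 - \<epsilon>)" and z: "cmod z < 1"
  shows "sin (\<epsilon> / 2) * (cmod l + cmod ((1 - z) powr of_real \<alpha>)) \<le> cmod (l + (1 - z) powr of_real \<alpha>)"
proof -
  define b \<psi> where "b = cmod (1 - z) powr \<alpha>" and "\<psi> = \<alpha> * Arg (1 - z)"
  define a \<phi> where "a = cmod l" and "\<phi> = Arg l"
  note pol = one_minus_powr_polar[OF z]
  have u: "(1 - z) powr of_real \<alpha> = of_real b * cis \<psi>" using pol(1)[of \<alpha>] by (simp add: b_def \<psi>_def)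
  have l': "l = of_real a * cis \<phi>"
    using Arg_eq[of l] l by (simp add: a_def \<phi>_def cis_conv_exp open_sector_def)
  have ab: "a \<ge> 0" "b \<ge> 0" by (auto simp: a_def b_def)
  have "\<bar>\<psi>\<bar> \<le> \<alpha> * pi / 2"
    using mult_left_mono[of "\<bar>Arg (1 - z)\<bar>" "pi / 2" \<alpha>] pol(2) \<alpha> by (simp add: \<psi>_def abs_mult)
  moreover have "\<bar>\<phi>\<bar> < pi - \<alpha> * pi / 2 - \<epsilon>" using l by (simp add: open_sector_def \<phi>_def)
  ultimately have "\<bar>\<phi> - \<psi>\<bar> \<le> pi - \<epsilon>" by linarith
  then have "cos (pi - \<epsilon>) \<le> cos \<bar>\<phi> - \<psi>\<bar>"
    using \<epsilon> by (intro cos_monotone_0_pi_le) auto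
  then have c: "cos (\<phi> - \<psi>) \<ge> - cos \<epsilon>" by simp
  have "2 * (sin (\<epsilon> / 2))\<^sup>2 = 1 - cos \<epsilon>"
    using cos_double_sin[of "\<epsilon> / 2"] by simp
  then have s: "(sin (\<epsilon> / 2))\<^sup>2 = (1 - cos \<epsilon>) / 2" by simp
  have "(sin (\<epsilon> / 2) * (a + b))\<^sup>2 = (1 - cos \<epsilon>) / 2 * (a + b)\<^sup>2"
    by (simp add: power_mult_distrib s)
  also have "\<dots> = a\<^sup>2 + b\<^sup>2 - 2 * a * b * cos \<epsilon> - (1 + cos \<epsilon>) / 2 * (a - b)\<^sup>2"
    by (simp add: power2_eq_square field_simps)
  also have "\<dots> \<le> a\<^sup>2 + b\<^sup>2 - 2 * a * b * cos \<epsilon>"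
  proof -
    have "0 \<le> (1 + cos \<epsilon>) / 2 * (a - b)\<^sup>2"
      using cos_ge_minus_one[of \<epsilon>] by (intro mult_nonneg_nonneg divide_nonneg_pos) (linarith, auto)
    then show ?thesis by linarith
  qed
  also have "\<dots> \<le> a\<^sup>2 + b\<^sup>2 + 2 * a * b * cos (\<phi> - \<psi>)"
    using mult_left_mono[OF c, of "2 * a * b"] ab by simp
  also have "\<dots> = (cmod (l + (1 - z) powr of_real \<alpha>))\<^sup>2"
    by (simp only: u l' norm_add_polar)
  finally have "sin (\<epsilon> / 2) * (a + b) \<le> cmod (l + (1 - z) powr of_real \<alpha>)"
    by (rule power2_le_imp_le) simp
  then show ?thesis using ab by (simp add: u norm_mult a_def)
qed

lemma fps_conv_radius_mult_ge_1:
  fixes f g :: "complex fps"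
  assumes "fps_conv_radius f \<ge> 1" "fps_conv_radius g \<ge> 1"
  shows "fps_conv_radius (f * g) \<ge> 1"
  using assms by (intro order_trans[OF _ fps_conv_radius_mult]) simp

text \<open>Exponent 4 leaves room for the decay of order 3 that \<open>fc_pfps_bound\<close>
  demands of \<open>G''\<close>, after one factor 1 + y has been spent on the extra u in n u (1 -
  u)^n. The proof is the fourth power of a linear lower bound for
  \<open>exp (\<kappa> / 4 * y)\<close>.\<close>

lemma exp_minus_le_inverse_power4:
  fixes \<kappa> :: real
  assumes "\<kappa> > 0"
  obtains Q where "Q > 0" "\<And>y. y \<ge> 0 \<Longrightarrow> exp (- \<kappa> * y) \<le> Q / (1 + y) ^ 4"
proof -
  define m where "m = min 1 (\<kappa> / 4)"
  have m: "m > 0" "m \<le> 1" "m \<le> \<kappa> / 4" using assms by (auto simp: m_def)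
  have "exp (- \<kappa> * y) \<le> (1 / m ^ 4) / (1 + y) ^ 4" if "y \<ge> 0" for y
  proof -
    have "m * (1 + y) \<le> 1 + \<kappa> / 4 * y"
      using mult_right_mono[OF m(3) that] m(2) by (simp add: distrib_left)
    also have "\<dots> \<le> exp (\<kappa> / 4 * y)" by (rule exp_ge_add_one_self)
    finally have "(m * (1 + y)) ^ 4 \<le> exp (\<kappa> / 4 * y) ^ 4"
      using m that by (intro power_mono) auto
    also have "\<dots> = exp (\<kappa> * y)" by (simp flip: exp_of_nat_mult)
    finally have "(m * (1 + y)) ^ 4 \<le> exp (\<kappa> * y)" .
    then have "inverse (exp (\<kappa> * y)) \<le> inverse ((m * (1 + y)) ^ 4)"
      using m that by (intro le_imp_inverse_le) auto
    then show ?thesis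
      by (simp add: exp_minus power_mult_distrib divide_inverse)
  qed
  moreover have "1 / m ^ 4 > 0" using m by simp
  ultimately show thesis by (rule that[rotated])
qed

lemma has_field_derivative_one_minus_power:
  "((\<lambda>u::complex. (1 - u) ^ m) has_field_derivative - (of_nat m * (1 - u) ^ (m - 1))) (at u)"
  by (rule derivative_eq_intros refl | simp)+

section \<open>Uniform bounds for powers and resolvents of the fractional power at r t\<close>

context kreiss
begin

text \<open>A power series is determined by its values near 0. This turns
  \<open>pfps \<alpha> G\<close> into an algebraic expression in \<open>ufps \<alpha>\<close>, to
  which the multiplicativity of \<open>fc\<close> applies.\<close>

lemma pfps_eqI:
  assumes "fps_conv_radius f \<ge> 1" "\<And>z. cmod z < 1 \<Longrightarrow> eval_fps f z = G ((1 - z) powr of_real \<alpha>)"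
    and "\<And>z. cmod z < 1 \<Longrightarrow> (G has_field_derivative G' z) (at ((1 - z) powr of_real \<alpha>))"
  shows "pfps \<alpha> G = f"
proof (rule eval_fps_eqD)
  have one: "(0::ereal) < 1" by simp
  show "fps_conv_radius (pfps \<alpha> G) > 0" "fps_conv_radius f > 0"
    using pfps_radius[of G G' \<alpha>] assms one by (auto intro: less_le_trans[OF one])
  have "eventually (\<lambda>z::complex. z \<in> ball 0 1) (nhds 0)"
    by (intro eventually_nhds_in_open) auto
  then show "eventually (\<lambda>z. eval_fps (pfps \<alpha> G) z = eval_fps f z) (nhds 0)"
    by eventually_elim (use assms in \<open>simp add: eval_pfps[of G G' \<alpha>]\<close>)
qed

abbreviation ufps :: "real \<Rightarrow> complex fps" where
  "ufps \<alpha> \<equiv> pfps \<alpha> (\<lambda>u. u)"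

lemma ufps:
  shows ufps_radius: "fps_conv_radius (ufps \<alpha>) \<ge> 1"
    and eval_ufps: "cmod z < 1 \<Longrightarrow> eval_fps (ufps \<alpha>) z = (1 - z) powr of_real \<alpha>"
  using pfps[of "\<lambda>u. u" "\<lambda>_. 1" \<alpha>] by auto

lemma fc_power:
  assumes "fps_conv_radius f \<ge> 1" "0 \<le> r" "r < 1"
  shows "fc (f ^ n) r = fc f r ^ n"
proof (induction n)
  case 0
  show ?case using fc_const[of 1 r] by (simp add: scaleC_one)
next
  case (Suc n)
  have "fps_conv_radius (f ^ n) \<ge> 1"
    using assms(1) fps_conv_radius_power[of f n] by (rule order_trans)
  then show ?case using Suc assms by (simp add: fc_mult)
qed

lemma one_minus_ufps:
  shows one_minus_ufps_radius: "fps_conv_radius (1 - ufps \<alpha>) \<ge> 1"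
    and eval_one_minus_ufps: "cmod z < 1 \<Longrightarrow> eval_fps (1 - ufps \<alpha>) z = 1 - (1 - z) powr of_real \<alpha>"
    and fc_one_minus_ufps: "0 \<le> r \<Longrightarrow> r < 1 \<Longrightarrow> fc (1 - ufps \<alpha>) r = 1 - fc (ufps \<alpha>) r"
proof -
  have "1 \<le> min (fps_conv_radius 1) (fps_conv_radius (ufps \<alpha>))"
    using ufps_radius by simp
  then show "fps_conv_radius (1 - ufps \<alpha>) \<ge> 1"
    by (rule order_trans[OF _ fps_conv_radius_diff])
  show "eval_fps (1 - ufps \<alpha>) z = 1 - (1 - z) powr of_real \<alpha>" if "cmod z < 1"
  proof -
    have "ereal (cmod z) < fps_conv_radius (ufps \<alpha>)"
      using that by (intro less_le_trans[OF _ ufps_radius]) (simp add: one_ereal_def)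
    then show ?thesis using that by (subst eval_fps_diff) (auto simp: eval_ufps)
  qed
  show "fc (1 - ufps \<alpha>) r = 1 - fc (ufps \<alpha>) r" if "0 \<le> r" "r < 1"
    using that fc_diff[of 1 "ufps \<alpha>" r] ufps_radius fc_const[of 1 r] by (simp add: scaleC_one)
qed

lemma norm_less_radius: "fps_conv_radius f \<ge> 1 \<Longrightarrow> cmod z < 1 \<Longrightarrow> ereal (cmod z) < fps_conv_radius f"
  by (rule less_le_trans) (auto simp: one_ereal_def)

lemma pfps_one_minus_power: "pfps \<alpha> (\<lambda>u. (1 - u) ^ n) = (1 - ufps \<alpha>) ^ n"
proof (rule pfps_eqI)
  show "fps_conv_radius ((1 - ufps \<alpha>) ^ n) \<ge> 1"
    using one_minus_ufps_radius fps_conv_radius_power by (rule order_trans)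
  show "eval_fps ((1 - ufps \<alpha>) ^ n) z = (1 - (1 - z) powr of_real \<alpha>) ^ n" if "cmod z < 1" for z
    using that norm_less_radius[OF one_minus_ufps_radius that]
    by (subst eval_fps_power) (simp_all add: eval_one_minus_ufps)
qed (auto intro!: derivative_eq_intros)

lemma pfps_mult_one_minus_power:
  "pfps \<alpha> (\<lambda>u. of_nat n * u * (1 - u) ^ n) = fps_const (of_nat n) * ufps \<alpha> * (1 - ufps \<alpha>) ^ n"
proof (rule pfps_eqI)
  have r1: "fps_conv_radius ((1 - ufps \<alpha>) ^ n) \<ge> 1"
    using one_minus_ufps_radius fps_conv_radius_power by (rule order_trans)
  have r2: "fps_conv_radius (fps_const (of_nat n) * ufps \<alpha>) \<ge> 1"
    by (intro fps_conv_radius_mult_ge_1 ufps_radius) simp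
  show "fps_conv_radius (fps_const (of_nat n) * ufps \<alpha> * (1 - ufps \<alpha>) ^ n) \<ge> 1"
    by (intro fps_conv_radius_mult_ge_1 r1 r2)
  show "eval_fps (fps_const (of_nat n) * ufps \<alpha> * (1 - ufps \<alpha>) ^ n) z
      = of_nat n * ((1 - z) powr of_real \<alpha>) * (1 - (1 - z) powr of_real \<alpha>) ^ n" if "cmod z < 1" for z
    using that norm_less_radius[OF r1 that] norm_less_radius[OF r2 that]
      norm_less_radius[OF ufps_radius that] norm_less_radius[OF one_minus_ufps_radius that]
    by (simp add: eval_fps_mult eval_fps_power eval_ufps eval_one_minus_ufps)
qed (rule derivative_eq_intros refl | simp)+

text \<open>Exponential decay in n |u| makes (1 - u)^n and n u (1 - u)^n behave like functions of n
  u, so \<open>fc_pfps_bound\<close> applies with p = n and a constant independent of n. The case n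
  = 0 is split off because p must be positive; it accounts for \<open>norm 1\<close> in
  \<open>M\<close>.\<close>

lemma fc_one_minus_power_bounds:
  assumes \<alpha>: "0 < \<alpha>" "\<alpha> < 1"
  obtains M where
    "\<And>n r. 0 \<le> r \<Longrightarrow> r < 1 \<Longrightarrow> norm ((1 - fc (ufps \<alpha>) r) ^ n) \<le> M"
    "\<And>n r. 0 \<le> r \<Longrightarrow> r < 1 \<Longrightarrow> real n * norm (fc (ufps \<alpha>) r * (1 - fc (ufps \<alpha>) r) ^ n) \<le> M"
proof -
  obtain \<kappa> where \<kappa>: "\<kappa> > 0" and dec: "\<And>z. cmod z < 1 \<Longrightarrow>
      cmod (1 - (1 - z) powr of_real \<alpha>) \<le> exp (- \<kappa> * cmod ((1 - z) powr of_real \<alpha>))"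
    using norm_one_minus_one_minus_powr[OF \<alpha>] by metis
  obtain Q0 where Q0: "Q0 > 0" "\<And>y. y \<ge> 0 \<Longrightarrow> exp (- \<kappa> * y) \<le> Q0 / (1 + y) ^ 4"
    using exp_minus_le_inverse_power4[OF \<kappa>] by metis
  define Q where "Q = exp (4 * \<kappa>) * Q0"
  have Q: "Q > 0" using Q0 by (simp add: Q_def)
  \<comment> \<open>Differentiation lowers the exponent by up to 2. The j missing factors cost
    \<open>exp (real j * \<kappa> * cmod u)\<close>, at most \<open>exp (4 * \<kappa>)\<close>
    because \<open>cmod u \<le> 2\<close>; this is the origin of \<open>Q\<close>.\<close>
  have pw: "cmod (1 - u) ^ (n - j) \<le> Q / (1 + real n * cmod u) ^ 4"
    if "cmod z < 1" "u = (1 - z) powr of_real \<alpha>" "j \<le> n" "j \<le> 2" for z u and n j :: nat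
  proof -
    have "cmod (1 - u) ^ (n - j) \<le> exp (- \<kappa> * cmod u) ^ (n - j)"
      using dec[OF that(1)] that(2) by (intro power_mono) auto
    also have "\<dots> = exp (real (n - j) * (- \<kappa> * cmod u))"
      by (rule exp_of_nat_mult[symmetric])
    also have "\<dots> = exp (real j * \<kappa> * cmod u) * exp (- \<kappa> * (real n * cmod u))"
      unfolding exp_add[symmetric] using that(3) by (simp add: of_nat_diff algebra_simps)
    also have "\<dots> \<le> exp (4 * \<kappa>) * (Q0 / (1 + real n * cmod u) ^ 4)"
    proof (rule mult_mono)
      have "real j * cmod u \<le> 2 * 2"
        using that(4) norm_one_minus_powr_le_2[OF that(1), of \<alpha>] \<alpha> unfolding that(2) by (intro mult_mono) auto
      then have "\<kappa> * (real j * cmod u) \<le> \<kappa> * (2 * 2)" using \<kappa> by (intro mult_left_mono) auto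
      then show "exp (real j * \<kappa> * cmod u) \<le> exp (4 * \<kappa>)" by (simp add: mult_ac)
    qed (use Q0(2)[of "real n * cmod u"] in auto)
    finally show ?thesis by (simp add: Q_def)
  qed
  have den: "Q / (1 + y) ^ 4 \<le> Q / (1 + y) ^ 3" "Q / (1 + y) ^ 3 \<le> Q / (1 + y)\<^sup>2"
    "Q / (1 + y) ^ 4 + y * (Q / (1 + y) ^ 4) = Q / (1 + y) ^ 3" if "y \<ge> 0" for y :: real
  proof -
    show "Q / (1 + y) ^ 4 \<le> Q / (1 + y) ^ 3" "Q / (1 + y) ^ 3 \<le> Q / (1 + y)\<^sup>2"
      using that Q by (intro divide_left_mono power_increasing mult_pos_pos zero_less_power; simp)+
    have "Q / (1 + y) ^ 4 + y * (Q / (1 + y) ^ 4) = (1 + y) * (Q / ((1 + y) * (1 + y) ^ 3))"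
      by (simp add: algebra_simps power4_eq_xxxx power3_eq_cube add_divide_distrib)
    also have "\<dots> = Q / (1 + y) ^ 3" using that by simp
    finally show "Q / (1 + y) ^ 4 + y * (Q / (1 + y) ^ 4) = Q / (1 + y) ^ 3" .
  qed
  define M where "M = norm (1::'a) + (norm t + 8000 * K / (\<alpha> * (1 - \<alpha>)) * norm (t\<^sup>2)) * (2 * Q)"
  have M0: "M \<ge> 0" "norm (1::'a) \<le> M"
    using \<alpha> K_ge Q by (auto simp: M_def)
  show thesis
  proof (rule that[of M])
    fix n :: nat and r :: real assume r: "0 \<le> r" "r < 1"
    show "norm ((1 - fc (ufps \<alpha>) r) ^ n) \<le> M"
    proof (cases "n = 0")
      case True
      then show ?thesis using M0 by simp
    next
      case False
      have "norm (fc (pfps \<alpha> (\<lambda>u. (1 - u) ^ n)) r) \<le> cmod ((1 - 1) ^ n) * K +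
          (norm t + 8000 * K / (\<alpha> * (1 - \<alpha>)) * norm (t\<^sup>2)) * (2 * Q)"
      proof (rule fc_pfps_bound[OF \<alpha>, where p = "real n" and G' = "\<lambda>u. - (of_nat n * (1 - u) ^ (n - 1))"
          and G'' = "\<lambda>u. of_nat n * (of_nat (n - 1) * (1 - u) ^ (n - 2))", OF _ _ _ _ _ _ r])
        fix z u :: complex assume z: "cmod z < 1" and u: "u = (1 - z) powr of_real \<alpha>"
        define y where "y = real n * cmod u"
        have y: "y \<ge> 0" by (simp add: y_def)
        have "cmod (- (of_nat n * (1 - u) ^ (n - 1))) \<le> real n * (Q / (1 + y) ^ 4)"
          using mult_left_mono[OF pw[OF z u, of 1 n], of "real n"] False by (simp add: norm_mult norm_power y_def)
        also have "\<dots> \<le> real n * (2 * (Q / (1 + y)\<^sup>2))"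
        proof (rule mult_left_mono)
          show "Q / (1 + y) ^ 4 \<le> 2 * (Q / (1 + y)\<^sup>2)"
            using den(1,2)[OF y] Q by (smt (verit) divide_nonneg_nonneg zero_le_power2)
        qed simp
        finally show "cmod (- (of_nat n * (1 - u) ^ (n - 1))) \<le> 2 * Q * real n / (1 + real n * cmod u)\<^sup>2"
          by (simp add: y_def mult_ac)
        have "cmod (of_nat n * (of_nat (n - 1) * (1 - u) ^ (n - 2))) \<le> real n * (real n * (Q / (1 + y) ^ 4))"
        \<comment> \<open>For n = 1 the truncated difference \<open>n - 2\<close> is 0 and
          \<open>pw\<close> with j = 2 does not apply, but then the factor \<open>n - 1\<close>
          vanishes.\<close>
        proof (cases "n = 1")
          case True
          then show ?thesis using Q y by simp
        next
          case n1: False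
          have "real (n - 1) * cmod (1 - u) ^ (n - 2) \<le> real n * (Q / (1 + y) ^ 4)"
            using pw[OF z u, of 2 n] False n1 unfolding y_def by (intro mult_mono) auto
          from mult_left_mono[OF this, of "real n"] show ?thesis
            by (simp add: norm_mult norm_power del: of_nat_diff)
        qed
        also have "\<dots> \<le> real n * (real n * (2 * (Q / (1 + y) ^ 3)))"
        proof (intro mult_left_mono)
          have "Q / (1 + y) ^ 3 \<ge> 0" using Q y by simp
          then show "Q / (1 + y) ^ 4 \<le> 2 * (Q / (1 + y) ^ 3)" using den(1)[OF y] by linarith
        qed auto
        finally show "cmod (of_nat n * (of_nat (n - 1) * (1 - u) ^ (n - 2))) \<le> 2 * Q * (real n)\<^sup>2 / (1 + real n * cmod u) ^ 3"
          by (simp add: y_def power2_eq_square mult_ac)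
      next
        fix z :: complex assume "cmod z < 1"
        show "((\<lambda>u. (1 - u) ^ n) has_field_derivative - (of_nat n * (1 - (1 - z) powr of_real \<alpha>) ^ (n - 1)))
            (at ((1 - z) powr of_real \<alpha>))"
          by (rule has_field_derivative_one_minus_power)
        have "((\<lambda>u. - (of_nat n * (1 - u) ^ (n - 1))) has_field_derivative
            - (of_nat n * - (of_nat (n - 1) * (1 - (1 - z) powr of_real \<alpha>) ^ (n - 1 - 1)))) (at ((1 - z) powr of_real \<alpha>))"
          by (intro DERIV_minus DERIV_cmult has_field_derivative_one_minus_power)
        moreover have "n - 1 - 1 = n - 2" by simp
        ultimately show "((\<lambda>u. - (of_nat n * (1 - u) ^ (n - 1))) has_field_derivative
            of_nat n * (of_nat (n - 1) * (1 - (1 - z) powr of_real \<alpha>) ^ (n - 2))) (at ((1 - z) powr of_real \<alpha>))"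
          by (simp only: mult_minus_right minus_minus)
      qed (use False Q in auto)
      also have "\<dots> \<le> M" using False by (simp add: M_def power_0_left)
      finally show ?thesis
        using r by (simp add: pfps_one_minus_power fc_power one_minus_ufps_radius fc_one_minus_ufps)
    qed
    show "real n * norm (fc (ufps \<alpha>) r * (1 - fc (ufps \<alpha>) r) ^ n) \<le> M"
    proof (cases "n = 0")
      case True
      then show ?thesis using M0 by simp
    next
      case False
      have "norm (fc (pfps \<alpha> (\<lambda>u. of_nat n * u * (1 - u) ^ n)) r) \<le> cmod (of_nat n * 1 * (1 - 1) ^ n) * K +
          (norm t + 8000 * K / (\<alpha> * (1 - \<alpha>)) * norm (t\<^sup>2)) * (2 * Q)"
      proof (rule fc_pfps_bound[OF \<alpha>, where p = "real n"
          and G' = "\<lambda>u. of_nat n * (1 - u) ^ n - of_nat n * u * (of_nat n * (1 - u) ^ (n - 1))"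
          and G'' = "\<lambda>u. of_nat n * u * (of_nat n * (of_nat (n - 1) * (1 - u) ^ (n - 2)))
             - 2 * (of_nat n * (of_nat n * (1 - u) ^ (n - 1)))", OF _ _ _ _ _ _ r])
        fix z u :: complex assume z: "cmod z < 1" and u: "u = (1 - z) powr of_real \<alpha>"
        define y where "y = real n * cmod u"
        have y: "y \<ge> 0" by (simp add: y_def)
        have q: "Q / (1 + y) ^ 3 \<ge> 0" "Q / (1 + y) ^ 4 \<ge> 0" using Q y by auto
        have p0: "cmod (1 - u) ^ n \<le> Q / (1 + y) ^ 4" using pw[OF z u, of 0 n] by (simp add: y_def)
        have p1: "cmod (1 - u) ^ (n - 1) \<le> Q / (1 + y) ^ 4" using pw[OF z u, of 1 n] False by (simp add: y_def)
        have "cmod (of_nat n * (1 - u) ^ n - of_nat n * u * (of_nat n * (1 - u) ^ (n - 1)))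
            \<le> cmod (of_nat n * (1 - u) ^ n) + cmod (of_nat n * u * (of_nat n * (1 - u) ^ (n - 1)))"
          by (rule norm_triangle_ineq4)
        also have "\<dots> = real n * (cmod (1 - u) ^ n + y * cmod (1 - u) ^ (n - 1))"
          by (simp add: norm_mult norm_power y_def algebra_simps)
        also have "\<dots> \<le> real n * (Q / (1 + y) ^ 4 + y * (Q / (1 + y) ^ 4))"
          using p0 p1 y by (intro mult_left_mono add_mono) auto
        also have "\<dots> = real n * (Q / (1 + y) ^ 3)" by (simp only: den(3)[OF y])
        also have "\<dots> \<le> real n * (2 * (Q / (1 + y)\<^sup>2))"
          using den(2)[OF y] q(1) by (intro mult_left_mono) linarith+
        finally show "cmod (of_nat n * (1 - u) ^ n - of_nat n * u * (of_nat n * (1 - u) ^ (n - 1)))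
            \<le> 2 * Q * real n / (1 + real n * cmod u)\<^sup>2"
          by (simp add: y_def mult_ac)
        have p2: "real (n - 1) * cmod (1 - u) ^ (n - 2) \<le> real n * (Q / (1 + y) ^ 4)"
        proof (cases "n = 1")
          case True
          then show ?thesis using q by simp
        next
          case n1: False
          then show ?thesis
            using pw[OF z u, of 2 n] False unfolding y_def by (intro mult_mono) auto
        qed
        have "cmod (of_nat n * u * (of_nat n * (of_nat (n - 1) * (1 - u) ^ (n - 2))) - 2 * (of_nat n * (of_nat n * (1 - u) ^ (n - 1))))
            \<le> cmod (of_nat n * u * (of_nat n * (of_nat (n - 1) * (1 - u) ^ (n - 2)))) + cmod (2 * (of_nat n * (of_nat n * (1 - u) ^ (n - 1))))"
          by (rule norm_triangle_ineq4)
        also have "\<dots> = real n * (y * (real (n - 1) * cmod (1 - u) ^ (n - 2)) + 2 * (real n * cmod (1 - u) ^ (n - 1)))"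
          by (simp add: norm_mult norm_power y_def algebra_simps del: of_nat_diff)
        also have "\<dots> \<le> real n * (y * (real n * (Q / (1 + y) ^ 4)) + 2 * (real n * (Q / (1 + y) ^ 4)))"
          using p1 p2 y by (intro mult_left_mono add_mono) auto
        also have "\<dots> = (real n)\<^sup>2 * ((Q / (1 + y) ^ 4 + y * (Q / (1 + y) ^ 4)) + Q / (1 + y) ^ 4)"
          by (simp only: power2_eq_square) (simp add: algebra_simps)
        also have "\<dots> \<le> (real n)\<^sup>2 * (2 * (Q / (1 + y) ^ 3))"
          unfolding den(3)[OF y] using den(1)[OF y] by (intro mult_left_mono) (linarith, simp)
        finally show "cmod (of_nat n * u * (of_nat n * (of_nat (n - 1) * (1 - u) ^ (n - 2)))
             - 2 * (of_nat n * (of_nat n * (1 - u) ^ (n - 1)))) \<le> 2 * Q * (real n)\<^sup>2 / (1 + real n * cmod u) ^ 3"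
          by (simp add: y_def mult_ac)
      next
        fix z :: complex assume "cmod z < 1"
        let ?u = "(1 - z) powr of_real \<alpha>"
        have "((\<lambda>u. of_nat n * u * (1 - u) ^ n) has_field_derivative
           (of_nat n * 1 * (1 - ?u) ^ n + - (of_nat n * (1 - ?u) ^ (n - 1)) * (of_nat n * ?u))) (at ?u)"
          by (intro DERIV_mult DERIV_cmult DERIV_ident has_field_derivative_one_minus_power)
        then show "((\<lambda>u. of_nat n * u * (1 - u) ^ n) has_field_derivative
           of_nat n * (1 - ?u) ^ n - of_nat n * ?u * (of_nat n * (1 - ?u) ^ (n - 1))) (at ?u)"
          by (simp add: mult_ac)
        have "((\<lambda>u. of_nat n * (1 - u) ^ n - of_nat n * u * (of_nat n * (1 - u) ^ (n - 1))) has_field_derivative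
           (of_nat n * - (of_nat n * (1 - ?u) ^ (n - 1)) -
            (of_nat n * 1 * (of_nat n * (1 - ?u) ^ (n - 1)) +
             of_nat n * - (of_nat (n - 1) * (1 - ?u) ^ (n - 1 - 1)) * (of_nat n * ?u)))) (at ?u)"
          by (intro DERIV_diff DERIV_mult DERIV_cmult DERIV_ident has_field_derivative_one_minus_power)
        moreover have "n - 1 - 1 = n - 2" by simp
        ultimately show "((\<lambda>u. of_nat n * (1 - u) ^ n - of_nat n * u * (of_nat n * (1 - u) ^ (n - 1))) has_field_derivative
           of_nat n * ?u * (of_nat n * (of_nat (n - 1) * (1 - ?u) ^ (n - 2)))
             - 2 * (of_nat n * (of_nat n * (1 - ?u) ^ (n - 1)))) (at ?u)"
          by (simp add: mult_ac del: of_nat_diff)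
      qed (use False Q in auto)
      also have "\<dots> \<le> M" using False by (simp add: M_def power_0_left)
      finally have "norm (fc (fps_const (of_nat n) * ufps \<alpha> * (1 - ufps \<alpha>) ^ n) r) \<le> M"
        by (simp only: pfps_mult_one_minus_power)
      moreover have "fc (fps_const (of_nat n) * ufps \<alpha> * (1 - ufps \<alpha>) ^ n) r
          = of_nat n *\<^sub>C (fc (ufps \<alpha>) r * (1 - fc (ufps \<alpha>) r) ^ n)"
      proof -
        have r1: "fps_conv_radius ((1 - ufps \<alpha>) ^ n) \<ge> 1"
          using one_minus_ufps_radius fps_conv_radius_power by (rule order_trans)
        have r2: "fps_conv_radius (fps_const (of_nat n) * ufps \<alpha>) \<ge> 1"
          by (intro fps_conv_radius_mult_ge_1 ufps_radius) simp
        show ?thesis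
          using r by (simp add: fc_mult[OF r2 r1] fc_mult ufps_radius fc_const fc_power one_minus_ufps_radius
              fc_one_minus_ufps scaleC_simps)
      qed
      ultimately show ?thesis by (simp add: norm_scaleC)
    qed
  qed
qed

text \<open>The function l / (l + u) depends on u / l only, so the scale is p = 1 / |l| and
  \<open>D\<close> is independent of \<open>l\<close>. The denominator is controlled by
  \<open>norm_sector_add_ge\<close>; \<open>D = 2 / \<kappa> ^ 3\<close> comes from the second
  derivative 2 l / (l + u)^3 and covers the first because \<kappa> is at most 1.\<close>

lemma fc_resolvent_bound:
  assumes \<alpha>: "0 < \<alpha>" "\<alpha> < 1" and \<epsilon>: "0 < \<epsilon>" "\<epsilon> < pi - \<alpha> * pi / 2"
  obtains M where "\<And>l r. l \<in> open_sector (pi - \<alpha> * pi / 2 - \<epsilon>) \<Longrightarrow> 0 \<le> r \<Longrightarrow> r < 1 \<Longrightarrow>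
    \<exists>R. R * (l *\<^sub>C 1 + fc (ufps \<alpha>) r) = 1 \<and> (l *\<^sub>C 1 + fc (ufps \<alpha>) r) * R = 1 \<and> cmod l * norm R \<le> M"
proof -
  define \<kappa> where "\<kappa> = sin (\<epsilon> / 2)"
  have "\<alpha> * pi > 0" using \<alpha> by simp
  then have "\<epsilon> / 2 < pi" using \<epsilon> by linarith
  then have \<kappa>: "\<kappa> > 0" "\<kappa> \<le> 1" using \<epsilon> by (auto simp: \<kappa>_def intro!: sin_gt_zero)
  define D where "D = 2 / \<kappa> ^ 3"
  define M where "M = K / \<kappa> + (norm t + 8000 * K / (\<alpha> * (1 - \<alpha>)) * norm (t\<^sup>2)) * D"
  show thesis
  proof (rule that[of M])
    fix l :: complex and r :: real
    assume l: "l \<in> open_sector (pi - \<alpha> * pi / 2 - \<epsilon>)" and r: "0 \<le> r" "r < 1"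
    have l0: "l \<noteq> 0" using l by (simp add: open_sector_def)
    define p where "p = 1 / cmod l"
    have p: "p > 0" using l0 by (simp add: p_def)
    have lower: "\<kappa> * (cmod l * (1 + p * cmod u)) \<le> cmod (l + u)" if "cmod z < 1" "u = (1 - z) powr of_real \<alpha>" for z u
    proof -
      have "cmod l * (1 + p * cmod u) = cmod l + cmod u" using l0 by (simp add: p_def distrib_left)
      then show ?thesis
        using norm_sector_add_ge[OF \<alpha> \<epsilon> l that(1)] by (simp only: that(2) \<kappa>_def)
    qed
    have pos: "0 < \<kappa> * (cmod l * (1 + p * cmod u))" for u
      using \<kappa> l0 p by (intro mult_pos_pos add_pos_nonneg) auto
    have ne: "l + u \<noteq> 0" if "cmod z < 1" "u = (1 - z) powr of_real \<alpha>" for z u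
      using lower[OF that] pos[of u] by (metis norm_zero not_less)
    let ?G = "\<lambda>u. l / (l + u)"
    have dG: "(?G has_field_derivative - l / (l + u)\<^sup>2) (at u)"
      and dG1: "((\<lambda>u. - l / (l + u)\<^sup>2) has_field_derivative 2 * l / (l + u) ^ 3) (at u)"
      if "l + u \<noteq> 0" for u
    proof -
      show "(?G has_field_derivative - l / (l + u)\<^sup>2) (at u)"
        using that by (auto intro!: derivative_eq_intros simp: power2_eq_square)
      show "((\<lambda>u. - l / (l + u)\<^sup>2) has_field_derivative 2 * l / (l + u) ^ 3) (at u)"
        using that by (auto intro!: derivative_eq_intros simp: divide_simps power2_eq_square power3_eq_cube)
    qed
    have "norm (fc (pfps \<alpha> ?G) r) \<le> cmod (?G 1) * K + (norm t + 8000 * K / (\<alpha> * (1 - \<alpha>)) * norm (t\<^sup>2)) * D"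
    proof (rule fc_pfps_bound[OF \<alpha> p, where G' = "\<lambda>u. - l / (l + u)\<^sup>2" and G'' = "\<lambda>u. 2 * l / (l + u) ^ 3", OF _ _ _ _ _ r])
      show "D \<ge> 0" using \<kappa> by (simp add: D_def)
      fix z :: complex assume z: "cmod z < 1"
      show "(?G has_field_derivative - l / (l + (1 - z) powr of_real \<alpha>)\<^sup>2) (at ((1 - z) powr of_real \<alpha>))"
        by (rule dG[OF ne[OF z refl]])
      show "((\<lambda>u. - l / (l + u)\<^sup>2) has_field_derivative 2 * l / (l + (1 - z) powr of_real \<alpha>) ^ 3) (at ((1 - z) powr of_real \<alpha>))"
        by (rule dG1[OF ne[OF z refl]])
      fix u assume u: "u = (1 - z) powr of_real \<alpha>"
      define B where "B = 1 + p * cmod u"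
      have B: "B > 0" using p by (simp add: B_def add_pos_nonneg)
      have lw: "\<kappa> * (cmod l * B) \<le> cmod (l + u)" "0 < \<kappa> * (cmod l * B)"
        using lower[OF z u] pos[of u] by (auto simp: B_def)
      have "cmod (- l / (l + u)\<^sup>2) = cmod l / (cmod (l + u))\<^sup>2" by (simp add: norm_divide norm_power)
      also have "\<dots> \<le> cmod l / (\<kappa> * (cmod l * B))\<^sup>2"
        using lw \<kappa> B l0 ne[OF z u] by (intro divide_left_mono power_mono mult_pos_pos zero_less_power) auto
      also have "\<dots> = 1 / \<kappa>\<^sup>2 * p / B\<^sup>2" using l0 by (simp add: p_def power2_eq_square)
      also have "\<dots> \<le> D * p / B\<^sup>2"
      proof (intro divide_right_mono mult_right_mono)
        have "\<kappa> ^ 3 \<le> \<kappa>\<^sup>2" using \<kappa> by (intro power_decreasing) auto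
        then have "1 / \<kappa>\<^sup>2 \<le> 1 / \<kappa> ^ 3" using \<kappa> by (intro divide_left_mono) auto
        also have "\<dots> \<le> D" using \<kappa> by (simp add: D_def divide_right_mono)
        finally show "1 / \<kappa>\<^sup>2 \<le> D" .
      qed (use p in auto)
      finally show "cmod (- l / (l + u)\<^sup>2) \<le> D * p / (1 + p * cmod u)\<^sup>2" by (simp add: B_def)
      have "cmod (2 * l / (l + u) ^ 3) = 2 * cmod l / (cmod (l + u)) ^ 3" by (simp add: norm_divide norm_power norm_mult)
      also have "\<dots> \<le> 2 * cmod l / (\<kappa> * (cmod l * B)) ^ 3"
        using lw \<kappa> B l0 ne[OF z u] by (intro divide_left_mono power_mono mult_pos_pos zero_less_power) auto
      also have "\<dots> = D * p\<^sup>2 / B ^ 3" using l0 by (simp add: D_def p_def power2_eq_square power3_eq_cube)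
      finally show "cmod (2 * l / (l + u) ^ 3) \<le> D * p\<^sup>2 / (1 + p * cmod u) ^ 3" by (simp add: B_def)
    qed
    also have "\<dots> \<le> M"
    proof -
      have "\<kappa> * (cmod l * (1 + p)) \<le> cmod (l + 1)" using lower[of 0 1] by simp
      moreover have "cmod l * (1 + p) = cmod l + 1" using l0 by (simp add: p_def distrib_left)
      ultimately have "\<kappa> * (cmod l + 1) \<le> cmod (l + 1)" by simp
      moreover have "\<kappa> * cmod l \<le> \<kappa> * (cmod l + 1)" using \<kappa> by simp
      ultimately have "\<kappa> * cmod l \<le> cmod (l + 1)" by (rule order_trans[rotated])
      then have "cmod (?G 1) \<le> 1 / \<kappa>"
        using \<kappa> by (simp add: norm_divide divide_simps mult.commute)
      then have "cmod (?G 1) * K \<le> 1 / \<kappa> * K" using K_ge by (intro mult_right_mono) auto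
      then show ?thesis by (simp add: M_def)
    qed
    finally have bnd: "norm (fc (pfps \<alpha> ?G) r) \<le> M" .
    let ?g = "pfps \<alpha> ?G"
    have rg: "fps_conv_radius ?g \<ge> 1" and eg: "\<And>z. cmod z < 1 \<Longrightarrow> eval_fps ?g z = ?G ((1 - z) powr of_real \<alpha>)"
      using pfps[of ?G "\<lambda>z. - l / (l + (1 - z) powr of_real \<alpha>)\<^sup>2" \<alpha>] dG[OF ne[OF _ refl]] by auto
    have rl: "fps_conv_radius (fps_const l + ufps \<alpha>) \<ge> 1"
      using ufps_radius[of \<alpha>] by (intro order_trans[OF _ fps_conv_radius_add]) simp
    have rm: "fps_conv_radius ((fps_const l + ufps \<alpha>) * ?g) \<ge> 1"
      by (intro fps_conv_radius_mult_ge_1 rl rg)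
    have one: "(0::ereal) < 1" by simp
    \<comment> \<open>Invertibility is an identity between power series, transported by the
      multiplicativity of \<open>fc\<close>. Since power series commute, it yields the inverse on
      both sides.\<close>
    have prod: "(fps_const l + ufps \<alpha>) * ?g = fps_const l"
    proof (rule eval_fps_eqD)
      show "fps_conv_radius ((fps_const l + ufps \<alpha>) * ?g) > 0" using rm one by (rule less_le_trans[rotated])
      have "eventually (\<lambda>z::complex. z \<in> ball 0 1) (nhds 0)"
        by (intro eventually_nhds_in_open) auto
      then show "eventually (\<lambda>z. eval_fps ((fps_const l + ufps \<alpha>) * ?g) z = eval_fps (fps_const l) z) (nhds 0)"
      proof eventually_elim
        case (elim z)
        then have z: "cmod z < 1" by simp
        show ?case
          using norm_less_radius[OF rl z] norm_less_radius[OF rg z] norm_less_radius[OF ufps_radius z] ne[OF z refl]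
          by (simp add: eval_fps_mult eval_fps_add eg[OF z] eval_ufps[OF z])
      qed
    qed simp
    define N where "N = fc ?g r"
    have 1: "(l *\<^sub>C 1 + fc (ufps \<alpha>) r) * N = l *\<^sub>C 1"
      using fc_mult[OF rl rg r] r
      by (simp add: prod N_def fc_const fc_add ufps_radius)
    have 2: "N * (l *\<^sub>C 1 + fc (ufps \<alpha>) r) = l *\<^sub>C 1"
      using fc_mult[OF rg rl r] r
      by (simp add: prod mult.commute[of ?g] N_def fc_const fc_add ufps_radius)
    show "\<exists>R. R * (l *\<^sub>C 1 + fc (ufps \<alpha>) r) = 1 \<and> (l *\<^sub>C 1 + fc (ufps \<alpha>) r) * R = 1 \<and> cmod l * norm R \<le> M"
      using 1 2 l0 bnd
      by (intro exI[of _ "(1 / l) *\<^sub>C N"]) (simp add: scaleC_simps norm_scaleC norm_divide N_def)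
  qed
qed

end

section \<open>Balakrishnan's integral\<close>

lemma Beta_reflection_real:
  fixes \<alpha> :: real
  shows "Beta \<alpha> (1 - \<alpha>) = pi / sin (pi * \<alpha>)"
proof -
  have "complex_of_real (Beta \<alpha> (1 - \<alpha>)) = Gamma (of_real \<alpha>) * Gamma (1 - of_real \<alpha>)"
    by (simp add: Beta_def flip: Gamma_complex_of_real)
  also have "\<dots> = of_real (pi / sin (pi * \<alpha>))"
    by (simp add: Gamma_reflection_complex sin_of_real flip: of_real_mult)
  finally show ?thesis by (simp only: of_real_eq_iff)
qed

text \<open>The substitution x = s / (1 + s) leads to the Beta integral with parameters \<alpha> and
  1 - \<alpha>, so \<open>G\<close> is the indefinite Beta integral taken at s / (1 + s). An
  antiderivative with its limits, not just the value of the integral, is what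
  \<open>dominated_has_integral_Ioi\<close> takes as input.\<close>

lemma beta_antiderivative:
  assumes \<alpha>: "0 < \<alpha>" "\<alpha> < (1::real)"
  obtains G where "\<And>s. s > 0 \<Longrightarrow> (G has_real_derivative s powr (\<alpha> - 1) / (1 + s)) (at s)"
    "(G \<longlongrightarrow> 0) (at_right 0)" "(G \<longlongrightarrow> pi / sin (pi * \<alpha>)) at_top"
proof -
  define f where "f = (\<lambda>x::real. x powr (\<alpha> - 1) * (1 - x) powr (- \<alpha>))"
  define B where "B = (\<lambda>u. integral {0..u} f)"
  have int: "(f has_integral pi / sin (pi * \<alpha>)) {0..1}"
    using has_integral_Beta_real[of \<alpha> "1 - \<alpha>"] \<alpha> by (simp add: f_def Beta_reflection_real)
  then have intf: "f integrable_on {0..1}" by blast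
  have cont: "continuous_on {0..1} B"
    unfolding B_def by (rule indefinite_integral_continuous_1[OF intf])
  have dB: "(B has_real_derivative f x) (at x)" if x: "0 < x" "x < 1" for x
  proof -
    have "isCont f x" unfolding f_def using x by (intro continuous_intros) auto
    then have "((\<lambda>u. integral {0..u} f) has_vector_derivative f x) (at x within ({0..1} - {}))"
      using x by (intro integral_has_vector_derivative_continuous_at[OF intf])
        (auto intro: continuous_at_imp_continuous_at_within)
    then show ?thesis
      using x by (simp add: B_def at_within_Icc_at has_real_derivative_iff_has_vector_derivative)
  qed
  define G where "G = (\<lambda>s. B (s / (1 + s)))"
  have in01: "s / (1 + s) \<in> {0..1}" if "s > 0" for s :: real using that by auto
  show thesis
  proof (rule that[of G])
    fix s :: real assume s: "s > 0"
    have "((\<lambda>s. s / (1 + s)) has_real_derivative 1 / (1 + s)\<^sup>2) (at s)"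
      using s by (auto intro!: derivative_eq_intros simp: power2_eq_square)
    moreover have "(B has_real_derivative f (s / (1 + s))) (at (s / (1 + s)))"
      using s by (intro dB) auto
    ultimately have "(G has_real_derivative f (s / (1 + s)) * (1 / (1 + s)\<^sup>2)) (at s)"
      unfolding G_def by (intro DERIV_chain2)
    also have "f (s / (1 + s)) * (1 / (1 + s)\<^sup>2) = s powr (\<alpha> - 1) / (1 + s)"
    proof -
      have "1 - s / (1 + s) = 1 / (1 + s)" using s by (simp add: field_simps)
      then have "f (s / (1 + s)) = s powr (\<alpha> - 1) / (1 + s) powr (\<alpha> - 1) * (1 + s) powr \<alpha>"
        using s by (simp add: f_def powr_divide powr_minus)
      also have "\<dots> = s powr (\<alpha> - 1) * (1 + s)"
        using s by (simp add: powr_diff)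
      finally show ?thesis using s by (simp add: power2_eq_square)
    qed
    finally show "(G has_real_derivative s powr (\<alpha> - 1) / (1 + s)) (at s)" .
  next
    have "((\<lambda>s. s / (1 + s)) \<longlongrightarrow> 0 / (1 + 0)) (at_right (0::real))"
      by (intro tendsto_intros) auto
    then have "(G \<longlongrightarrow> B 0) (at_right 0)"
      unfolding G_def using in01
      by (intro continuous_on_tendsto_compose[OF cont]) (auto simp: eventually_at_filter)
    then show "(G \<longlongrightarrow> 0) (at_right 0)" by (simp add: B_def)
  next
    have "((\<lambda>s::real. s / (1 + s)) \<longlongrightarrow> 1) at_top"
      by real_asymp
    then have "(G \<longlongrightarrow> B 1) at_top"
      unfolding G_def
      by (intro continuous_on_tendsto_compose[OF cont] eventually_mono[OF eventually_gt_at_top[of 0] in01]) auto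
    then show "(G \<longlongrightarrow> pi / sin (pi * \<alpha>)) at_top"
      using int by (simp add: B_def integral_unique)
  qed
qed

text \<open>By scaling, \<open>C * (q powr \<alpha> * G (s / q))\<close> is an antiderivative of the
  majorant. With q = 1 this gives convergence of the integrals, with q = 1 - r the rate at which
  they converge as r tends to 1.\<close>

lemma balakrishnan_dominated:
  fixes f :: "real \<Rightarrow> 'b::banach"
  assumes \<alpha>: "0 < \<alpha>" "\<alpha> < 1" and "q > 0" and cont: "continuous_on {0<..} f"
    and le: "\<And>s. s > 0 \<Longrightarrow> norm (f s) \<le> C * (s powr (\<alpha> - 1) * q / (q + s))"
  obtains I where "(f has_integral I) {0<..}" "norm I \<le> C * (q powr \<alpha> * (pi / sin (pi * \<alpha>)))"
proof -
  obtain G where G: "\<And>s. s > 0 \<Longrightarrow> (G has_real_derivative s powr (\<alpha> - 1) / (1 + s)) (at s)"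
    "(G \<longlongrightarrow> 0) (at_right 0)" "(G \<longlongrightarrow> pi / sin (pi * \<alpha>)) at_top"
    by (rule beta_antiderivative[OF \<alpha>]) (rule that)
  define H where "H = (\<lambda>s. C * (q powr \<alpha> * G (s / q)))"
  have dH: "(H has_real_derivative C * (s powr (\<alpha> - 1) * q / (q + s))) (at s)" if s: "s > 0" for s
  proof -
    have "((\<lambda>s. s / q) has_real_derivative 1 / q) (at s)"
      using \<open>q > 0\<close> by (auto intro!: derivative_eq_intros)
    moreover have "(G has_real_derivative (s / q) powr (\<alpha> - 1) / (1 + s / q)) (at (s / q))"
      using s \<open>q > 0\<close> by (intro G) auto
    ultimately have "((\<lambda>s. G (s / q)) has_real_derivative (s / q) powr (\<alpha> - 1) / (1 + s / q) * (1 / q)) (at s)"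
      by (intro DERIV_chain2)
    then have "(H has_real_derivative C * (q powr \<alpha> * ((s / q) powr (\<alpha> - 1) / (1 + s / q) * (1 / q)))) (at s)"
      unfolding H_def by (intro DERIV_cmult)
    also have "q powr \<alpha> * ((s / q) powr (\<alpha> - 1) / (1 + s / q) * (1 / q)) = s powr (\<alpha> - 1) * q / (q + s)"
    proof -
      have "1 + s / q = (q + s) / q" using \<open>q > 0\<close> by (simp add: field_simps)
      moreover have "(s / q) powr (\<alpha> - 1) = s powr (\<alpha> - 1) * q / q powr \<alpha>"
        using s \<open>q > 0\<close> by (simp add: powr_divide powr_diff)
      ultimately show ?thesis using s \<open>q > 0\<close> by simp
    qed
    finally show ?thesis .
  qed
  have H0: "(H \<longlongrightarrow> C * (q powr \<alpha> * 0)) (at_right 0)"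
  proof -
    have "filterlim (\<lambda>s. s / q) (at_right 0) (at_right 0)"
      using \<open>q > 0\<close> by (intro filterlim_at_withinI tendsto_eq_intros refl) (auto simp: eventually_at_filter)
    then show ?thesis unfolding H_def
      by (intro tendsto_intros filterlim_compose[OF G(2)])
  qed
  have Hinf: "(H \<longlongrightarrow> C * (q powr \<alpha> * (pi / sin (pi * \<alpha>)))) at_top"
  proof -
    have "filterlim (\<lambda>s. s / q) at_top at_top"
      using \<open>q > 0\<close> by real_asymp
    then show ?thesis unfolding H_def
      by (intro tendsto_intros filterlim_compose[OF G(3)])
  qed
  obtain I where "(f has_integral I) {0<..}" "norm I \<le> C * (q powr \<alpha> * (pi / sin (pi * \<alpha>))) - C * (q powr \<alpha> * 0)"
    by (rule dominated_has_integral_Ioi[OF cont dH le H0 Hinf])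
  then show thesis by (intro that) auto
qed

text \<open>The coefficient of \<open>x\<^sup>k\<close> in the expansion of \<open>s\<^sup>\<alpha>\<^sup>-\<^sup>1 (1 - x) / (s + 1 - x)\<close>.\<close>

definition bkern :: "real \<Rightarrow> nat \<Rightarrow> real \<Rightarrow> real" where
  "bkern \<alpha> k s = (if k = 0 then s powr (\<alpha> - 1) / (1 + s) else - (s powr \<alpha> / (1 + s) ^ (k + 1)))"

text \<open>The majorant does not depend on \<open>k\<close>, so it dominates whole tails of the
  series in \<open>balak_sums\<close>.\<close>

lemma bkern_bound:
  assumes "s > 0"
  shows "\<bar>bkern \<alpha> k s\<bar> \<le> s powr (\<alpha> - 1) / (1 + s)"
proof (cases "k = 0")
  case True
  then show ?thesis using assms by (simp add: bkern_def)
next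
  case False
  have "(1 + s) ^ 2 \<le> (1 + s) ^ (k + 1)"
    using assms False by (intro power_increasing) auto
  moreover have "s * (1 + s) \<le> (1 + s) ^ 2" using assms by (simp add: power2_eq_square)
  ultimately have "s * (1 + s) \<le> (1 + s) ^ (k + 1)" by linarith
  then have "s powr \<alpha> / (1 + s) ^ (k + 1) \<le> s powr \<alpha> / (s * (1 + s))"
    using assms by (intro divide_left_mono) auto
  also have "\<dots> = s powr (\<alpha> - 1) / (1 + s)" using assms by (simp add: powr_diff)
  finally show ?thesis using assms False by (simp add: bkern_def)
qed

lemma continuous_on_bkern: "continuous_on {0<..} (bkern \<alpha> k)"
  unfolding bkern_def by (cases "k = 0") (auto intro!: continuous_intros)

lemma powr_over_power_limits:
  fixes a :: real
  assumes "0 < a" "a < real m"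
  shows "((\<lambda>s. s powr a / (1 + s) ^ m) \<longlongrightarrow> 0) (at_right 0)"
    and "((\<lambda>s. s powr a / (1 + s) ^ m) \<longlongrightarrow> 0) at_top"
proof -
  have "((\<lambda>s. s powr a / (1 + s) ^ m) \<longlongrightarrow> 0 / (1 + 0) ^ m) (at_right 0)"
    using assms by (intro tendsto_intros tendsto_zero_powrI) (auto simp: eventually_at_filter)
  then show "((\<lambda>s. s powr a / (1 + s) ^ m) \<longlongrightarrow> 0) (at_right 0)" by simp
  show "((\<lambda>s. s powr a / (1 + s) ^ m) \<longlongrightarrow> 0) at_top"
  proof (rule Lim_null_comparison)
    show "((\<lambda>s. s powr (a - real m)) \<longlongrightarrow> 0) at_top"
      using assms by (intro tendsto_neg_powr filterlim_ident) auto
    show "\<forall>\<^sub>F s in at_top. norm (s powr a / (1 + s) ^ m) \<le> s powr (a - real m)"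
      using eventually_gt_at_top[of 0]
    proof eventually_elim
      case (elim s)
      have "s powr a / (1 + s) ^ m \<le> s powr a / s ^ m"
        using elim by (intro divide_left_mono power_mono mult_pos_pos) auto
      then show ?case using elim by (simp add: powr_diff powr_realpow)
    qed
  qed
qed

text \<open>The combination \<open>(real k - \<alpha>) * bkern \<alpha> k s - real (Suc k) * bkern
  \<alpha> (Suc k) s\<close> is the derivative of a function vanishing at 0 and at infinity. The
  integrals therefore obey the recursion of the signed binomial coefficients. Convergence of the
  integral of index \<open>Suc k\<close> is established first, so that the recursion can be solved
  for it.\<close>

lemma has_integral_bkern:
  assumes \<alpha>: "0 < \<alpha>" "\<alpha> < (1::real)"
  shows "(bkern \<alpha> k has_integral pi / sin (pi * \<alpha>) * ((-1) ^ k * (\<alpha> gchoose k))) {0<..}"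
proof (induction k)
  case 0
  obtain G where G: "\<And>s. s > 0 \<Longrightarrow> (G has_real_derivative s powr (\<alpha> - 1) / (1 + s)) (at s)"
    "(G \<longlongrightarrow> 0) (at_right 0)" "(G \<longlongrightarrow> pi / sin (pi * \<alpha>)) at_top"
    by (rule beta_antiderivative[OF \<alpha>]) (rule that)
  have "(bkern \<alpha> 0 has_integral pi / sin (pi * \<alpha>) - 0) {0<..}"
    using G by (intro has_integral_Ioi_vector_derivative[of G])
      (auto simp: bkern_def has_real_derivative_iff_has_vector_derivative)
  then show ?case by simp
next
  case (Suc k)
  obtain I where I: "(bkern \<alpha> (Suc k) has_integral I) {0<..}"
  proof (rule balakrishnan_dominated[OF \<alpha> zero_less_one continuous_on_bkern[of \<alpha> "Suc k"]])
    show "norm (bkern \<alpha> (Suc k) s) \<le> 1 * (s powr (\<alpha> - 1) * 1 / (1 + s))" if "s > 0" for s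
      using bkern_bound[OF that] by simp
  qed
  let ?J = "pi / sin (pi * \<alpha>) * ((-1) ^ k * (\<alpha> gchoose k))"
  have "((\<lambda>s. (real k - \<alpha>) * bkern \<alpha> k s - real (Suc k) * bkern \<alpha> (Suc k) s) has_integral
      ((real k - \<alpha>) * ?J - real (Suc k) * I)) {0<..}"
    by (intro has_integral_diff has_integral_mult_right Suc.IH I)
  moreover have "((\<lambda>s. (real k - \<alpha>) * bkern \<alpha> k s - real (Suc k) * bkern \<alpha> (Suc k) s) has_integral 0 - 0) {0<..}"
  \<comment> \<open>The kernel of index 0 has its own formula and needs its own primitive: at k = 0
    the function \<open>s powr (\<alpha> + 1) / (1 + s) ^ (k + 1)\<close> does not tend to 0 at
    infinity.\<close>
  proof (cases "k = 0")
    case True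
    show ?thesis
    proof (rule has_integral_Ioi_vector_derivative[of "\<lambda>s. - (s powr \<alpha> / (1 + s) ^ 1)"])
      fix s :: real assume s: "s > 0"
      have "((\<lambda>s. - (s powr \<alpha> / (1 + s) ^ 1)) has_real_derivative
         - ((\<alpha> * s powr (\<alpha> - 1) * (1 + s) - s powr \<alpha> * 1) / ((1 + s) * (1 + s)))) (at s)"
        using s by (auto intro!: derivative_eq_intros)
      also have "- ((\<alpha> * s powr (\<alpha> - 1) * (1 + s) - s powr \<alpha> * 1) / ((1 + s) * (1 + s))) =
          (real k - \<alpha>) * bkern \<alpha> k s - real (Suc k) * bkern \<alpha> (Suc k) s"
        using s True by (simp add: bkern_def power2_eq_square diff_divide_distrib)
      finally show "((\<lambda>s. - (s powr \<alpha> / (1 + s) ^ 1)) has_vector_derivative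
         (real k - \<alpha>) * bkern \<alpha> k s - real (Suc k) * bkern \<alpha> (Suc k) s) (at s)"
        by (simp only: has_real_derivative_iff_has_vector_derivative)
    next
      show "((\<lambda>s. - (s powr \<alpha> / (1 + s) ^ 1)) \<longlongrightarrow> 0) (at_right 0)"
        using tendsto_minus[OF powr_over_power_limits(1)[of \<alpha> 1]] \<alpha> by simp
      show "((\<lambda>s. - (s powr \<alpha> / (1 + s) ^ 1)) \<longlongrightarrow> 0) at_top"
        using tendsto_minus[OF powr_over_power_limits(2)[of \<alpha> 1]] \<alpha> by simp
    qed
  next
    case False
    show ?thesis
    proof (rule has_integral_Ioi_vector_derivative[of "\<lambda>s. s powr (\<alpha> + 1) / (1 + s) ^ (k + 1)"])
      fix s :: real assume s: "s > 0"
      define b where "b = (1 + s) ^ k"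
      have b: "b > 0" using s by (simp add: b_def)
      have "((\<lambda>s::real. 1 + s) has_real_derivative 1) (at s)"
        by (auto intro!: derivative_eq_intros)
      from DERIV_power[OF this, of "k + 1"]
      have dp: "((\<lambda>s. (1 + s) ^ (k + 1)) has_real_derivative real (k + 1) * (1 + s) ^ k) (at s)"
        by simp
      have dq: "((\<lambda>s. s powr (\<alpha> + 1)) has_real_derivative (\<alpha> + 1) * s powr \<alpha>) (at s)"
        using s by (auto intro!: derivative_eq_intros)
      have "((\<lambda>s. s powr (\<alpha> + 1) / (1 + s) ^ (k + 1)) has_real_derivative
         (((\<alpha> + 1) * s powr \<alpha>) * (1 + s) ^ (k + 1) - s powr (\<alpha> + 1) * (real (k + 1) * (1 + s) ^ k))
            / ((1 + s) ^ (k + 1) * (1 + s) ^ (k + 1))) (at s)"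
        by (rule DERIV_divide[OF dq dp]) (use s in simp)
      also have "(((\<alpha> + 1) * s powr \<alpha>) * (1 + s) ^ (k + 1) - s powr (\<alpha> + 1) * (real (k + 1) * (1 + s) ^ k))
            / ((1 + s) ^ (k + 1) * (1 + s) ^ (k + 1)) =
          (real k - \<alpha>) * bkern \<alpha> k s - real (Suc k) * bkern \<alpha> (Suc k) s"
      proof -
        have "s powr (\<alpha> + 1) = s powr \<alpha> * s" using s by (simp add: powr_add)
        then show ?thesis
          using s False b
          by (simp add: bkern_def b_def[symmetric] divide_simps) (simp add: algebra_simps)
      qed
      finally show "((\<lambda>s. s powr (\<alpha> + 1) / (1 + s) ^ (k + 1)) has_vector_derivative
         (real k - \<alpha>) * bkern \<alpha> k s - real (Suc k) * bkern \<alpha> (Suc k) s) (at s)"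
        by (simp only: has_real_derivative_iff_has_vector_derivative)
    qed (use \<alpha> False powr_over_power_limits[of "\<alpha> + 1" "k + 1"] in auto)
  qed
  ultimately have "(real k - \<alpha>) * ?J - real (Suc k) * I = 0 - 0"
    by (rule has_integral_unique)
  then have "real (Suc k) * I = (real k - \<alpha>) * ?J" by simp
  also have "(x - y) * (p * (m * g)) = p * (-1 * m * ((y - x) * g))" for x y p m g :: real
    by (simp add: algebra_simps)
  then have "(real k - \<alpha>) * ?J = pi / sin (pi * \<alpha>) * ((-1) ^ Suc k * ((\<alpha> - real k) * (\<alpha> gchoose k)))"
    unfolding power_Suc .
  also have "(\<alpha> - real k) * (\<alpha> gchoose k) = real (Suc k) * (\<alpha> gchoose Suc k)"
    using gbinomial_mult_1[of \<alpha> k] by (simp add: algebra_simps del: of_nat_Suc)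
  finally have "real (Suc k) * I = real (Suc k) * (pi / sin (pi * \<alpha>) * ((-1) ^ Suc k * (\<alpha> gchoose Suc k)))"
    by (simp only: mult_ac)
  then have "I = pi / sin (pi * \<alpha>) * ((-1) ^ Suc k * (\<alpha> gchoose Suc k))"
    by (simp only: mult_cancel_left) simp
  then show ?case using I by simp
qed

section \<open>Balakrishnan's integrand at r t and the passage to r = 1\<close>

context kreiss
begin

text \<open>The binomial series. Up to the factor \<open>pi / sin (pi * \<alpha>)\<close> these
  numbers are the integrals of \<open>bkern\<close>, which is why Balakrishnan's integral reproduces
  \<open>fc (ufps \<alpha>) r\<close>.\<close>

lemma ufps_nth: "fps_nth (ufps \<alpha>) k = of_real ((-1) ^ k * (\<alpha> gchoose k))"
proof -
  define f :: "complex fps" where "f = Abs_fps (\<lambda>k. (-1) ^ k * (of_real \<alpha> gchoose k))"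
  have "conv_radius (\<lambda>k. (-1) ^ k * (complex_of_real \<alpha> gchoose k)) = conv_radius (\<lambda>k. complex_of_real \<alpha> gchoose k)"
    by (subst (1 2) conv_radius_norm[symmetric]) (simp add: norm_mult norm_power)
  then have rad: "fps_conv_radius f \<ge> 1"
    by (simp add: f_def fps_conv_radius_def conv_radius_gchoose)
  have "ufps \<alpha> = f"
  proof (rule pfps_eqI[OF rad])
    fix z :: complex assume "cmod z < 1"
    then have "(\<lambda>n. (of_real \<alpha> gchoose n) * (- z) ^ n) sums (1 + (- z)) powr of_real \<alpha>"
      by (intro gen_binomial_complex) simp
    moreover have "(of_real \<alpha> gchoose n) * (- z) ^ n = fps_nth f n * z ^ n" for n
      by (simp add: f_def power_minus[of z] mult_ac)
    ultimately show "eval_fps f z = (1 - z) powr of_real \<alpha>"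
      by (simp add: eval_fps_def sums_iff)
    show "((\<lambda>u. u) has_field_derivative 1) (at ((1 - z) powr of_real \<alpha>))" by (rule DERIV_ident)
  qed
  moreover have "(of_real \<alpha> gchoose k :: complex) = of_real (\<alpha> gchoose k)"
    by (simp add: gbinomial_prod_rev)
  ultimately show ?thesis by (simp add: f_def)
qed

text \<open>This is \<open>s\<^sup>\<alpha>\<^sup>-\<^sup>1 (s + v)\<^sup>-\<^sup>1 v\<close> for \<open>v = 1 - r t\<close>, since \<open>(s + v)\<^sup>-\<^sup>1 = res (r / (1 + s)) / (1 + s)\<close>.\<close>

definition balak :: "real \<Rightarrow> real \<Rightarrow> real \<Rightarrow> 'a" where
  "balak \<alpha> r s = s powr (\<alpha> - 1) *\<^sub>R (1 - (s / (1 + s)) *\<^sub>R res (of_real (r / (1 + s))))"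

lemma norm_res_real_bound:
  assumes "0 \<le> r" "r \<le> 1" "s > 0"
  shows "cmod (of_real (r / (1 + s))) < 1" "norm (res (of_real (r / (1 + s)))) \<le> K * (1 + s) / (1 - r + s)"
proof -
  show 1: "cmod (of_real (r / (1 + s))) < 1" using assms by (simp only: norm_of_real) simp
  have "norm (res (of_real (r / (1 + s)))) \<le> K / (1 - r / (1 + s))"
    using res_bound[OF 1] assms by (simp only: norm_of_real) simp
  also have "1 - r / (1 + s) = (1 - r + s) / (1 + s)" using assms by (simp add: field_simps)
  finally show "norm (res (of_real (r / (1 + s)))) \<le> K * (1 + s) / (1 - r + s)" by simp
qed

lemma continuous_on_balak:
  assumes "0 \<le> r" "r \<le> 1"
  shows "continuous_on {0<..} (balak \<alpha> r)"
  unfolding balak_def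
  by (intro continuous_intros norm_res_real_bound(1) assms) auto

text \<open>For large s the resolvent term nearly cancels 1, so the triangle inequality is applied
  only after inserting \<open>res_eq\<close>. What remains is 1 / (1 + s) and a term with two such
  factors, one of which is consumed by the bound \<open>K * (1 + s) / s\<close> of the resolvent.
  The estimate is uniform in r up to r = 1.\<close>

lemma balak_bound:
  assumes "0 \<le> r" "r \<le> 1" "s > 0"
  shows "norm (balak \<alpha> r s) \<le> K * (1 + norm t) * (s powr (\<alpha> - 1) * 1 / (1 + s))"
proof -
  note R = norm_res_real_bound[OF assms]
  let ?R = "res (of_real (r / (1 + s)))"
  have "1 - (s / (1 + s)) *\<^sub>R ?R = (1 / (1 + s)) *\<^sub>R 1 - (s / (1 + s) * (r / (1 + s))) *\<^sub>R (t * ?R)"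
  proof -
    have "1 - (s / (1 + s)) *\<^sub>R ?R = 1 - (s / (1 + s)) *\<^sub>R (1 + (r / (1 + s)) *\<^sub>R (t * ?R))"
      using arg_cong[OF res_eq[OF R(1)], of "\<lambda>x. 1 - (s / (1 + s)) *\<^sub>R x"] by (simp only: scaleC_of_real)
    also have "\<dots> = (1 - s / (1 + s)) *\<^sub>R 1 - (s / (1 + s) * (r / (1 + s))) *\<^sub>R (t * ?R)"
      by (simp only: scaleR_add_right scaleR_scaleR scaleR_diff_left scaleR_one diff_diff_eq)
    also have "1 - s / (1 + s) = 1 / (1 + s)" using assms by (simp add: field_simps)
    finally show ?thesis .
  qed
  then have "norm (1 - (s / (1 + s)) *\<^sub>R ?R) \<le> norm ((1 / (1 + s)) *\<^sub>R (1::'a)) + norm ((s / (1 + s) * (r / (1 + s))) *\<^sub>R (t * ?R))"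
    by (simp only: norm_triangle_ineq4)
  also have "norm ((1 / (1 + s)) *\<^sub>R (1::'a)) \<le> K / (1 + s)"
    using K_ge assms by (simp add: divide_right_mono)
  also have "norm ((s / (1 + s) * (r / (1 + s))) *\<^sub>R (t * ?R)) \<le> (s / (1 + s) * (1 / (1 + s))) * (norm t * (K * (1 + s) / s))"
  proof -
    have "norm (t * ?R) \<le> norm t * (K * (1 + s) / s)"
    proof (rule order_trans[OF norm_mult_ineq mult_left_mono])
      show "norm ?R \<le> K * (1 + s) / s"
        using K_ge assms by (intro order_trans[OF R(2)] divide_left_mono) auto
    qed simp
    moreover have "\<bar>s / (1 + s) * (r / (1 + s))\<bar> \<le> s / (1 + s) * (1 / (1 + s))"
      using assms by (simp add: abs_mult divide_right_mono mult_left_le)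
    ultimately show ?thesis unfolding norm_scaleR using assms by (intro mult_mono) auto
  qed
  also have "(s / (1 + s) * (1 / (1 + s))) * (norm t * (K * (1 + s) / s)) = K * norm t / (1 + s)"
    using assms by simp
  finally have "norm (1 - (s / (1 + s)) *\<^sub>R ?R) \<le> K * (1 + norm t) / (1 + s)"
    by (simp add: distrib_left add_divide_distrib)
  from mult_left_mono[OF this, of "s powr (\<alpha> - 1)"] show ?thesis
    by (simp add: balak_def mult_ac)
qed

text \<open>The resolvent identity supplies (1 - r) / (1 + s). Bounding the resolvent belonging to 1
  by \<open>K * (1 + s) / s\<close> and the one belonging to \<open>r\<close> by
  \<open>K * (1 + s) / (1 - r + s)\<close> leaves the majorant of
  \<open>balakrishnan_dominated\<close> with q = 1 - r.\<close>

lemma balak_diff_bound: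
  assumes "0 \<le> r" "r < 1" "s > 0"
  shows "norm (balak \<alpha> r s - balak \<alpha> 1 s) \<le> norm t * K\<^sup>2 * (s powr (\<alpha> - 1) * (1 - r) / ((1 - r) + s))"
proof -
  have "0 \<le> r" "r \<le> 1" using assms by auto
  note Rr = norm_res_real_bound[OF this assms(3)]
  have R1: "cmod (of_real (1 / (1 + s))) < 1" "norm (res (of_real (1 / (1 + s)))) \<le> K * (1 + s) / s"
    using norm_res_real_bound[of 1 s] assms by auto
  let ?R = "res (of_real (r / (1 + s)))" and ?S = "res (of_real (1 / (1 + s)))"
  have "balak \<alpha> r s - balak \<alpha> 1 s = (s powr (\<alpha> - 1) * (s / (1 + s))) *\<^sub>R (?S - ?R)"
    by (simp add: balak_def algebra_simps)
  also have "?S - ?R = of_real ((1 - r) / (1 + s)) *\<^sub>C (?S * t * ?R)"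
    using res_diff[OF R1(1) Rr(1)] by (simp only: of_real_diff[symmetric] diff_divide_distrib[symmetric])
  finally have "norm (balak \<alpha> r s - balak \<alpha> 1 s) =
      (s powr (\<alpha> - 1) * (s / (1 + s))) * ((1 - r) / (1 + s) * norm (?S * t * ?R))"
    using assms by (simp add: scaleC_of_real del: of_real_divide)
  also have "\<dots> \<le> (s powr (\<alpha> - 1) * (s / (1 + s))) * ((1 - r) / (1 + s) * ((K * (1 + s) / s) * norm t * (K * (1 + s) / (1 - r + s))))"
  proof (intro mult_left_mono)
    have "norm (?S * t * ?R) \<le> norm ?S * norm t * norm ?R"
      by (meson norm_mult_ineq order_trans mult_right_mono norm_ge_zero)
    also have "\<dots> \<le> (K * (1 + s) / s) * norm t * (K * (1 + s) / (1 - r + s))"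
      using R1(2) Rr(2) K_ge assms by (intro mult_mono) auto
    finally show "norm (?S * t * ?R) \<le> (K * (1 + s) / s) * norm t * (K * (1 + s) / (1 - r + s))" .
  qed (use assms in auto)
  also have "\<dots> = norm t * K\<^sup>2 * (s powr (\<alpha> - 1) * (1 - r) / ((1 - r) + s))"
  proof -
    have "1 + s \<noteq> 0" "s \<noteq> 0" using assms by auto
    then show ?thesis by (simp add: power2_eq_square)
  qed
  finally show ?thesis .
qed

lemma balak_sums:
  assumes "0 \<le> r" "r \<le> 1" "s > 0"
  shows "(\<lambda>k. bkern \<alpha> k s *\<^sub>R (r ^ k *\<^sub>R t ^ k)) sums balak \<alpha> r s"
proof -
  note R = norm_res_real_bound[OF assms]
  have "(\<lambda>k. (of_real (r / (1 + s)) ^ k) *\<^sub>C t ^ k) sums res (of_real (r / (1 + s)))"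
    by (rule res_sums[OF R(1)])
  then have "(\<lambda>k. (r / (1 + s)) ^ k *\<^sub>R t ^ k) sums res (of_real (r / (1 + s)))"
    by (simp only: of_real_power[symmetric] scaleC_of_real)
  then have "(\<lambda>k. s powr (\<alpha> - 1) *\<^sub>R ((if k = 0 then 1 else 0) - (s / (1 + s)) *\<^sub>R ((r / (1 + s)) ^ k *\<^sub>R t ^ k))) sums
      balak \<alpha> r s"
    unfolding balak_def using sums_single[of 0 "\<lambda>_. 1::'a"]
    by (intro sums_scaleR_right sums_diff) auto
  moreover have "s powr (\<alpha> - 1) *\<^sub>R ((if k = 0 then 1 else 0) - (s / (1 + s)) *\<^sub>R ((r / (1 + s)) ^ k *\<^sub>R t ^ k))
      = bkern \<alpha> k s *\<^sub>R (r ^ k *\<^sub>R t ^ k)" for k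
  proof (cases "k = 0")
    case True
    have "1 - s / (1 + s) = 1 / (1 + s)" using assms by (simp add: field_simps)
    then have "(1::'a) - (s / (1 + s)) *\<^sub>R 1 = (1 / (1 + s)) *\<^sub>R 1"
      by (metis scaleR_one scaleR_diff_left)
    then show ?thesis using True by (simp add: bkern_def)
  next
    case False
    have "s powr (\<alpha> - 1) * s = s powr \<alpha>" using assms by (simp add: powr_diff)
    then show ?thesis using False by (simp add: bkern_def power_divide field_simps)
  qed
  ultimately show ?thesis by simp
qed

text \<open>Termwise integration. After n terms the remainder of the integrand is at most the tail
  of the sum of \<open>norm (b k)\<close> times a fixed integrable function, by
  \<open>bkern_bound\<close>, so the error of the partial sums tends to 0.\<close>

lemma has_integral_balak:
  assumes \<alpha>: "0 < \<alpha>" "\<alpha> < 1" and r: "0 \<le> r" "r < 1"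
  shows "(balak \<alpha> r has_integral (pi / sin (pi * \<alpha>)) *\<^sub>R fc (ufps \<alpha>) r) {0<..}"
proof -
  let ?P = "pi / sin (pi * \<alpha>)"
  define b where "b = (\<lambda>k. r ^ k *\<^sub>R t ^ k)"
  define J where "J = (\<lambda>n. \<Sum>k<n. (?P * ((-1) ^ k * (\<alpha> gchoose k))) *\<^sub>R b k)"
  have sb: "summable (\<lambda>k. norm (b k))"
    using summable_power[of r] r by (simp add: b_def)
  obtain I where I: "(balak \<alpha> r has_integral I) {0<..}"
    by (rule balakrishnan_dominated[OF \<alpha> zero_less_one continuous_on_balak[OF r(1) less_imp_le[OF r(2)]]
          balak_bound[OF r(1) less_imp_le[OF r(2)]]])
  have close: "norm (I - J n) \<le> (\<Sum>k. norm (b (k + n))) * ?P" for n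
  proof -
    define g where "g = (\<lambda>s. balak \<alpha> r s - (\<Sum>k<n. bkern \<alpha> k s *\<^sub>R b k))"
    have g: "(g has_integral (I - J n)) {0<..}"
      unfolding g_def J_def
      by (intro has_integral_diff I has_integral_sum has_integral_scaleR_left has_integral_bkern \<alpha>) auto
    have contg: "continuous_on {0<..} g"
      unfolding g_def using r
      by (intro continuous_intros continuous_on_balak continuous_on_bkern) auto
    have leg: "norm (g s) \<le> (\<Sum>k. norm (b (k + n))) * (s powr (\<alpha> - 1) * 1 / (1 + s))" if s: "s > 0" for s
    proof -
      have "(\<lambda>k. bkern \<alpha> k s *\<^sub>R b k) sums balak \<alpha> r s"
        unfolding b_def using r s by (intro balak_sums) auto
      then have "(\<lambda>k. bkern \<alpha> (k + n) s *\<^sub>R b (k + n)) sums g s"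
        unfolding g_def by (rule sums_split_initial_segment)
      then have eq: "g s = (\<Sum>k. bkern \<alpha> (k + n) s *\<^sub>R b (k + n))" by (rule sums_unique)
      have sbn: "summable (\<lambda>k. norm (b (k + n)))" using sb by (rule summable_ignore_initial_segment)
      have "norm (g s) \<le> (\<Sum>k. (s powr (\<alpha> - 1) / (1 + s)) * norm (b (k + n)))"
        unfolding eq
      proof (rule norm_suminf_le)
        show "norm (bkern \<alpha> (k + n) s *\<^sub>R b (k + n)) \<le> (s powr (\<alpha> - 1) / (1 + s)) * norm (b (k + n))" for k
          unfolding norm_scaleR using bkern_bound[OF s] by (intro mult_right_mono) auto
      qed (intro summable_mult sbn)
      also have "\<dots> = (s powr (\<alpha> - 1) / (1 + s)) * (\<Sum>k. norm (b (k + n)))"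
        by (rule suminf_mult[OF sbn])
      finally show ?thesis by (simp add: mult_ac)
    qed
    obtain I' where "(g has_integral I') {0<..}" "norm I' \<le> (\<Sum>k. norm (b (k + n))) * (1 powr \<alpha> * ?P)"
      by (rule balakrishnan_dominated[OF \<alpha> zero_less_one contg leg])
    with has_integral_unique[OF g] show ?thesis by auto
  qed
  have "(\<lambda>n. norm (I - J n)) \<longlonglongrightarrow> 0"
  proof (rule tendsto_sandwich[OF _ _ tendsto_const])
    show "\<forall>\<^sub>F n in sequentially. norm (I - J n) \<le> (\<Sum>k. norm (b (k + n))) * ?P"
      using close by simp
    show "(\<lambda>n. (\<Sum>k. norm (b (k + n))) * ?P) \<longlonglongrightarrow> 0"
      using tendsto_mult_right[OF suminf_exist_split2[OF sb], of ?P] by simp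
  qed simp
  then have "(\<lambda>n. I - J n) \<longlonglongrightarrow> 0" by (rule tendsto_norm_zero_cancel)
  then have "J \<longlonglongrightarrow> I" using tendsto_diff[OF tendsto_const[of I sequentially], of "\<lambda>n. I - J n" 0] by simp
  moreover have "J \<longlonglongrightarrow> ?P *\<^sub>R fc (ufps \<alpha>) r"
  proof -
    have "(\<lambda>k. ?P *\<^sub>R ((fps_nth (ufps \<alpha>) k * of_real r ^ k) *\<^sub>C t ^ k)) sums (?P *\<^sub>R fc (ufps \<alpha>) r)"
      by (intro sums_scaleR_right fc_sums ufps_radius r)
    moreover have "?P *\<^sub>R ((fps_nth (ufps \<alpha>) k * of_real r ^ k) *\<^sub>C t ^ k) = (?P * ((-1) ^ k * (\<alpha> gchoose k))) *\<^sub>R b k" for k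
      unfolding ufps_nth b_def of_real_power[symmetric] of_real_mult[symmetric] scaleC_of_real by (simp add: mult_ac)
    ultimately show ?thesis by (simp add: J_def sums_def)
  qed
  ultimately show ?thesis using I LIMSEQ_unique by blast
qed

text \<open>At r = 1 absolute convergence of the power series is not known, but the integral still
  converges, and \<open>a\<close> is read off from it. Integrating \<open>balak_diff_bound\<close>
  shows that the distance from \<open>fc (ufps \<alpha>) r\<close> to \<open>a\<close> is of order
  \<open>(1 - r) powr \<alpha>\<close>.\<close>

lemma balakrishnan_limit:
  assumes \<alpha>: "0 < \<alpha>" "\<alpha> < 1"
  obtains a where "(balak \<alpha> 1 has_integral (pi / sin (pi * \<alpha>)) *\<^sub>R a) {0<..}"
    "((\<lambda>r. fc (ufps \<alpha>) r) \<longlongrightarrow> a) (at_left 1)"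
proof -
  let ?P = "pi / sin (pi * \<alpha>)"
  have "0 < pi * \<alpha>" "pi * \<alpha> < pi" using \<alpha> by auto
  then have sn: "sin (pi * \<alpha>) > 0" by (intro sin_gt_zero) auto
  then have P: "?P > 0" by simp
  obtain I where I: "(balak \<alpha> 1 has_integral I) {0<..}"
    by (rule balakrishnan_dominated[OF \<alpha> zero_less_one continuous_on_balak[OF zero_le_one order_refl]
          balak_bound[OF zero_le_one order_refl]])
  define a where "a = (1 / ?P) *\<^sub>R I"
  have Ia: "I = ?P *\<^sub>R a" using sn by (simp add: a_def)
  have close: "norm (fc (ufps \<alpha>) r - a) \<le> norm t * K\<^sup>2 * (1 - r) powr \<alpha>" if r: "0 \<le> r" "r < 1" for r
  proof -
    have d: "((\<lambda>s. balak \<alpha> r s - balak \<alpha> 1 s) has_integral (?P *\<^sub>R fc (ufps \<alpha>) r - I)) {0<..}"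
      by (intro has_integral_diff has_integral_balak \<alpha> r I)
    have c: "continuous_on {0<..} (\<lambda>s. balak \<alpha> r s - balak \<alpha> 1 s)"
      using r by (intro continuous_intros continuous_on_balak) auto
    have q: "1 - r > 0" using r by simp
    obtain I' where "((\<lambda>s. balak \<alpha> r s - balak \<alpha> 1 s) has_integral I') {0<..}"
      "norm I' \<le> norm t * K\<^sup>2 * ((1 - r) powr \<alpha> * ?P)"
      by (rule balakrishnan_dominated[OF \<alpha> q c balak_diff_bound[OF r]])
    then have "norm (?P *\<^sub>R (fc (ufps \<alpha>) r - a)) \<le> ?P * (norm t * K\<^sup>2 * (1 - r) powr \<alpha>)"
      using has_integral_unique[OF d] by (simp add: Ia scaleR_diff_right mult_ac)
    then have "?P * norm (fc (ufps \<alpha>) r - a) \<le> ?P * (norm t * K\<^sup>2 * (1 - r) powr \<alpha>)"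
      using P by (simp only: norm_scaleR abs_of_pos)
    then show ?thesis using P by (rule mult_left_le_imp_le)
  qed
  show thesis
  proof (rule that)
    show "(balak \<alpha> 1 has_integral ?P *\<^sub>R a) {0<..}" using I Ia by simp
    show "((\<lambda>r. fc (ufps \<alpha>) r) \<longlongrightarrow> a) (at_left 1)"
    proof (rule Lim_null[THEN iffD2], rule Lim_null_comparison)
      have "((\<lambda>r. norm t * K\<^sup>2 * (1 - r) powr \<alpha>) \<longlongrightarrow> norm t * K\<^sup>2 * 0) (at_left 1)"
        using \<alpha> by (intro tendsto_mult tendsto_const tendsto_zero_powrI)
          (auto intro!: tendsto_eq_intros simp: eventually_at_filter)
      then show "((\<lambda>r. norm t * K\<^sup>2 * (1 - r) powr \<alpha>) \<longlongrightarrow> 0) (at_left 1)" by simp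
      have "eventually (\<lambda>r::real. r \<in> {0<..<1}) (at_left 1)"
        using eventually_at_left_real[of 0 1] by simp
      then show "\<forall>\<^sub>F r in at_left 1. norm (fc (ufps \<alpha>) r - a) \<le> norm t * K\<^sup>2 * (1 - r) powr \<alpha>"
        by eventually_elim (rule close; simp)
    qed
  qed
qed

text \<open>Bounds uniform in r survive the norm limit. Only the inverses need an argument: for
  fixed l they are bounded along a sequence of radii, and the identity
  \<open>R m - R n = R m * (x n - x m) * R n\<close> makes them Cauchy; their limit inverts l +
  a.\<close>

theorem fractional_power_properties:
  assumes \<alpha>: "0 < \<alpha>" "\<alpha> < 1"
  obtains a M where "(balak \<alpha> 1 has_integral (pi / sin (pi * \<alpha>)) *\<^sub>R a) {0<..}"
    "\<And>n. norm ((1 - a) ^ n) \<le> M"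
    "\<And>n. real n * norm (a * (1 - a) ^ n) \<le> M"
    "\<And>\<epsilon>. 0 < \<epsilon> \<Longrightarrow> \<epsilon> < pi - \<alpha> * pi / 2 \<Longrightarrow> \<exists>C. \<forall>l\<in>open_sector (pi - \<alpha> * pi / 2 - \<epsilon>).
       \<exists>R. R * (l *\<^sub>C 1 + a) = 1 \<and> (l *\<^sub>C 1 + a) * R = 1 \<and> cmod l * norm R \<le> C"
proof -
  obtain a where int: "(balak \<alpha> 1 has_integral (pi / sin (pi * \<alpha>)) *\<^sub>R a) {0<..}"
    and lim: "((\<lambda>r. fc (ufps \<alpha>) r) \<longlongrightarrow> a) (at_left 1)"
    by (rule balakrishnan_limit[OF \<alpha>])
  obtain M where M: "\<And>n r. 0 \<le> r \<Longrightarrow> r < 1 \<Longrightarrow> norm ((1 - fc (ufps \<alpha>) r) ^ n) \<le> M"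
    "\<And>n r. 0 \<le> r \<Longrightarrow> r < 1 \<Longrightarrow> real n * norm (fc (ufps \<alpha>) r * (1 - fc (ufps \<alpha>) r) ^ n) \<le> M"
    by (rule fc_one_minus_power_bounds[OF \<alpha>]) (rule that)
  have ev: "eventually (\<lambda>r::real. r \<in> {0<..<1}) (at_left 1)"
    using eventually_at_left_real[of 0 1] by simp
  show thesis
  proof (rule that[OF int])
    fix n
    have "((\<lambda>r. norm ((1 - fc (ufps \<alpha>) r) ^ n)) \<longlongrightarrow> norm ((1 - a) ^ n)) (at_left 1)"
      by (intro tendsto_intros lim)
    then show "norm ((1 - a) ^ n) \<le> M"
      by (rule tendsto_upperbound) (use ev in \<open>auto elim!: eventually_mono intro!: M\<close>)
    have "((\<lambda>r. real n * norm (fc (ufps \<alpha>) r * (1 - fc (ufps \<alpha>) r) ^ n)) \<longlongrightarrow> real n * norm (a * (1 - a) ^ n)) (at_left 1)"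
      by (intro tendsto_intros lim)
    then show "real n * norm (a * (1 - a) ^ n) \<le> M"
      by (rule tendsto_upperbound) (use ev in \<open>auto elim!: eventually_mono intro!: M\<close>)
  next
    fix \<epsilon> assume \<epsilon>: "0 < \<epsilon>" "\<epsilon> < pi - \<alpha> * pi / 2"
    obtain C where C: "\<And>l r. l \<in> open_sector (pi - \<alpha> * pi / 2 - \<epsilon>) \<Longrightarrow> 0 \<le> r \<Longrightarrow> r < 1 \<Longrightarrow>
      \<exists>R. R * (l *\<^sub>C 1 + fc (ufps \<alpha>) r) = 1 \<and> (l *\<^sub>C 1 + fc (ufps \<alpha>) r) * R = 1 \<and> cmod l * norm R \<le> C"
      by (rule fc_resolvent_bound[OF \<alpha> \<epsilon>]) (rule that)
    define x where "x = (\<lambda>n. fc (ufps \<alpha>) (1 - 1 / real (n + 2)))"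
    have "filterlim (\<lambda>n. 1 - 1 / real (n + 2)) (at_left 1) sequentially"
      by (intro filterlim_at_withinI) (real_asymp, auto)
    then have x: "x \<longlonglongrightarrow> a"
      unfolding x_def by (rule filterlim_compose[OF lim])
    have "\<exists>R. R * (l *\<^sub>C 1 + a) = 1 \<and> (l *\<^sub>C 1 + a) * R = 1 \<and> cmod l * norm R \<le> C"
      if l: "l \<in> open_sector (pi - \<alpha> * pi / 2 - \<epsilon>)" for l
    proof -
      have l0: "cmod l > 0" using l by (auto simp: open_sector_def)
      have "\<forall>n. \<exists>R. R * (l *\<^sub>C 1 + x n) = 1 \<and> (l *\<^sub>C 1 + x n) * R = 1 \<and> cmod l * norm R \<le> C"
        unfolding x_def by (intro allI C l) auto
      then obtain R where R: "\<And>n. R n * (l *\<^sub>C 1 + x n) = 1" "\<And>n. (l *\<^sub>C 1 + x n) * R n = 1"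
        "\<And>n. cmod l * norm (R n) \<le> C"
        by metis
      \<comment> \<open>The summand 1 keeps \<open>B\<close> positive even if \<open>C\<close> is 0,
        so that \<open>e / (B * B)\<close> is meaningful.\<close>
      define B where "B = C / cmod l + 1"
      have C0: "C \<ge> 0" using R(3)[of 0] by (rule order_trans[rotated]) simp
      have B: "norm (R n) \<le> B" for n
      proof -
        have "norm (R n) \<le> C / cmod l" using R(3)[of n] l0 by (simp add: pos_le_divide_eq mult.commute)
        then show ?thesis by (simp add: B_def)
      qed
      have B0: "B > 0" using C0 l0 by (simp add: B_def add_nonneg_pos)
      have diff: "norm (R m - R n) \<le> B * B * norm (x m - x n)" for m n
      proof -
        have "R m - R n = R m * ((l *\<^sub>C 1 + x n) * R n) - (R m * (l *\<^sub>C 1 + x m)) * R n"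
          by (simp add: R)
        also have "\<dots> = R m * (x n - x m) * R n"
          by (simp add: algebra_simps)
        also have "norm \<dots> \<le> norm (R m) * norm (x n - x m) * norm (R n)"
          by (meson norm_mult_ineq order_trans mult_right_mono norm_ge_zero)
        also have "\<dots> \<le> B * norm (x n - x m) * B"
          using B B0 by (intro mult_mono) auto
        finally show ?thesis by (simp add: mult_ac norm_minus_commute)
      qed
      have "Cauchy R"
      proof (rule CauchyI)
        fix e :: real assume "e > 0"
        then obtain N where N: "\<And>m n. m \<ge> N \<Longrightarrow> n \<ge> N \<Longrightarrow> norm (x m - x n) < e / (B * B)"
          using CauchyD[OF LIMSEQ_imp_Cauchy[OF x], of "e / (B * B)"] B0 by (auto intro!: divide_pos_pos)
        have "norm (R m - R n) < e" if "m \<ge> N" "n \<ge> N" for m n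
        proof -
          have "B * B * norm (x m - x n) < B * B * (e / (B * B))"
            using B0 by (intro mult_strict_left_mono N that) auto
          also have "\<dots> = e" using B0 by simp
          finally show ?thesis using diff[of m n] by linarith
        qed
        then show "\<exists>M. \<forall>m\<ge>M. \<forall>n\<ge>M. norm (R m - R n) < e" by blast
      qed
      then obtain S where S: "R \<longlonglongrightarrow> S"
        using Cauchy_convergent_iff convergent_def by blast
      have "(\<lambda>n. R n * (l *\<^sub>C 1 + x n)) \<longlonglongrightarrow> S * (l *\<^sub>C 1 + a)"
        "(\<lambda>n. (l *\<^sub>C 1 + x n) * R n) \<longlonglongrightarrow> (l *\<^sub>C 1 + a) * S"
        "(\<lambda>n. cmod l * norm (R n)) \<longlonglongrightarrow> cmod l * norm S"
        by (intro tendsto_intros S x)+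
      then have "S * (l *\<^sub>C 1 + a) = 1" "(l *\<^sub>C 1 + a) * S = 1" "cmod l * norm S \<le> C"
        using R by (auto simp: LIMSEQ_const_iff intro: LIMSEQ_le_const2)
      then show ?thesis by blast
    qed
    then show "\<exists>C. \<forall>l\<in>open_sector (pi - \<alpha> * pi / 2 - \<epsilon>).
       \<exists>R. R * (l *\<^sub>C 1 + a) = 1 \<and> (l *\<^sub>C 1 + a) * R = 1 \<and> cmod l * norm R \<le> C"
      by blast
  qed
qed

end

section \<open>Operators as a complex Banach algebra\<close>

lemma blinfun_eq_iff: "A = B \<longleftrightarrow> (\<forall>x. blinfun_apply A x = blinfun_apply B x)"
  by (auto intro: blinfun_eqI)

lemma blinfun_apply_cscal [simp]: "blinfun_apply (cscal c) x = c *\<^sub>C x"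
  unfolding cscal_def by (simp add: bounded_linear_Blinfun_apply scaleC.bounded_linear_right)

text \<open>Equality follows from the upper bound used for \<open>c\<close> and for its
  reciprocal.\<close>

lemma norm_cscal_compose: "norm (cscal c o\<^sub>L T) = cmod c * norm T"
  for T :: "'a::complex_banach \<Rightarrow>\<^sub>L 'a"
proof -
  have le: "norm (cscal c o\<^sub>L T) \<le> cmod c * norm T" for c :: complex and T :: "'a \<Rightarrow>\<^sub>L 'a"
    by (rule norm_blinfun_bound) (auto simp: norm_scaleC mult.assoc intro!: mult_left_mono norm_blinfun)
  show ?thesis
  proof (cases "c = 0")
    case True
    then show ?thesis using le[of c T] by simp
  next
    case False
    have "T = cscal (1 / c) o\<^sub>L (cscal c o\<^sub>L T)"
      using False by (intro blinfun_eqI) (simp add: scaleC_scaleC scaleC_one)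
    then have "norm T \<le> cmod (1 / c) * norm (cscal c o\<^sub>L T)"
      using le[of "1 / c" "cscal c o\<^sub>L T"] by simp
    then show ?thesis
      using le[of c T] False by (simp add: norm_divide field_simps)
  qed
qed

text \<open>The inverses supplied by \<open>kreiss_op\<close> are a priori only real-linear; this
  brings them into the type \<open>cop\<close>.\<close>

lemma clinear_op_inverse:
  assumes "is_inverse_op R A" "clinear_op A"
  shows "clinear_op R"
  unfolding clinear_op_def
proof (intro allI)
  fix c x
  have RA: "blinfun_apply R (blinfun_apply A y) = y" and AR: "blinfun_apply A (blinfun_apply R y) = y" for y
    using assms(1) by (auto simp: is_inverse_op_def dest!: arg_cong[where f = "\<lambda>T. blinfun_apply T y"])
  have "blinfun_apply R (c *\<^sub>C x) = blinfun_apply R (c *\<^sub>C blinfun_apply A (blinfun_apply R x))"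
    by (simp add: AR)
  also have "\<dots> = c *\<^sub>C blinfun_apply R x"
    using assms(2) RA[of "c *\<^sub>C blinfun_apply R x"] by (simp add: clinear_op_def)
  finally show "blinfun_apply R (c *\<^sub>C x) = c *\<^sub>C blinfun_apply R x" .
qed

lemma op_inverse_eqI:
  assumes "is_inverse_op R A"
  shows "op_inverse A = R"
  unfolding op_inverse_def
proof (rule the_equality)
  show "is_inverse_op R A" by (rule assms)
next
  fix S assume "is_inverse_op S A"
  then have "blinfun_apply S (blinfun_apply A y) = y" "blinfun_apply A (blinfun_apply R y) = y" for y
    using assms by (auto simp: is_inverse_op_def blinfun_eq_iff)
  from this(1)[of "blinfun_apply R x" for x] this(2)
  show "S = R" by (simp add: blinfun_eq_iff)
qed

lemma is_inverse_op_minus: "is_inverse_op R A \<Longrightarrow> is_inverse_op (- R) (- A)"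
  by (simp add: is_inverse_op_def blinfun_eq_iff uminus_blinfun.rep_eq blinfun.minus_right)

text \<open>Elements of \<open>blinfun\<close> are merely real-linear, and
  \<open>scaleC_mult_right\<close> fails for those that do not commute with multiplication by
  \<open>\<i>\<close>. The complex-linear ones form a norm-closed algebra in which the calculus
  applies.\<close>

typedef (overloaded) 'a cop = "{T :: 'a::complex_banach \<Rightarrow>\<^sub>L 'a. clinear_op T}"
  by (rule exI[of _ 0]) (simp add: clinear_op_def scaleC.zero_right)

setup_lifting type_definition_cop

lemma clinear_Rep_cop: "clinear_op (Rep_cop T)"
  using Rep_cop[of T] by simp

instantiation cop :: (complex_banach) real_normed_vector
begin

lift_definition zero_cop :: "'a cop" is 0
  by (simp add: clinear_op_def scaleC.zero_right)
lift_definition plus_cop :: "'a cop \<Rightarrow> 'a cop \<Rightarrow> 'a cop" is "(+)"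
  by (simp add: clinear_op_def plus_blinfun.rep_eq scaleC_add_right)
lift_definition minus_cop :: "'a cop \<Rightarrow> 'a cop \<Rightarrow> 'a cop" is "(-)"
  by (simp add: clinear_op_def minus_blinfun.rep_eq scaleC.diff_right)
lift_definition uminus_cop :: "'a cop \<Rightarrow> 'a cop" is uminus
  by (simp add: clinear_op_def uminus_blinfun.rep_eq scaleC.minus_right)
lift_definition scaleR_cop :: "real \<Rightarrow> 'a cop \<Rightarrow> 'a cop" is scaleR
  by (simp add: clinear_op_def scaleR_blinfun.rep_eq scaleC.scaleR_right)
lift_definition norm_cop :: "'a cop \<Rightarrow> real" is norm .
definition sgn_cop :: "'a cop \<Rightarrow> 'a cop" where "sgn_cop x = scaleR (inverse (norm x)) x"
definition dist_cop :: "'a cop \<Rightarrow> 'a cop \<Rightarrow> real" where "dist_cop x y = norm (x - y)"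
definition uniformity_cop :: "('a cop \<times> 'a cop) filter" where
  "uniformity_cop = (INF e\<in>{0<..}. principal {(x, y). dist x y < e})"
definition open_cop :: "'a cop set \<Rightarrow> bool" where
  "open_cop U = (\<forall>x\<in>U. \<forall>\<^sub>F (x', y) in uniformity. x' = x \<longrightarrow> y \<in> U)"

instance
proof
  fix x y z :: "'a cop" and a b :: real
  show "x + y + z = x + (y + z)" by transfer simp
  show "x + y = y + x" by transfer simp
  show "0 + x = x" by transfer simp
  show "- x + x = 0" by transfer simp
  show "x - y = x + - y" by transfer simp
  show "a *\<^sub>R (x + y) = a *\<^sub>R x + a *\<^sub>R y" by transfer (rule scaleR_add_right)
  show "(a + b) *\<^sub>R x = a *\<^sub>R x + b *\<^sub>R x" by transfer (rule scaleR_add_left)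
  show "a *\<^sub>R b *\<^sub>R x = (a * b) *\<^sub>R x" by transfer simp
  show "1 *\<^sub>R x = x" by transfer simp
  show "(norm x = 0) = (x = 0)" by transfer simp
  show "norm (x + y) \<le> norm x + norm y" by transfer (rule norm_triangle_ineq)
  show "norm (a *\<^sub>R x) = \<bar>a\<bar> * norm x" by transfer simp
qed (auto simp: dist_cop_def sgn_cop_def uniformity_cop_def open_cop_def)

end

lemma dist_Rep_cop: "dist (Rep_cop x) (Rep_cop y) = dist x y"
  by (simp add: dist_cop_def dist_norm norm_cop.rep_eq minus_cop.rep_eq)

instance cop :: (complex_banach) banach
proof
  fix X :: "nat \<Rightarrow> 'a cop" assume "Cauchy X"
  then have "Cauchy (\<lambda>n. Rep_cop (X n))"
    by (simp add: Cauchy_def dist_Rep_cop)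
  then obtain L where L: "(\<lambda>n. Rep_cop (X n)) \<longlonglongrightarrow> L"
    by (auto simp: Cauchy_convergent_iff convergent_def)
  have "clinear_op L"
    unfolding clinear_op_def
  proof (intro allI)
    fix c x
    have "(\<lambda>n. blinfun_apply (Rep_cop (X n)) (c *\<^sub>C x)) \<longlonglongrightarrow> blinfun_apply L (c *\<^sub>C x)"
      by (intro tendsto_intros L)
    moreover have "(\<lambda>n. c *\<^sub>C blinfun_apply (Rep_cop (X n)) x) \<longlonglongrightarrow> c *\<^sub>C blinfun_apply L x"
      by (intro scaleC.tendsto tendsto_intros L)
    moreover have "blinfun_apply (Rep_cop (X n)) (c *\<^sub>C x) = c *\<^sub>C blinfun_apply (Rep_cop (X n)) x" for n
      using clinear_Rep_cop[of "X n"] by (simp add: clinear_op_def)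
    ultimately show "blinfun_apply L (c *\<^sub>C x) = c *\<^sub>C blinfun_apply L x"
      using LIMSEQ_unique by simp
  qed
  then have "dist (X n) (Abs_cop L) = dist (Rep_cop (X n)) L" for n
    using dist_Rep_cop[of "X n" "Abs_cop L"] by (simp add: Abs_cop_inverse)
  then have "X \<longlonglongrightarrow> Abs_cop L"
    using L unfolding tendsto_iff by simp
  then show "convergent X" by (auto simp: convergent_def)
qed

instantiation cop :: (complex_banach) complex_banach_algebra
begin

lift_definition one_cop :: "'a cop" is id_blinfun
  by (simp add: clinear_op_def)
lift_definition times_cop :: "'a cop \<Rightarrow> 'a cop \<Rightarrow> 'a cop" is "(o\<^sub>L)"
  by (simp add: clinear_op_def)
lift_definition scaleC_cop :: "complex \<Rightarrow> 'a cop \<Rightarrow> 'a cop" is "\<lambda>c T. cscal c o\<^sub>L T"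
  by (simp add: clinear_op_def scaleC_scaleC mult.commute)

instance
proof
  fix x y z :: "'a cop" and a b :: complex and r :: real
  show "x * y * z = x * (y * z)" by transfer (rule blinfun_eqI, simp)
  show "(x + y) * z = x * z + y * z" by transfer (rule blinfun_eqI, simp add: plus_blinfun.rep_eq)
  show "x * (y + z) = x * y + x * z" by transfer (rule blinfun_eqI, simp add: plus_blinfun.rep_eq blinfun.add_right)
  show "r *\<^sub>R x * y = r *\<^sub>R (x * y)" by transfer (rule blinfun_eqI, simp add: scaleR_blinfun.rep_eq)
  show "x * r *\<^sub>R y = r *\<^sub>R (x * y)" by transfer (rule blinfun_eqI, simp add: scaleR_blinfun.rep_eq blinfun.scaleR_right)
  show "norm (x * y) \<le> norm x * norm y" by transfer (rule norm_blinfun_compose)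
  show "1 * x = x" by transfer (rule blinfun_eqI, simp)
  show "x * 1 = x" by transfer (rule blinfun_eqI, simp)
  show "a *\<^sub>C (x + y) = a *\<^sub>C x + a *\<^sub>C y"
    by transfer (rule blinfun_eqI, simp add: plus_blinfun.rep_eq scaleC_add_right)
  show "(a + b) *\<^sub>C x = a *\<^sub>C x + b *\<^sub>C x"
    by transfer (rule blinfun_eqI, simp add: plus_blinfun.rep_eq scaleC_add_left)
  show "a *\<^sub>C b *\<^sub>C x = (a * b) *\<^sub>C x"
    by transfer (rule blinfun_eqI, simp add: scaleC_scaleC)
  show "1 *\<^sub>C x = x" by transfer (rule blinfun_eqI, simp add: scaleC_one)
  show "complex_of_real r *\<^sub>C x = r *\<^sub>R x"
    by transfer (rule blinfun_eqI, simp add: scaleR_blinfun.rep_eq scaleC_of_real)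
  show "norm (a *\<^sub>C x) = cmod a * norm x" by transfer (rule norm_cscal_compose)
  show "a *\<^sub>C x * y = a *\<^sub>C (x * y)" by transfer (rule blinfun_eqI, simp)
  show "x * a *\<^sub>C y = a *\<^sub>C (x * y)"
    by transfer (rule blinfun_eqI, simp add: clinear_op_def)
qed

end

lemma bounded_linear_Rep_cop: "bounded_linear Rep_cop"
  by (rule bounded_linear_intro[where K = 1])
     (simp_all add: plus_cop.rep_eq scaleR_cop.rep_eq norm_cop.rep_eq)

lemma is_inverse_op_Rep_cop: "is_inverse_op (Rep_cop R) (Rep_cop A) \<longleftrightarrow> R * A = 1 \<and> A * R = 1"
  unfolding is_inverse_op_def by transfer simp

lemma Rep_cop_scaleC_one: "Rep_cop (l *\<^sub>C 1) = cscal l"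
  by (rule blinfun_eqI) (simp add: scaleC_cop.rep_eq one_cop.rep_eq)

lemma op_pow_Rep_cop: "op_pow (Rep_cop x) n = Rep_cop (x ^ n)"
  by (induction n) (simp_all add: one_cop.rep_eq times_cop.rep_eq)

text \<open>The spectral inclusion follows from the resolvent condition: if l is outside the closed
  sector, then -l lies in one of the open sectors, with \<epsilon> half the remaining angle, and an
  inverse of -l + V is up to sign an inverse of l - V.\<close>

lemma op_of_typeI:
  fixes V :: "'a::complex_banach \<Rightarrow>\<^sub>L 'a"
  assumes \<omega>: "0 \<le> \<omega>" "\<omega> < pi"
    and res: "\<And>\<epsilon>. 0 < \<epsilon> \<Longrightarrow> \<epsilon> < pi - \<omega> \<Longrightarrow> \<exists>M. \<forall>l\<in>open_sector (pi - \<omega> - \<epsilon>).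
            \<exists>R. is_inverse_op R (cscal l + V) \<and> norm (cscal l o\<^sub>L R) \<le> M"
  shows "op_of_type V \<omega>"
  unfolding op_of_type_def
proof (intro conjI allI impI subsetI)
  fix l assume l: "l \<in> op_spectrum V"
  show "l \<in> closed_sector \<omega>"
  proof (rule ccontr)
    assume "l \<notin> closed_sector \<omega>"
    then have l0: "l \<noteq> 0" and "\<bar>Arg l\<bar> > \<omega>" by (auto simp: closed_sector_def)
    then have "\<bar>Arg (- l)\<bar> < pi - \<omega>"
      using Arg_minus[OF l0] Arg_le_pi[of l] mpi_less_Arg[of l] by (auto split: if_splits)
    define \<epsilon> where "\<epsilon> = (pi - \<omega> - \<bar>Arg (- l)\<bar>) / 2"
    have "0 < \<epsilon>" "\<epsilon> < pi - \<omega>" "\<bar>Arg (- l)\<bar> < pi - \<omega> - \<epsilon>"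
      using \<open>\<bar>Arg (- l)\<bar> < pi - \<omega>\<close> \<omega> by (auto simp: \<epsilon>_def field_simps)
    moreover from this have "- l \<in> open_sector (pi - \<omega> - \<epsilon>)"
      using l0 by (simp add: open_sector_def)
    ultimately obtain R where R: "is_inverse_op R (cscal (- l) + V)"
      using res[of \<epsilon>] by blast
    have "- (cscal (- l) + V) = cscal l - V"
      by (rule blinfun_eqI) (simp add: plus_blinfun.rep_eq minus_blinfun.rep_eq uminus_blinfun.rep_eq scaleC.minus_left)
    then have "is_inverse_op (- R) (cscal l - V)"
      using is_inverse_op_minus[OF R] by simp
    with l show False by (auto simp: op_spectrum_def)
  qed
qed (use res in auto)

text \<open>In this sector \<open>cos (Arg l) \<ge> sin \<epsilon>\<close>, and the law of cosines
  does the rest. It puts l + 1 at distance at least \<open>sin \<epsilon> * cmod l\<close> outside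
  the unit circle.\<close>

lemma norm_one_plus_sector_ge:
  assumes "l \<in> open_sector (pi / 2 - \<epsilon>)" "0 < \<epsilon>" "\<epsilon> < pi / 2"
  shows "1 + sin \<epsilon> * cmod l \<le> cmod (l + 1)"
proof -
  have l: "l = of_real (cmod l) * cis (Arg l)" and Arg: "\<bar>Arg l\<bar> < pi / 2 - \<epsilon>"
    using Arg_eq[of l] assms by (auto simp: open_sector_def cis_conv_exp)
  have "cos (pi / 2 - \<epsilon>) \<le> cos \<bar>Arg l\<bar>"
    using Arg assms by (intro cos_monotone_0_pi_le) auto
  then have c: "sin \<epsilon> \<le> cos (Arg l)" by (simp add: cos_diff)
  have s: "0 \<le> sin \<epsilon>" "sin \<epsilon> \<le> 1" using assms by (auto intro!: sin_ge_zero)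
  have "(1 + sin \<epsilon> * cmod l)\<^sup>2 = 1 + 2 * cmod l * sin \<epsilon> + (sin \<epsilon>)\<^sup>2 * (cmod l)\<^sup>2"
    by (simp add: power2_eq_square algebra_simps)
  also have "\<dots> \<le> 1 + 2 * cmod l * cos (Arg l) + 1 * (cmod l)\<^sup>2"
    using c s by (intro add_mono mult_left_mono mult_right_mono) (auto intro: power_le_one)
  also have "\<dots> = (cmod (l + 1))\<^sup>2"
    using norm_add_polar[of "cmod l" "Arg l" 1 0] by (subst (3) l) simp
  finally show ?thesis by (rule power2_le_imp_le) simp
qed

section \<open>Fractional powers of Kreiss operators\<close>

lemma kreiss_Abs_cop:
  assumes T: "clinear_op T" and "kreiss_op T"
  obtains K where "kreiss (Abs_cop T) K"
proof -
  obtain c where "c > 0" and c: "\<And>l. cmod l > 1 \<Longrightarrow>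
      \<exists>R. is_inverse_op R (cscal l - T) \<and> norm R \<le> c / (cmod l - 1)"
    using assms(2) by (auto simp: kreiss_op_def)
  define t where "t = Abs_cop T"
  have t: "Rep_cop t = T" using T by (simp add: t_def Abs_cop_inverse)
  \<comment> \<open>At z = 0 there is no \<open>l = 1 / z\<close>; the maximum with
    \<open>norm 1\<close> covers the inverse 1 there without a limit argument.\<close>
  define K where "K = max c (norm (1::'a cop))"
  have "kreiss t K"
  proof
    fix z assume z: "cmod z < 1"
    show "\<exists>N. N * (1 - z *\<^sub>C t) = 1 \<and> (1 - z *\<^sub>C t) * N = 1 \<and> norm N \<le> K / (1 - cmod z)"
    proof (cases "z = 0")
      case True
      then show ?thesis by (intro exI[of _ 1]) (simp add: scaleC.zero_left K_def)
    next
      case False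
      define l where "l = 1 / z"
      have l: "cmod l > 1" "l * z = 1" using z False by (auto simp: l_def norm_divide)
      obtain R where R: "is_inverse_op R (cscal l - T)" "norm R \<le> c / (cmod l - 1)"
        using c[OF l(1)] by blast
      have rep: "cscal l - T = Rep_cop (l *\<^sub>C 1 - t)"
        by (simp add: minus_cop.rep_eq Rep_cop_scaleC_one t)
      define S where "S = Abs_cop R"
      have S: "Rep_cop S = R"
        using clinear_op_inverse[OF R(1)[unfolded rep] clinear_Rep_cop] by (simp add: S_def Abs_cop_inverse)
      have inv: "S * (l *\<^sub>C 1 - t) = 1" "(l *\<^sub>C 1 - t) * S = 1"
        using R(1) is_inverse_op_Rep_cop[of S "l *\<^sub>C 1 - t"] by (simp_all add: S rep)
      have eq: "1 - z *\<^sub>C t = z *\<^sub>C (l *\<^sub>C 1 - t)"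
        using l(2) by (simp add: scaleC.diff_right scaleC_simps mult.commute)
      have "norm (l *\<^sub>C S) = cmod l * norm R"
        unfolding norm_scaleC by (simp add: norm_cop.rep_eq S)
      also have "\<dots> \<le> cmod l * (c / (cmod l - 1))"
        by (intro mult_left_mono R) auto
      also have "\<dots> = c / (1 - cmod z)"
        using False z by (simp add: l_def norm_divide field_simps)
      also have "\<dots> \<le> K / (1 - cmod z)"
        using z by (intro divide_right_mono) (auto simp: K_def)
      finally show ?thesis
        using inv l(2) by (intro exI[of _ "l *\<^sub>C S"]) (simp add: eq scaleC_simps mult.commute)
    qed
  qed
  then show thesis using that by (simp add: t_def)
qed

text \<open>The two integrands agree through \<open>N * (1 - t) = 1 - s *\<^sub>R N\<close>, where
  \<open>N\<close> inverts s + 1 - t. The integral is computed in the algebra \<open>cop\<close> and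
  carried to operators by the bounded linear map \<open>Rep_cop\<close>.\<close>

lemma frac_pow_eq_balakrishnan:
  assumes "kreiss t K" and \<alpha>: "0 < \<alpha>" "\<alpha> < 1"
    and int: "(kreiss.balak t K \<alpha> 1 has_integral (pi / sin (pi * \<alpha>)) *\<^sub>R a) {0<..}"
  shows "frac_pow (id_blinfun - Rep_cop t) \<alpha> = Rep_cop a"
proof -
  interpret kreiss t K by fact
  let ?V = "id_blinfun - Rep_cop t"
  have "(s powr (\<alpha> - 1)) *\<^sub>R (op_inverse (cscal (of_real s) + ?V) o\<^sub>L ?V) = Rep_cop (balak \<alpha> 1 s)"
    if s: "s > 0" for s
  proof -
    let ?R = "res (of_real (1 / (1 + s)))"
    define N where "N = (1 / (1 + s)) *\<^sub>R ?R"
    have z: "cmod (of_real (1 / (1 + s))) < 1" using norm_res_real_bound(1)[of 1 s] s by simp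
    have eq: "s *\<^sub>R 1 + (1 - t) = (1 + s) *\<^sub>R (1 - of_real (1 / (1 + s)) *\<^sub>C t)"
      using s by (simp only: scaleC_of_real scaleR_diff_right scaleR_scaleR) (simp add: scaleR_add_left)
    have N: "N * (s *\<^sub>R 1 + (1 - t)) = 1" "(s *\<^sub>R 1 + (1 - t)) * N = 1"
      unfolding eq N_def using res_left[OF z] res_right[OF z] s by simp_all
    have rep: "cscal (of_real s) + ?V = Rep_cop (s *\<^sub>R 1 + (1 - t))"
      by (simp add: plus_cop.rep_eq minus_cop.rep_eq one_cop.rep_eq Rep_cop_scaleC_one flip: scaleC_of_real)
    have "op_inverse (cscal (of_real s) + ?V) = Rep_cop N"
      unfolding rep using N by (intro op_inverse_eqI) (simp add: is_inverse_op_Rep_cop)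
    then have "op_inverse (cscal (of_real s) + ?V) o\<^sub>L ?V = Rep_cop (N * (1 - t))"
      by (simp add: times_cop.rep_eq minus_cop.rep_eq one_cop.rep_eq)
    also have "N * (1 - t) = 1 - s *\<^sub>R N"
      using N(1) by (simp add: distrib_left eq_diff_eq add.commute)
    finally show ?thesis
      by (simp add: balak_def N_def scaleR_cop.rep_eq)
  qed
  then have "((\<lambda>s. (s powr (\<alpha> - 1)) *\<^sub>R (op_inverse (cscal (of_real s) + ?V) o\<^sub>L ?V)) has_integral
      Rep_cop ((pi / sin (pi * \<alpha>)) *\<^sub>R a)) {0<..}"
    using has_integral_linear[OF int bounded_linear_Rep_cop] by (subst has_integral_cong) (auto simp: o_def)
  then have "frac_pow ?V \<alpha> = (sin (\<alpha> * pi) / pi) *\<^sub>R Rep_cop ((pi / sin (pi * \<alpha>)) *\<^sub>R a)"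
    using \<alpha> by (simp add: frac_pow_def integral_unique)
  moreover have "0 < pi * \<alpha>" "pi * \<alpha> < pi" using \<alpha> by auto
  then have "sin (pi * \<alpha>) > 0" by (intro sin_gt_zero) auto
  ultimately show ?thesis by (simp add: scaleR_cop.rep_eq mult.commute)
qed

text \<open>The exponent 1 is out of reach of the calculus, whose constants contain
  \<open>1 / (1 - \<alpha>)\<close>. Here the Kreiss condition at l + 1 is enough, because
  \<open>cmod (l + 1) - 1\<close> is at least \<open>sin \<epsilon> * cmod l\<close>.\<close>

lemma kreiss_op_one_minus_type:
  assumes "kreiss_op T"
  shows "op_of_type (id_blinfun - T) (pi / 2)"
proof (rule op_of_typeI)
  obtain c where "c > 0" and c: "\<And>l. cmod l > 1 \<Longrightarrow>
      \<exists>R. is_inverse_op R (cscal l - T) \<and> norm R \<le> c / (cmod l - 1)"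
    using assms by (auto simp: kreiss_op_def)
  fix \<epsilon> assume \<epsilon>: "0 < \<epsilon>" "\<epsilon> < pi - pi / 2"
  show "\<exists>M. \<forall>l\<in>open_sector (pi - pi / 2 - \<epsilon>).
      \<exists>R. is_inverse_op R (cscal l + (id_blinfun - T)) \<and> norm (cscal l o\<^sub>L R) \<le> M"
  proof (intro exI[of _ "c / sin \<epsilon>"] ballI)
    fix l assume l: "l \<in> open_sector (pi - pi / 2 - \<epsilon>)"
    have l0: "cmod l > 0" using l by (auto simp: open_sector_def)
    have s: "sin \<epsilon> > 0" using \<epsilon> by (intro sin_gt_zero) auto
    have ge: "1 + sin \<epsilon> * cmod l \<le> cmod (l + 1)"
      using l \<epsilon> by (intro norm_one_plus_sector_ge) auto
    have pos: "sin \<epsilon> * cmod l > 0" using s l0 by simp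
    obtain R where R: "is_inverse_op R (cscal (l + 1) - T)" "norm R \<le> c / (cmod (l + 1) - 1)"
      using c[of "l + 1"] ge pos by auto
    have "cscal (l + 1) - T = cscal l + (id_blinfun - T)"
      by (rule blinfun_eqI) (simp add: plus_blinfun.rep_eq minus_blinfun.rep_eq scaleC_add_left scaleC_one)
    moreover have "norm (cscal l o\<^sub>L R) \<le> c / sin \<epsilon>"
    proof -
      have "norm R \<le> c / (sin \<epsilon> * cmod l)"
        using ge pos \<open>c > 0\<close> by (intro order_trans[OF R(2)] divide_left_mono) auto
      then have "cmod l * norm R \<le> cmod l * (c / (sin \<epsilon> * cmod l))"
        by (intro mult_left_mono) auto
      then show ?thesis using l0 by (simp add: norm_cscal_compose)
    qed
    ultimately show "\<exists>R. is_inverse_op R (cscal l + (id_blinfun - T)) \<and> norm (cscal l o\<^sub>L R) \<le> c / sin \<epsilon>"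
      using R(1) by metis
  qed
qed auto

theorem theorem7p2:
  fixes T :: "'a::complex_banach \<Rightarrow>\<^sub>L 'a"
  assumes "clinear_op T"
    and "kreiss_op T"
  shows "(\<forall>\<alpha>. 0 < \<alpha> \<and> \<alpha> \<le> 1 \<longrightarrow> op_of_type (frac_pow (id_blinfun - T) \<alpha>) (\<alpha> * pi / 2))
    \<and> (\<forall>\<alpha>. 0 < \<alpha> \<and> \<alpha> < 1 \<longrightarrow> ritt_op (id_blinfun - frac_pow (id_blinfun - T) \<alpha>))"
proof -
  obtain K where "kreiss (Abs_cop T) K"
    using kreiss_Abs_cop[OF assms] .
  then interpret kreiss "Abs_cop T" K .
  have T: "Rep_cop (Abs_cop T) = T" using assms(1) by (simp add: Abs_cop_inverse)
  have main: "op_of_type (frac_pow (id_blinfun - T) \<alpha>) (\<alpha> * pi / 2) \<and>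
      ritt_op (id_blinfun - frac_pow (id_blinfun - T) \<alpha>)" if \<alpha>: "0 < \<alpha>" "\<alpha> < 1" for \<alpha>
  proof -
    obtain a M where int: "(balak \<alpha> 1 has_integral (pi / sin (pi * \<alpha>)) *\<^sub>R a) {0<..}"
      and M1: "\<And>n. norm ((1 - a) ^ n) \<le> M" and M2: "\<And>n. real n * norm (a * (1 - a) ^ n) \<le> M"
      and sect: "\<And>\<epsilon>. 0 < \<epsilon> \<Longrightarrow> \<epsilon> < pi - \<alpha> * pi / 2 \<Longrightarrow> \<exists>C. \<forall>l\<in>open_sector (pi - \<alpha> * pi / 2 - \<epsilon>).
         \<exists>R. R * (l *\<^sub>C 1 + a) = 1 \<and> (l *\<^sub>C 1 + a) * R = 1 \<and> cmod l * norm R \<le> C"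
      by (rule fractional_power_properties[OF \<alpha>]) (rule that)
    have frac: "frac_pow (id_blinfun - T) \<alpha> = Rep_cop a"
      using frac_pow_eq_balakrishnan[OF kreiss_axioms \<alpha> int] by (simp add: T)
    have "op_of_type (Rep_cop a) (\<alpha> * pi / 2)"
    proof (rule op_of_typeI)
      have "\<alpha> * pi < 1 * pi" using \<alpha> by (intro mult_strict_right_mono) auto
      moreover have "0 < \<alpha> * pi" using \<alpha> by simp
      ultimately show "0 \<le> \<alpha> * pi / 2" "\<alpha> * pi / 2 < pi" by linarith+
      fix \<epsilon> assume "0 < \<epsilon>" "\<epsilon> < pi - \<alpha> * pi / 2"
      then obtain C where C: "\<And>l. l\<in>open_sector (pi - \<alpha> * pi / 2 - \<epsilon>) \<Longrightarrow>
         \<exists>R. R * (l *\<^sub>C 1 + a) = 1 \<and> (l *\<^sub>C 1 + a) * R = 1 \<and> cmod l * norm R \<le> C"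
        using sect by blast
      show "\<exists>M. \<forall>l\<in>open_sector (pi - \<alpha> * pi / 2 - \<epsilon>).
          \<exists>R. is_inverse_op R (cscal l + Rep_cop a) \<and> norm (cscal l o\<^sub>L R) \<le> M"
      proof (intro exI[of _ C] ballI)
        fix l assume "l \<in> open_sector (pi - \<alpha> * pi / 2 - \<epsilon>)"
        from C[OF this] obtain R where R: "R * (l *\<^sub>C 1 + a) = 1" "(l *\<^sub>C 1 + a) * R = 1" "cmod l * norm R \<le> C"
          by blast
        have "cscal l + Rep_cop a = Rep_cop (l *\<^sub>C 1 + a)"
          by (simp add: plus_cop.rep_eq Rep_cop_scaleC_one)
        then have "is_inverse_op (Rep_cop R) (cscal l + Rep_cop a)"
          using R by (simp add: is_inverse_op_Rep_cop)
        moreover have "norm (cscal l o\<^sub>L Rep_cop R) \<le> C"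
          using R(3) by (simp add: norm_cscal_compose norm_cop.rep_eq)
        ultimately show "\<exists>R. is_inverse_op R (cscal l + Rep_cop a) \<and> norm (cscal l o\<^sub>L R) \<le> C"
          by blast
      qed
    qed
    moreover have "ritt_op (id_blinfun - Rep_cop a)"
    proof -
      have S: "id_blinfun - Rep_cop a = Rep_cop (1 - a)"
        by (simp add: minus_cop.rep_eq one_cop.rep_eq)
      have "power_bounded (Rep_cop (1 - a))"
        unfolding power_bounded_def bounded_iff op_pow_Rep_cop
        using M1 by (auto simp: norm_cop.rep_eq)
      moreover have "real n * norm (op_pow (Rep_cop (1 - a)) n - op_pow (Rep_cop (1 - a)) (Suc n)) \<le> M" for n
      proof -
        have "op_pow (Rep_cop (1 - a)) n - op_pow (Rep_cop (1 - a)) (Suc n) = Rep_cop (a * (1 - a) ^ n)"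
          unfolding op_pow_Rep_cop minus_cop.rep_eq[symmetric] by (simp add: left_diff_distrib)
        then show ?thesis using M2[of n] by (simp add: norm_cop.rep_eq)
      qed
      ultimately show ?thesis unfolding S ritt_op_def by blast
    qed
    ultimately show ?thesis by (simp only: frac)
  qed
  moreover have "op_of_type (frac_pow (id_blinfun - T) 1) (1 * pi / 2)"
    using kreiss_op_one_minus_type[OF assms(2)] by (simp add: frac_pow_def)
  ultimately show ?thesis by (metis less_eq_real_def)
qed

end
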